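(* Let $k$ be a field and $H$ a finite dimensional Hopf algebra over $k$ with antipode $S$. Let $X=(H^{op}\otimes H)\underline{\otimes}(H^*\otimes H^{*op})$ and let $Z=(H^*\otimes H^{*op})\bowtie(H\otimes H^{op})$ be the diagonal crossed product. Then $X$ and $Z$ are isomorphic as algebras via the mutually inverse maps $\beta:X\to Z$, $\beta^{-1}:Z\to X$, $$\beta((g\otimes h)\underline{\otimes}(p\otimes q))=\sum (h_1\rightharpoonup p\leftharpoonup g_1\otimes h_3\rightharpoonup q\leftharpoonup g_3)\bowtie(h_2\otimes g_2),$$ $$\beta^{-1}((p\otimes q)\bowtie(h\otimes g))=\sum (g_2\otimes h_2)\underline{\otimes}(S^{-1}(h_1)\rightharpoonup p\leftharpoonup S(g_1)\otimes S(h_3)\rightharpoonup q\leftharpoonup S^{-1}(g_3)),$$ and, if $M$ is an $H^*$-Hopf bimodule, the actions of $X$ and $Z$ on $M$ correspond via these isomorphisms, i.e. $x\cdot m=\beta(x)\cdot m$ for all $x\in X$, $m\in M$.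
   Context: Everything is over a fixed field $k$, $\otimes=\otimes_k$, and Sweedler notation is used. The antipode $S$ is bijective since $H$ is finite dimensional; $H^*$ is the dual Hopf algebra, with $(pq)(h)=\sum p(h_1)q(h_2)$ and $\sum p_1(h)p_2(h')=p(hh')$. $H^{op}$, $H^{*op}$ denote opposite algebras. Regular actions of $H$ on $H^*$: $(h\rightharpoonup f)(h')=f(h'h)$ and $(f\leftharpoonup h')(h)=f(h'h)$. The algebra $X$ (Cibils–Rosso) has underlying space $H\otimes H\otimes H^*\otimes H^*$, elements written $(g\otimes h)\underline{\otimes}(p\otimes q)$. Its multiplication is determined by: $H^{op}\otimes H$ and $H^*\otimes H^{*op}$ (embedded as $(g\otimes h)\underline{\otimes}(1\otimes1)$ and $(1\otimes 1)\underline{\otimes}(p\otimes q)$) are subalgebras with their natural tensor product multiplications; $(g\otimes h)\underline{\otimes}(p\otimes q)=((g\otimes h)\underline{\otimes}(1\otimes1))((1\otimes1)\underline{\otimes}(p\otimes q))$; and $$((1\otimes1)\underline{\otimes}(p\otimes q))((g\otimes h)\underline{\otimes}(1\otimes1))=\sum (g_2\otimes h_2)\underline{\otimes}(S^{-1}(h_1)\rightharpoonup p\leftharpoonup S(g_1)\otimes S(h_3)\rightharpoonup q\leftharpoonup S^{-1}(g_3)).$$ The algebra $Z$ has underlying space $(H^*\otimes H^* )\otimes(H\otimes H)$, elements written $(p\otimes q)\bowtie(h\otimes g)$, unit $(1\otimes1)\bowtie(1\otimes1)$, and multiplication $$((p\otimes q)\bowtie(h\otimes g))((p'\otimes q')\bowtie(h'\otimes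 g'))=\sum (p(h_1\rightharpoonup p'\leftharpoonup g_1)\otimes(h_3\rightharpoonup q'\leftharpoonup g_3)q)\bowtie(h_2h'\otimes g'g_2),$$ products on the right being taken in $H^*$ and $H$ (not in the opposite algebras). A Hopf bimodule over $H^*$ is a vector space $M$ that is an $H^*$-bimodule (actions $p\cdot m$, $m\cdot q$) and an $H^*$-bicomodule, with coaction $M\to H^*\otimes M\otimes H^*$, $m\mapsto\sum m_{(-1)}\otimes m_{(0)}\otimes m_{(1)}$, such that the left and right coactions are $H^*$-bimodule maps, i.e. $\sum (p\cdot m\cdot q)_{(-1)}\otimes (p\cdot m\cdot q)_{(0)}\otimes (p\cdot m\cdot q)_{(1)}=\sum p_1m_{(-1)}q_1\otimes p_2\cdot m_{(0)}\cdot q_2\otimes p_3m_{(1)}q_3$. Such an $M$ is a left $X$-module by $$((g\otimes h)\underline{\otimes}(p\otimes q))\cdot m=\sum m_{(-1)}(g_2)m_{(1)}(h_2)(h_1\rightharpoonup p\leftharpoonup g_1)\cdot m_{(0)}\cdot(h_3\rightharpoonup q\leftharpoonup g_3)$$ and a left $Z$-module by $$((p\otimes q)\bowtie(h\otimes g))\cdot m=\sum m_{(-1)}(g)m_{(1)}(h)\,p\cdot m_{(0)}\cdot q.$$ *)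

theory Defs
  imports Complex_Main "HOL-Library.Function_Algebras"
begin

section \<open>Vector spaces, linear maps, tensor products\<close>

text \<open>
  A vector space is a subspace \<open>vcar V\<close> of an ambient type carrying an abelian group structure,
  with scalar multiplication \<open>vscale V\<close>. Function types carry the pointwise
  group structure of \<^theory>\<open>HOL-Library.Function_Algebras\<close>; the pointwise product of functions is never used.
\<close>

record ('k, 'a) vspace =
  vcar :: "'a set"
  vscale :: "'k \<Rightarrow> 'a \<Rightarrow> 'a"

definition vec_space :: "('k::field, 'a::ab_group_add, 'z) vspace_scheme \<Rightarrow> bool" where
  "vec_space V \<longleftrightarrow> vector_space (vscale V) \<and> module.subspace (vscale V) (vcar V)"

definition linear_map ::
  "('k, 'a::ab_group_add, 'y) vspace_scheme \<Rightarrow> ('k, 'b::ab_group_add, 'z) vspace_scheme \<Rightarrow> ('a \<Rightarrow> 'b) \<Rightarrow> bool" where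
  "linear_map V W f \<longleftrightarrow>
     (\<forall>x\<in>vcar V. f x \<in> vcar W) \<and>
     (\<forall>x\<in>vcar V. \<forall>y\<in>vcar V. f (x + y) = f x + f y) \<and>
     (\<forall>c. \<forall>x\<in>vcar V. f (vscale V c x) = vscale W c (f x))"

definition bilinear_map ::
  "('k, 'a::ab_group_add, 'x) vspace_scheme \<Rightarrow> ('k, 'b::ab_group_add, 'y) vspace_scheme \<Rightarrow>
   ('k, 'c::ab_group_add, 'z) vspace_scheme \<Rightarrow> ('a \<Rightarrow> 'b \<Rightarrow> 'c) \<Rightarrow> bool" where
  "bilinear_map U V W f \<longleftrightarrow>
     (\<forall>u\<in>vcar U. linear_map V W (f u)) \<and> (\<forall>v\<in>vcar V. linear_map U W (\<lambda>u. f u v))"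

definition ground :: "('k::field, 'k) vspace" where
  "ground = \<lparr>vcar = UNIV, vscale = (*)\<rparr>"

definition fscale :: "'k::field \<Rightarrow> ('a \<Rightarrow> 'k) \<Rightarrow> 'a \<Rightarrow> 'k" where
  "fscale c f = (\<lambda>x. c * f x)"

text \<open>
  Over a field the tensor product of \<open>U\<close> and \<open>V\<close> embeds into the dual of the space of bilinear
  forms on \<open>U \<times> V\<close>, with \<open>u \<otimes> v\<close> acting as evaluation at \<open>(u, v)\<close>. It is
  realised here as the span of these evaluations (a functional is set to \<open>0\<close> on functions
  that are not bilinear). Theorem \<open>tensor_universal\<close> below is the universal property.
\<close>

type_synonym ('k, 'u, 'v) tens = "('u \<Rightarrow> 'v \<Rightarrow> 'k) \<Rightarrow> 'k"

definition pure_tensor ::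
  "('k::field, 'u::ab_group_add, 'y) vspace_scheme \<Rightarrow> ('k, 'v::ab_group_add, 'z) vspace_scheme \<Rightarrow>
   'u \<Rightarrow> 'v \<Rightarrow> ('k, 'u, 'v) tens" where
  "pure_tensor U V u v = (\<lambda>B. if bilinear_map U V ground B then B u v else 0)"

definition tensor ::
  "('k::field, 'u::ab_group_add, 'y) vspace_scheme \<Rightarrow> ('k, 'v::ab_group_add, 'z) vspace_scheme \<Rightarrow>
   ('k, ('k, 'u, 'v) tens) vspace" where
  "tensor U V =
     \<lparr>vcar = module.span fscale {pure_tensor U V u v |u v. u \<in> vcar U \<and> v \<in> vcar V},
      vscale = fscale\<rparr>"

text \<open>
  For \<open>f\<close> bilinear on \<open>U \<times> V\<close>, \<open>tlift U V f\<close> is the induced linear map on the tensor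
  product: write \<open>t = \<Sum> u \<otimes> v\<close> and return \<open>\<Sum> f u v\<close>. The choice of the
  representation is immaterial by \<open>tensor_universal\<close>.
\<close>

definition tlift ::
  "('k::field, 'u::ab_group_add, 'y) vspace_scheme \<Rightarrow> ('k, 'v::ab_group_add, 'z) vspace_scheme \<Rightarrow>
   ('u \<Rightarrow> 'v \<Rightarrow> 'w::ab_group_add) \<Rightarrow> ('k, 'u, 'v) tens \<Rightarrow> 'w" where
  "tlift U V f t =
     (let r = (SOME r. set r \<subseteq> vcar U \<times> vcar V \<and> t = (\<Sum>(u, v)\<leftarrow>r. pure_tensor U V u v))
      in \<Sum>(u, v)\<leftarrow>r. f u v)"

lemma vector_space_fscale: "vector_space (fscale :: 'k::field \<Rightarrow> ('a \<Rightarrow> 'k) \<Rightarrow> _)"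
  by unfold_locales (auto simp: fscale_def fun_eq_iff algebra_simps)

lemma pure_tensor_bilinear:
  assumes "vec_space U" "vec_space V"
  shows "bilinear_map U V (tensor U V) (pure_tensor U V)"
proof -
  interpret T: vector_space "fscale :: 'a \<Rightarrow> (('b \<Rightarrow> 'd \<Rightarrow> 'a) \<Rightarrow> 'a) \<Rightarrow> _"
    by (rule vector_space_fscale)
  have mem: "pure_tensor U V u v \<in> vcar (tensor U V)" if "u \<in> vcar U" "v \<in> vcar V" for u v
    unfolding tensor_def vspace.simps using that by (intro T.span_base) blast
  have scale: "vscale (tensor U V) = fscale" by (simp add: tensor_def)
  have form:
    "u \<in> vcar U \<Longrightarrow> u' \<in> vcar U \<Longrightarrow> v \<in> vcar V \<Longrightarrow> B (u + u') v = B u v + B u' v"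
    "u \<in> vcar U \<Longrightarrow> v \<in> vcar V \<Longrightarrow> v' \<in> vcar V \<Longrightarrow> B u (v + v') = B u v + B u v'"
    "u \<in> vcar U \<Longrightarrow> v \<in> vcar V \<Longrightarrow> B (vscale U c u) v = c * B u v"
    "u \<in> vcar U \<Longrightarrow> v \<in> vcar V \<Longrightarrow> B u (vscale V c v) = c * B u v"
    if "bilinear_map U V ground B" for B c u u' v v'
    using that unfolding bilinear_map_def linear_map_def ground_def by simp_all
  show ?thesis
    unfolding bilinear_map_def linear_map_def
  proof (intro conjI ballI allI)
    fix u v assume uv: "u \<in> vcar U" "v \<in> vcar V"
    show "pure_tensor U V u v \<in> vcar (tensor U V)" by (rule mem[OF uv])
    show "pure_tensor U V u (vscale V c v) = vscale (tensor U V) c (pure_tensor U V u v)" for c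
      by (rule ext) (simp add: pure_tensor_def scale fscale_def form uv)
    show "pure_tensor U V u (v + v') = pure_tensor U V u v + pure_tensor U V u v'"
      if "v' \<in> vcar V" for v'
      by (rule ext) (simp add: pure_tensor_def form uv that)
  next
    fix v u assume uv: "v \<in> vcar V" "u \<in> vcar U"
    show "pure_tensor U V u v \<in> vcar (tensor U V)" by (rule mem[OF uv(2,1)])
    show "pure_tensor U V (vscale U c u) v = vscale (tensor U V) c (pure_tensor U V u v)" for c
      by (rule ext) (simp add: pure_tensor_def scale fscale_def form uv)
    show "pure_tensor U V (u + u') v = pure_tensor U V u v + pure_tensor U V u' v"
      if "u' \<in> vcar U" for u'
      by (rule ext) (simp add: pure_tensor_def form uv that)
  qed
qed

lemma tensor_representation:
  assumes U: "vec_space U" and V: "vec_space V" and t: "t \<in> vcar (tensor U V)"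
  shows "\<exists>r. set r \<subseteq> vcar U \<times> vcar V \<and> t = (\<Sum>(u, v)\<leftarrow>r. pure_tensor U V u v)"
proof -
  interpret T: vector_space "fscale :: 'a \<Rightarrow> (('b \<Rightarrow> 'd \<Rightarrow> 'a) \<Rightarrow> 'a) \<Rightarrow> _"
    by (rule vector_space_fscale)
  from t have "t \<in> T.span {pure_tensor U V u v |u v. u \<in> vcar U \<and> v \<in> vcar V}"
    by (simp add: tensor_def)
  then show ?thesis
  proof (induction rule: T.span_induct_alt)
    case base
    show ?case by (rule exI[of _ "[]"]) simp
  next
    case (step c x y)
    then obtain r u v where r: "set r \<subseteq> vcar U \<times> vcar V" "y = (\<Sum>(u, v)\<leftarrow>r. pure_tensor U V u v)"
      and x: "x = pure_tensor U V u v" "u \<in> vcar U" "v \<in> vcar V" by auto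
    have u: "vscale U c u \<in> vcar U"
      using U x(2) module.subspace_scale[of "vscale U" "vcar U"]
      by (simp add: vec_space_def module_iff_vector_space)
    have "fscale c x = pure_tensor U V (vscale U c u) v"
      using pure_tensor_bilinear[OF U V] x
      by (simp add: bilinear_map_def linear_map_def) (simp add: tensor_def)
    then show ?case
      using r x u by (intro exI[of _ "(vscale U c u, v) # r"]) auto
  qed
qed

lemma sum_list_map_linear:
  assumes "Vector_Spaces.linear s1 s2 h"
  shows "h (\<Sum>x\<leftarrow>xs. f x) = (\<Sum>x\<leftarrow>xs. h (f x))"
proof -
  interpret Vector_Spaces.linear s1 s2 h by (fact assms)
  show ?thesis by (induction xs) (simp_all add: add zero)
qed

lemma exists_separating_functional:
  assumes "vector_space (s :: 'k::field \<Rightarrow> 'a::ab_group_add \<Rightarrow> 'a)" "d \<noteq> 0"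
  shows "\<exists>\<phi>. Vector_Spaces.linear s (*) \<phi> \<and> \<phi> d \<noteq> 0"
proof -
  have K: "vector_space ((*) :: 'k \<Rightarrow> 'k \<Rightarrow> 'k)"
    by unfold_locales (auto simp: algebra_simps)
  interpret P: vector_space_pair s "(*) :: 'k \<Rightarrow> 'k \<Rightarrow> 'k"
    using assms(1) K by (simp add: vector_space_pair_def)
  have "P.vs1.independent {d}" using assms(2) by simp
  then obtain \<phi> where "Vector_Spaces.linear s (*) \<phi>" "\<forall>x\<in>{d}. \<phi> x = 1"
    using P.linear_independent_extend[of "{d}" "\<lambda>_. 1"] by blast
  then show ?thesis by (intro exI[of _ \<phi>]) simp
qed

lemma tensor_sum_well_defined:
  assumes W: "vec_space W" and f: "bilinear_map U V W f"
    and r: "set r \<subseteq> vcar U \<times> vcar V" and r': "set r' \<subseteq> vcar U \<times> vcar V"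
    and eq: "(\<Sum>(u, v)\<leftarrow>r. pure_tensor U V u v) = (\<Sum>(u, v)\<leftarrow>r'. pure_tensor U V u v)"
  shows "(\<Sum>(u, v)\<leftarrow>r. f u v) = (\<Sum>(u, v)\<leftarrow>r'. f u v)"
proof (rule ccontr)
  assume "\<not> ?thesis"
  then have "(\<Sum>(u, v)\<leftarrow>r. f u v) - (\<Sum>(u, v)\<leftarrow>r'. f u v) \<noteq> 0" by simp
  with W obtain \<phi> where lin: "Vector_Spaces.linear (vscale W) (*) \<phi>"
    and ne: "\<phi> ((\<Sum>(u, v)\<leftarrow>r. f u v) - (\<Sum>(u, v)\<leftarrow>r'. f u v)) \<noteq> 0"
    using exists_separating_functional unfolding vec_space_def by blast
  interpret L: Vector_Spaces.linear "vscale W" "(*)" \<phi> by (fact lin)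
  have B: "bilinear_map U V ground (\<lambda>u v. \<phi> (f u v))"
    using f by (auto simp: bilinear_map_def linear_map_def ground_def L.add L.scale)
  have ev: "(\<Sum>(u, v)\<leftarrow>q. pure_tensor U V u v) (\<lambda>u v. \<phi> (f u v)) = \<phi> (\<Sum>(u, v)\<leftarrow>q. f u v)" for q
  proof (induction q)
    case (Cons a q)
    then show ?case using B by (cases a) (simp add: L.add pure_tensor_def)
  qed (simp add: L.zero)
  have "\<phi> (\<Sum>(u, v)\<leftarrow>r. f u v) = \<phi> (\<Sum>(u, v)\<leftarrow>r'. f u v)"
    using ev[of r] ev[of r'] eq by simp
  with ne show False by (simp add: L.diff)
qed

lemma tlift_sum:
  assumes W: "vec_space W" and f: "bilinear_map U V W f"
    and r: "set r \<subseteq> vcar U \<times> vcar V"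
  shows "tlift U V f (\<Sum>(u, v)\<leftarrow>r. pure_tensor U V u v) = (\<Sum>(u, v)\<leftarrow>r. f u v)"
proof -
  let ?P = "\<lambda>q. set q \<subseteq> vcar U \<times> vcar V \<and>
      (\<Sum>(u, v)\<leftarrow>r. pure_tensor U V u v) = (\<Sum>(u, v)\<leftarrow>q. pure_tensor U V u v)"
  have "?P (SOME q. ?P q)" using r by (intro someI[of ?P r]) simp
  then have "(\<Sum>(u, v)\<leftarrow>r. f u v) = (\<Sum>(u, v)\<leftarrow>(SOME q. ?P q). f u v)"
    using r by (intro tensor_sum_well_defined[OF W f]) simp_all
  then show ?thesis by (simp only: tlift_def Let_def)
qed

theorem tensor_universal:
  assumes U: "vec_space U" and V: "vec_space V" and W: "vec_space W"
    and f: "bilinear_map U V W f"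
  shows "linear_map (tensor U V) W (tlift U V f)"
    and "\<And>u v. u \<in> vcar U \<Longrightarrow> v \<in> vcar V \<Longrightarrow> tlift U V f (pure_tensor U V u v) = f u v"
    and "\<And>F t. linear_map (tensor U V) W F \<Longrightarrow>
           (\<And>u v. u \<in> vcar U \<Longrightarrow> v \<in> vcar V \<Longrightarrow> F (pure_tensor U V u v) = f u v) \<Longrightarrow>
           t \<in> vcar (tensor U V) \<Longrightarrow> F t = tlift U V f t"
proof -
  note rep = tensor_representation[OF U V] and lift = tlift_sum[OF W f]
  have MW: "module (vscale W)" and SW: "module.subspace (vscale W) (vcar W)"
    using W by (auto simp: vec_space_def module_iff_vector_space)
  have MU: "module (vscale U)" and SU: "module.subspace (vscale U) (vcar U)"
    using U by (auto simp: vec_space_def module_iff_vector_space)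
  interpret T: vector_space "fscale :: 'a \<Rightarrow> (('b \<Rightarrow> 'd \<Rightarrow> 'a) \<Rightarrow> 'a) \<Rightarrow> _"
    by (rule vector_space_fscale)
  have mem: "pure_tensor U V u v \<in> vcar (tensor U V)" if "u \<in> vcar U" "v \<in> vcar V" for u v
    using pure_tensor_bilinear[OF U V] that by (auto simp: bilinear_map_def linear_map_def)
  show "tlift U V f (pure_tensor U V u v) = f u v" if "u \<in> vcar U" "v \<in> vcar V" for u v
    using lift[of "[(u, v)]"] that by simp
  show "linear_map (tensor U V) W (tlift U V f)"
    unfolding linear_map_def
  proof (intro conjI ballI allI)
    fix x assume "x \<in> vcar (tensor U V)"
    then obtain r where r: "set r \<subseteq> vcar U \<times> vcar V" "x = (\<Sum>(u, v)\<leftarrow>r. pure_tensor U V u v)"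
      using rep by blast
    have "(\<Sum>(u, v)\<leftarrow>r. f u v) \<in> vcar W"
      using r(1)
    proof (induction r)
      case Nil
      show ?case using module.subspace_0[OF MW SW] by simp
    next
      case (Cons a r)
      then show ?case
        using f module.subspace_add[OF MW SW]
        by (cases a) (auto simp: bilinear_map_def linear_map_def)
    qed
    then show "tlift U V f x \<in> vcar W" using lift[OF r(1)] r(2) by simp
    fix c
    let ?r = "map (\<lambda>(u, v). (vscale U c u, v)) r"
    have r': "set ?r \<subseteq> vcar U \<times> vcar V"
      using r(1) module.subspace_scale[OF MU SU] by auto
    have "vscale (tensor U V) c x = (\<Sum>(u, v)\<leftarrow>?r. pure_tensor U V u v)"
      unfolding r(2) using r(1)
    proof (induction r)
      case Nil
      show ?case by (simp add: tensor_def fscale_def zero_fun_def)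
    next
      case (Cons a r)
      obtain u v where a: "a = (u, v)" "u \<in> vcar U" "v \<in> vcar V" using Cons.prems by auto
      have "vscale (tensor U V) c (pure_tensor U V u v) = pure_tensor U V (vscale U c u) v"
        using pure_tensor_bilinear[OF U V] a unfolding bilinear_map_def linear_map_def by simp
      moreover have "vscale (tensor U V) c (s + t) = vscale (tensor U V) c s + vscale (tensor U V) c t" for s t
        unfolding tensor_def using T.scale_right_distrib by simp
      moreover have "vscale (tensor U V) c (\<Sum>(u, v)\<leftarrow>r. pure_tensor U V u v) =
          (\<Sum>(u, v)\<leftarrow>map (\<lambda>(u, v). (vscale U c u, v)) r. pure_tensor U V u v)"
        using Cons by simp
      ultimately show ?case by (simp only: a(1) list.map sum_list.Cons prod.case)
    qed
    moreover have "vscale W c (\<Sum>(u, v)\<leftarrow>r. f u v) = (\<Sum>(u, v)\<leftarrow>?r. f u v)"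
      using r(1)
    proof (induction r)
      case Nil
      show ?case using module.scale_zero_right[OF MW] by simp
    next
      case (Cons a r)
      then show ?case
        using f module.scale_right_distrib[OF MW]
        by (cases a) (auto simp: bilinear_map_def linear_map_def)
    qed
    ultimately show "tlift U V f (vscale (tensor U V) c x) = vscale W c (tlift U V f x)"
      using lift[OF r'] lift[OF r(1)] r(2) by simp
  next
    fix x y assume "x \<in> vcar (tensor U V)" "y \<in> vcar (tensor U V)"
    then obtain r q where r: "set r \<subseteq> vcar U \<times> vcar V" "x = (\<Sum>(u, v)\<leftarrow>r. pure_tensor U V u v)"
      and q: "set q \<subseteq> vcar U \<times> vcar V" "y = (\<Sum>(u, v)\<leftarrow>q. pure_tensor U V u v)"
      using rep by meson
    show "tlift U V f (x + y) = tlift U V f x + tlift U V f y"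
      using lift[of "r @ q"] lift[OF r(1)] lift[OF q(1)] r q by simp
  qed
  show "F t = tlift U V f t"
    if F: "linear_map (tensor U V) W F"
      and pure: "\<And>u v. u \<in> vcar U \<Longrightarrow> v \<in> vcar V \<Longrightarrow> F (pure_tensor U V u v) = f u v"
      and t: "t \<in> vcar (tensor U V)" for F t
  proof -
    obtain r where r: "set r \<subseteq> vcar U \<times> vcar V" "t = (\<Sum>(u, v)\<leftarrow>r. pure_tensor U V u v)"
      using rep[OF t] by blast
    have car: "vcar (tensor U V) = T.span {pure_tensor U V u v |u v. u \<in> vcar U \<and> v \<in> vcar V}"
      by (simp add: tensor_def)
    have F0: "F 0 = 0"
    proof -
      have "0 \<in> vcar (tensor U V)" by (simp add: car T.span_zero)
      then have "F (0 + 0) = F 0 + F 0" using F unfolding linear_map_def by blast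
      then show ?thesis by simp
    qed
    have "(\<Sum>(u, v)\<leftarrow>r. pure_tensor U V u v) \<in> vcar (tensor U V) \<and>
          F (\<Sum>(u, v)\<leftarrow>r. pure_tensor U V u v) = (\<Sum>(u, v)\<leftarrow>r. f u v)"
      using r(1)
    proof (induction r)
      case Nil
      show ?case unfolding list.map sum_list.Nil car using F0 T.span_zero by blast
    next
      case (Cons a r)
      obtain u v where a: "a = (u, v)" "u \<in> vcar U" "v \<in> vcar V" using Cons.prems by auto
      let ?s = "\<Sum>(u, v)\<leftarrow>r. pure_tensor U V u v"
      have IH: "?s \<in> vcar (tensor U V)" "F ?s = (\<Sum>(u, v)\<leftarrow>r. f u v)" using Cons by auto
      have "F (pure_tensor U V u v + ?s) = F (pure_tensor U V u v) + F ?s"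
        using F mem[OF a(2,3)] IH(1) unfolding linear_map_def by blast
      moreover have "pure_tensor U V u v + ?s \<in> vcar (tensor U V)"
        using mem[OF a(2,3)] IH(1) unfolding car by (rule T.span_add)
      ultimately show ?case unfolding a(1) list.map sum_list.Cons prod.case using IH pure[OF a(2,3)] by metis
    qed
    then show ?thesis using lift[OF r(1)] r(2) by simp
  qed
qed


section \<open>Algebras\<close>

record ('k, 'a) alg = "('k, 'a) vspace" +
  amult :: "'a \<Rightarrow> 'a \<Rightarrow> 'a"
  aone :: "'a"

definition assoc_algebra :: "('k::field, 'a::ab_group_add) alg \<Rightarrow> bool" where
  "assoc_algebra A \<longleftrightarrow>
     vec_space A \<and> bilinear_map A A A (amult A) \<and> aone A \<in> vcar A \<and>
     (\<forall>x\<in>vcar A. \<forall>y\<in>vcar A. \<forall>z\<in>vcar A. amult A (amult A x y) z = amult A x (amult A y z)) \<and>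
     (\<forall>x\<in>vcar A. amult A (aone A) x = x \<and> amult A x (aone A) = x)"

definition algebra_iso ::
  "('k::field, 'a::ab_group_add) alg \<Rightarrow> ('k, 'b::ab_group_add) alg \<Rightarrow> ('a \<Rightarrow> 'b) \<Rightarrow> bool" where
  "algebra_iso A B f \<longleftrightarrow>
     assoc_algebra A \<and> assoc_algebra B \<and> linear_map A B f \<and> bij_betw f (vcar A) (vcar B) \<and>
     (\<forall>x\<in>vcar A. \<forall>y\<in>vcar A. f (amult A x y) = amult B (f x) (f y)) \<and> f (aone A) = aone B"


section \<open>Hopf algebras\<close>

text \<open>The ring structure of \<open>H\<close> is that of the type \<open>'h\<close>; \<open>0 \<noteq> 1\<close> is no restriction, as
  the counit maps \<open>1\<close> to \<open>1\<close>.\<close>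

record ('k, 'h) hopf =
  hscale :: "'k \<Rightarrow> 'h \<Rightarrow> 'h"
  comult :: "'h \<Rightarrow> ('k, 'h, 'h) tens"
  counit :: "'h \<Rightarrow> 'k"
  antipode :: "'h \<Rightarrow> 'h"

definition hspace :: "('k, 'h) hopf \<Rightarrow> ('k, 'h) vspace" where
  "hspace H = \<lparr>vcar = UNIV, vscale = hscale H\<rparr>"

abbreviation hh_space :: "('k::field, 'h::ring_1) hopf \<Rightarrow> ('k, ('k, 'h, 'h) tens) vspace" where
  "hh_space H \<equiv> tensor (hspace H) (hspace H)"

text \<open>Sweedler sums \<open>\<Sum> f h\<^sub>1 h\<^sub>2\<close> and \<open>\<Sum> f h\<^sub>1 h\<^sub>2 h\<^sub>3\<close>.\<close>

definition sweedler2 ::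
  "('k::field, 'h::ring_1) hopf \<Rightarrow> 'h \<Rightarrow> ('h \<Rightarrow> 'h \<Rightarrow> 'w::ab_group_add) \<Rightarrow> 'w" where
  "sweedler2 H h f = tlift (hspace H) (hspace H) f (comult H h)"

definition sweedler3 ::
  "('k::field, 'h::ring_1) hopf \<Rightarrow> 'h \<Rightarrow> ('h \<Rightarrow> 'h \<Rightarrow> 'h \<Rightarrow> 'w::ab_group_add) \<Rightarrow> 'w" where
  "sweedler3 H h f = sweedler2 H h (\<lambda>h1 h'. sweedler2 H h' (\<lambda>h2 h3. f h1 h2 h3))"

locale hopf_algebra = vector_space "hscale H" for H :: "('k::field, 'h::ring_1) hopf" +
  assumes scale_mult_left: "hscale H c x * y = hscale H c (x * y)"
    and scale_mult_right: "x * hscale H c y = hscale H c (x * y)"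
    and comult_linear: "linear_map (hspace H) (hh_space H) (comult H)"
    and counit_linear: "Vector_Spaces.linear (hscale H) (*) (counit H)"
    and antipode_linear: "Vector_Spaces.linear (hscale H) (hscale H) (antipode H)"
    and coassoc:
      "sweedler2 H h (\<lambda>a h2. sweedler2 H h2 (\<lambda>b c.
         pure_tensor (hspace H) (hh_space H) a (pure_tensor (hspace H) (hspace H) b c))) =
       sweedler2 H h (\<lambda>h1 c. sweedler2 H h1 (\<lambda>a b.
         pure_tensor (hspace H) (hh_space H) a (pure_tensor (hspace H) (hspace H) b c)))"
    and counit_left: "sweedler2 H h (\<lambda>h1 h2. hscale H (counit H h1) h2) = h"
    and counit_right: "sweedler2 H h (\<lambda>h1 h2. hscale H (counit H h2) h1) = h"
    and comult_mult:
      "comult H (x * y) = sweedler2 H x (\<lambda>x1 x2. sweedler2 H y (\<lambda>y1 y2.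
         pure_tensor (hspace H) (hspace H) (x1 * y1) (x2 * y2)))"
    and comult_one: "comult H 1 = pure_tensor (hspace H) (hspace H) 1 1"
    and counit_mult: "counit H (x * y) = counit H x * counit H y"
    and counit_one: "counit H 1 = 1"
    and antipode_left: "sweedler2 H h (\<lambda>h1 h2. antipode H h1 * h2) = hscale H (counit H h) 1"
    and antipode_right: "sweedler2 H h (\<lambda>h1 h2. h1 * antipode H h2) = hscale H (counit H h) 1"

locale fd_hopf_algebra = hopf_algebra +
  assumes finite_dimensional: "\<exists>B. finite B \<and> span B = UNIV"

text \<open>Bijectivity of the antipode is a consequence of finite dimensionality, not an assumption.\<close>

abbreviation antipode_inv :: "('k, 'h) hopf \<Rightarrow> 'h \<Rightarrow> 'h" where
  "antipode_inv H \<equiv> inv (antipode H)"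


section \<open>The dual Hopf algebra and the regular actions\<close>

definition dual :: "('k::field, 'h::ring_1) hopf \<Rightarrow> ('k, 'h \<Rightarrow> 'k) vspace" where
  "dual H = \<lparr>vcar = {f. Vector_Spaces.linear (hscale H) (*) f}, vscale = fscale\<rparr>"

abbreviation dd_space ::
  "('k::field, 'h::ring_1) hopf \<Rightarrow> ('k, ('k, 'h \<Rightarrow> 'k, 'h \<Rightarrow> 'k) tens) vspace" where
  "dd_space H \<equiv> tensor (dual H) (dual H)"

definition dmult :: "('k::field, 'h::ring_1) hopf \<Rightarrow> ('h \<Rightarrow> 'k) \<Rightarrow> ('h \<Rightarrow> 'k) \<Rightarrow> 'h \<Rightarrow> 'k" where
  "dmult H p q = (\<lambda>h. sweedler2 H h (\<lambda>h1 h2. p h1 * q h2))"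

abbreviation dunit :: "('k, 'h) hopf \<Rightarrow> 'h \<Rightarrow> 'k" where
  "dunit H \<equiv> counit H"

definition dcomult ::
  "('k::field, 'h::ring_1) hopf \<Rightarrow> ('h \<Rightarrow> 'k) \<Rightarrow> ('k, 'h \<Rightarrow> 'k, 'h \<Rightarrow> 'k) tens" where
  "dcomult H p = (THE t. t \<in> vcar (dd_space H) \<and>
     (\<forall>h h'. tlift (dual H) (dual H) (\<lambda>p1 p2. p1 h * p2 h') t = p (h * h')))"

definition dcounit :: "('h::ring_1 \<Rightarrow> 'k) \<Rightarrow> 'k" where
  "dcounit p = p 1"

definition dsweedler2 ::
  "('k::field, 'h::ring_1) hopf \<Rightarrow> ('h \<Rightarrow> 'k) \<Rightarrow>
   (('h \<Rightarrow> 'k) \<Rightarrow> ('h \<Rightarrow> 'k) \<Rightarrow> 'w::ab_group_add) \<Rightarrow> 'w" where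
  "dsweedler2 H p F = tlift (dual H) (dual H) F (dcomult H p)"

definition dsweedler3 ::
  "('k::field, 'h::ring_1) hopf \<Rightarrow> ('h \<Rightarrow> 'k) \<Rightarrow>
   (('h \<Rightarrow> 'k) \<Rightarrow> ('h \<Rightarrow> 'k) \<Rightarrow> ('h \<Rightarrow> 'k) \<Rightarrow> 'w::ab_group_add) \<Rightarrow> 'w" where
  "dsweedler3 H p F = dsweedler2 H p (\<lambda>p1 p'. dsweedler2 H p' (\<lambda>p2 p3. F p1 p2 p3))"

text \<open>The regular actions make \<open>H\<^sup>*\<close> an \<open>H\<close>-bimodule, so the bracketing of
  \<open>a \<rightharpoonup> p \<leftharpoonup> b\<close> does not matter.\<close>

definition lreg :: "'h::times \<Rightarrow> ('h \<Rightarrow> 'k) \<Rightarrow> 'h \<Rightarrow> 'k" (infixl \<open>\<rightharpoonup>\<close> 75) where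
  "h \<rightharpoonup> f = (\<lambda>h'. f (h' * h))"

definition rreg :: "('h::times \<Rightarrow> 'k) \<Rightarrow> 'h \<Rightarrow> 'h \<Rightarrow> 'k" (infixl \<open>\<leftharpoonup>\<close> 75) where
  "f \<leftharpoonup> h' = (\<lambda>h. f (h' * h))"


section \<open>The algebra \<open>X\<close>\<close>

type_synonym ('k, 'h) xelt =
  "('k, ('k, 'h, 'h) tens, ('k, 'h \<Rightarrow> 'k, 'h \<Rightarrow> 'k) tens) tens"

text \<open>The element \<open>(g \<otimes> h) \<otimes> (p \<otimes> q)\<close>.\<close>

definition x_tensor ::
  "('k::field, 'h::ring_1) hopf \<Rightarrow> 'h \<Rightarrow> 'h \<Rightarrow> ('h \<Rightarrow> 'k) \<Rightarrow> ('h \<Rightarrow> 'k) \<Rightarrow> ('k, 'h) xelt" where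
  "x_tensor H g h p q = pure_tensor (hh_space H) (dd_space H)
     (pure_tensor (hspace H) (hspace H) g h) (pure_tensor (dual H) (dual H) p q)"

definition x_lift ::
  "('k::field, 'h::ring_1) hopf \<Rightarrow>
   ('h \<Rightarrow> 'h \<Rightarrow> ('h \<Rightarrow> 'k) \<Rightarrow> ('h \<Rightarrow> 'k) \<Rightarrow> 'w::ab_group_add) \<Rightarrow> ('k, 'h) xelt \<Rightarrow> 'w" where
  "x_lift H F = tlift (hh_space H) (dd_space H)
     (\<lambda>s t. tlift (hspace H) (hspace H) (\<lambda>g h. tlift (dual H) (dual H) (\<lambda>p q. F g h p q) t) s)"

text \<open>
  With \<open>a = g \<otimes> h\<close>, \<open>u = p \<otimes> q\<close>, \<open>a' = g' \<otimes> h'\<close>, \<open>u' = p' \<otimes> q'\<close>, the product \<open>(a u)(a' u')\<close> equals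
  \<open>a (u a') u'\<close>: the exchange rule rewrites \<open>u a'\<close>, then one multiplies by \<open>a\<close> on the left in
  the tensor product of \<open>H\<^sup>o\<^sup>p\<close> and \<open>H\<close>, and by \<open>u'\<close> on the right in the tensor product of \<open>H\<^sup>*\<close> and \<open>H\<^sup>*\<^sup>o\<^sup>p\<close>.
\<close>

definition x_mult ::
  "('k::field, 'h::ring_1) hopf \<Rightarrow> ('k, 'h) xelt \<Rightarrow> ('k, 'h) xelt \<Rightarrow> ('k, 'h) xelt" where
  "x_mult H x x' =
     x_lift H (\<lambda>g h p q. x_lift H (\<lambda>g' h' p' q'.
       sweedler3 H g' (\<lambda>g1 g2 g3. sweedler3 H h' (\<lambda>h1 h2 h3.
         x_tensor H (g2 * g) (h * h2)
           (dmult H (antipode_inv H h1 \<rightharpoonup> p \<leftharpoonup> antipode H g1) p')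
           (dmult H q' (antipode H h3 \<rightharpoonup> q \<leftharpoonup> antipode_inv H g3))))) x') x"

definition X_alg :: "('k::field, 'h::ring_1) hopf \<Rightarrow> ('k, ('k, 'h) xelt) alg" where
  "X_alg H =
     \<lparr>vcar = vcar (tensor (hh_space H) (dd_space H)), vscale = vscale (tensor (hh_space H) (dd_space H)),
      amult = x_mult H, aone = x_tensor H 1 1 (dunit H) (dunit H)\<rparr>"


section \<open>The diagonal crossed product \<open>Z\<close>\<close>

type_synonym ('k, 'h) zelt =
  "('k, ('k, 'h \<Rightarrow> 'k, 'h \<Rightarrow> 'k) tens, ('k, 'h, 'h) tens) tens"

text \<open>The element \<open>(p \<otimes> q) \<bowtie> (h \<otimes> g)\<close>.\<close>

definition z_tensor ::
  "('k::field, 'h::ring_1) hopf \<Rightarrow> ('h \<Rightarrow> 'k) \<Rightarrow> ('h \<Rightarrow> 'k) \<Rightarrow> 'h \<Rightarrow> 'h \<Rightarrow> ('k, 'h) zelt" where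
  "z_tensor H p q h g = pure_tensor (dd_space H) (hh_space H)
     (pure_tensor (dual H) (dual H) p q) (pure_tensor (hspace H) (hspace H) h g)"

definition z_lift ::
  "('k::field, 'h::ring_1) hopf \<Rightarrow>
   (('h \<Rightarrow> 'k) \<Rightarrow> ('h \<Rightarrow> 'k) \<Rightarrow> 'h \<Rightarrow> 'h \<Rightarrow> 'w::ab_group_add) \<Rightarrow> ('k, 'h) zelt \<Rightarrow> 'w" where
  "z_lift H F = tlift (dd_space H) (hh_space H)
     (\<lambda>t s. tlift (dual H) (dual H) (\<lambda>p q. tlift (hspace H) (hspace H) (\<lambda>h g. F p q h g) s) t)"

definition z_mult ::
  "('k::field, 'h::ring_1) hopf \<Rightarrow> ('k, 'h) zelt \<Rightarrow> ('k, 'h) zelt \<Rightarrow> ('k, 'h) zelt" where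
  "z_mult H z z' =
     z_lift H (\<lambda>p q h g. z_lift H (\<lambda>p' q' h' g'.
       sweedler3 H h (\<lambda>h1 h2 h3. sweedler3 H g (\<lambda>g1 g2 g3.
         z_tensor H
           (dmult H p (h1 \<rightharpoonup> p' \<leftharpoonup> g1)) (dmult H (h3 \<rightharpoonup> q' \<leftharpoonup> g3) q)
           (h2 * h') (g' * g2)))) z') z"

definition Z_alg :: "('k::field, 'h::ring_1) hopf \<Rightarrow> ('k, ('k, 'h) zelt) alg" where
  "Z_alg H =
     \<lparr>vcar = vcar (tensor (dd_space H) (hh_space H)), vscale = vscale (tensor (dd_space H) (hh_space H)),
      amult = z_mult H, aone = z_tensor H (dunit H) (dunit H) 1 1\<rparr>"


section \<open>The maps between \<open>X\<close> and \<open>Z\<close>\<close>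

definition beta :: "('k::field, 'h::ring_1) hopf \<Rightarrow> ('k, 'h) xelt \<Rightarrow> ('k, 'h) zelt" where
  "beta H = x_lift H (\<lambda>g h p q.
     sweedler3 H g (\<lambda>g1 g2 g3. sweedler3 H h (\<lambda>h1 h2 h3.
       z_tensor H (h1 \<rightharpoonup> p \<leftharpoonup> g1) (h3 \<rightharpoonup> q \<leftharpoonup> g3) h2 g2)))"

definition beta_inv :: "('k::field, 'h::ring_1) hopf \<Rightarrow> ('k, 'h) zelt \<Rightarrow> ('k, 'h) xelt" where
  "beta_inv H = z_lift H (\<lambda>p q h g.
     sweedler3 H g (\<lambda>g1 g2 g3. sweedler3 H h (\<lambda>h1 h2 h3.
       x_tensor H g2 h2
         (antipode_inv H h1 \<rightharpoonup> p \<leftharpoonup> antipode H g1)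
         (antipode H h3 \<rightharpoonup> q \<leftharpoonup> antipode_inv H g3))))"


section \<open>Hopf bimodules over the dual\<close>

record ('k, 'h, 'm) bimod =
  mscale :: "'k \<Rightarrow> 'm \<Rightarrow> 'm"
  lmul :: "('h \<Rightarrow> 'k) \<Rightarrow> 'm \<Rightarrow> 'm"
  rmul :: "'m \<Rightarrow> ('h \<Rightarrow> 'k) \<Rightarrow> 'm"
  lcoact :: "'m \<Rightarrow> ('k, 'h \<Rightarrow> 'k, 'm) tens"
  rcoact :: "'m \<Rightarrow> ('k, 'm, 'h \<Rightarrow> 'k) tens"

definition mspace :: "('k, 'h, 'm) bimod \<Rightarrow> ('k, 'm) vspace" where
  "mspace M = \<lparr>vcar = UNIV, vscale = mscale M\<rparr>"

abbreviation md_space ::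
  "('k::field, 'h::ring_1) hopf \<Rightarrow> ('k, 'h, 'm::ab_group_add) bimod \<Rightarrow> ('k, ('k, 'm, 'h \<Rightarrow> 'k) tens) vspace" where
  "md_space H M \<equiv> tensor (mspace M) (dual H)"

abbreviation dm_space ::
  "('k::field, 'h::ring_1) hopf \<Rightarrow> ('k, 'h, 'm::ab_group_add) bimod \<Rightarrow> ('k, ('k, 'h \<Rightarrow> 'k, 'm) tens) vspace" where
  "dm_space H M \<equiv> tensor (dual H) (mspace M)"

text \<open>The element \<open>a \<otimes> m \<otimes> b\<close> of \<open>H\<^sup>* \<otimes> M \<otimes> H\<^sup>*\<close>.\<close>

definition dmd_tensor ::
  "('k::field, 'h::ring_1) hopf \<Rightarrow> ('k, 'h, 'm::ab_group_add) bimod \<Rightarrow>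
   ('h \<Rightarrow> 'k) \<Rightarrow> 'm \<Rightarrow> ('h \<Rightarrow> 'k) \<Rightarrow> ('k, 'h \<Rightarrow> 'k, ('k, 'm, 'h \<Rightarrow> 'k) tens) tens" where
  "dmd_tensor H M a m b =
     pure_tensor (dual H) (md_space H M) a (pure_tensor (mspace M) (dual H) m b)"

definition lsweedler ::
  "('k::field, 'h::ring_1) hopf \<Rightarrow> ('k, 'h, 'm::ab_group_add) bimod \<Rightarrow> 'm \<Rightarrow>
   (('h \<Rightarrow> 'k) \<Rightarrow> 'm \<Rightarrow> 'w::ab_group_add) \<Rightarrow> 'w" where
  "lsweedler H M m F = tlift (dual H) (mspace M) F (lcoact M m)"

definition rsweedler ::
  "('k::field, 'h::ring_1) hopf \<Rightarrow> ('k, 'h, 'm::ab_group_add) bimod \<Rightarrow> 'm \<Rightarrow>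
   ('m \<Rightarrow> ('h \<Rightarrow> 'k) \<Rightarrow> 'w::ab_group_add) \<Rightarrow> 'w" where
  "rsweedler H M m F = tlift (mspace M) (dual H) F (rcoact M m)"

text \<open>The coaction \<open>M \<rightarrow> H\<^sup>* \<otimes> M \<otimes> H\<^sup>*\<close> and its Sweedler sums
  \<open>\<Sum> F m\<^sub>(\<^sub>-\<^sub>1\<^sub>) m\<^sub>(\<^sub>0\<^sub>) m\<^sub>(\<^sub>1\<^sub>)\<close>.\<close>

definition coact ::
  "('k::field, 'h::ring_1) hopf \<Rightarrow> ('k, 'h, 'm::ab_group_add) bimod \<Rightarrow> 'm \<Rightarrow>
   ('k, 'h \<Rightarrow> 'k, ('k, 'm, 'h \<Rightarrow> 'k) tens) tens" where
  "coact H M m = lsweedler H M m (\<lambda>a n. rsweedler H M n (\<lambda>n' b. dmd_tensor H M a n' b))"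

definition bisweedler ::
  "('k::field, 'h::ring_1) hopf \<Rightarrow> ('k, 'h, 'm::ab_group_add) bimod \<Rightarrow> 'm \<Rightarrow>
   (('h \<Rightarrow> 'k) \<Rightarrow> 'm \<Rightarrow> ('h \<Rightarrow> 'k) \<Rightarrow> 'w::ab_group_add) \<Rightarrow> 'w" where
  "bisweedler H M m F =
     tlift (dual H) (md_space H M)
       (\<lambda>a t. tlift (mspace M) (dual H) (\<lambda>n b. F a n b) t) (coact H M m)"

locale hopf_bimodule = H: fd_hopf_algebra H + M: vector_space "mscale M"
  for H :: "('k::field, 'h::ring_1) hopf" and M :: "('k, 'h, 'm::ab_group_add) bimod" +
  assumes lmul_bilinear: "bilinear_map (dual H) (mspace M) (mspace M) (lmul M)"
    and rmul_bilinear: "bilinear_map (mspace M) (dual H) (mspace M) (rmul M)"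
    and lmul_mult: "p \<in> vcar (dual H) \<Longrightarrow> q \<in> vcar (dual H) \<Longrightarrow>
      lmul M (dmult H p q) m = lmul M p (lmul M q m)"
    and rmul_mult: "p \<in> vcar (dual H) \<Longrightarrow> q \<in> vcar (dual H) \<Longrightarrow>
      rmul M m (dmult H p q) = rmul M (rmul M m p) q"
    and lmul_one: "lmul M (dunit H) m = m"
    and rmul_one: "rmul M m (dunit H) = m"
    and lmul_rmul: "p \<in> vcar (dual H) \<Longrightarrow> q \<in> vcar (dual H) \<Longrightarrow>
      rmul M (lmul M p m) q = lmul M p (rmul M m q)"
    and lcoact_linear: "linear_map (mspace M) (dm_space H M) (lcoact M)"
    and rcoact_linear: "linear_map (mspace M) (md_space H M) (rcoact M)"
    and lcoact_coassoc:
      "lsweedler H M m (\<lambda>a n. dsweedler2 H a (\<lambda>a1 a2.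
         pure_tensor (dual H) (dm_space H M) a1 (pure_tensor (dual H) (mspace M) a2 n))) =
       lsweedler H M m (\<lambda>a1 n. lsweedler H M n (\<lambda>a2 n'.
         pure_tensor (dual H) (dm_space H M) a1 (pure_tensor (dual H) (mspace M) a2 n')))"
    and rcoact_coassoc:
      "rsweedler H M m (\<lambda>n b. dsweedler2 H b (\<lambda>b1 b2.
         pure_tensor (mspace M) (dd_space H) n (pure_tensor (dual H) (dual H) b1 b2))) =
       rsweedler H M m (\<lambda>n b2. rsweedler H M n (\<lambda>n' b1.
         pure_tensor (mspace M) (dd_space H) n' (pure_tensor (dual H) (dual H) b1 b2)))"
    and lcoact_counit: "lsweedler H M m (\<lambda>a n. mscale M (dcounit a) n) = m"
    and rcoact_counit: "rsweedler H M m (\<lambda>n b. mscale M (dcounit b) n) = m"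
    and coact_commute:
      "lsweedler H M m (\<lambda>a n. rsweedler H M n (\<lambda>n' b. dmd_tensor H M a n' b)) =
       rsweedler H M m (\<lambda>n b. lsweedler H M n (\<lambda>a n'. dmd_tensor H M a n' b))"
    and hopf_compatible: "p \<in> vcar (dual H) \<Longrightarrow> q \<in> vcar (dual H) \<Longrightarrow>
      coact H M (rmul M (lmul M p m) q) =
        dsweedler3 H p (\<lambda>p1 p2 p3. dsweedler3 H q (\<lambda>q1 q2 q3. bisweedler H M m (\<lambda>a n b.
          dmd_tensor H M (dmult H (dmult H p1 a) q1)
            (rmul M (lmul M p2 n) q2) (dmult H (dmult H p3 b) q3))))"

definition x_act ::
  "('k::field, 'h::ring_1) hopf \<Rightarrow> ('k, 'h, 'm::ab_group_add) bimod \<Rightarrow> ('k, 'h) xelt \<Rightarrow> 'm \<Rightarrow> 'm" where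
  "x_act H M x m = x_lift H (\<lambda>g h p q. bisweedler H M m (\<lambda>a n b.
     sweedler3 H g (\<lambda>g1 g2 g3. sweedler3 H h (\<lambda>h1 h2 h3.
       mscale M (a g2 * b h2)
         (rmul M (lmul M (h1 \<rightharpoonup> p \<leftharpoonup> g1) n) (h3 \<rightharpoonup> q \<leftharpoonup> g3)))))) x"

definition z_act ::
  "('k::field, 'h::ring_1) hopf \<Rightarrow> ('k, 'h, 'm::ab_group_add) bimod \<Rightarrow> ('k, 'h) zelt \<Rightarrow> 'm \<Rightarrow> 'm" where
  "z_act H M z m = z_lift H (\<lambda>p q h g. bisweedler H M m (\<lambda>a n b.
     mscale M (a g * b h) (rmul M (lmul M p n) q))) z"

end

theory Submission
  imports Defs
begin

text \<open>
  \<open>H \<otimes> H\<^sup>o\<^sup>p\<close> and \<open>H\<^sup>* \<otimes> H\<^sup>*\<^sup>o\<^sup>p\<close> are subalgebras of \<open>Z\<close>, and \<open>Z\<close> factorises through them in both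
  orders: \<open>(p \<otimes> q) \<bowtie> (h \<otimes> g)\<close> is the product of \<open>p \<otimes> q\<close> and \<open>h \<otimes> g\<close>, whereas \<open>\<beta>\<close> sends
  \<open>(g \<otimes> h) \<otimes> (p \<otimes> q)\<close> to the product of \<open>h \<otimes> g\<close> and \<open>p \<otimes> q\<close>. That \<open>\<beta>\<close> and \<open>\<beta>\<^sup>-\<^sup>1\<close> are mutually
  inverse is the cancellation of \<open>S\<close> and \<open>S\<^sup>-\<^sup>1\<close> inside fivefold Sweedler sums. The exchange rule of
  \<open>X\<close> is the formula for \<open>\<beta>\<^sup>-\<^sup>1\<close>, so associativity of \<open>Z\<close> and \<open>\<beta> \<beta>\<^sup>-\<^sup>1 = id\<close> make \<open>\<beta>\<close> multiplicative,
  and the algebra axioms of \<open>X\<close> are transported from \<open>Z\<close>.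

  Bijectivity of \<open>S\<close> is the argument of Larson and Sweedler: the projection of the Hopf module
  \<open>H\<^sup>*\<close> onto the integrals is nonzero, and for a nonzero integral \<open>\<mu>\<close> the map \<open>h \<mapsto> \<mu> (- S h)\<close> is
  injective.
\<close>

section \<open>Multilinear maps\<close>

text \<open>A Sweedler sum is a \<open>tlift\<close> along a chosen representation of a coproduct.
  Exchanging two independent sums is then valid for every summand, but coassociativity, the counit
  law and antipode cancellation require summands that are linear in each slot. Nearly every
  rewriting step therefore leaves linearity and membership goals, and this shapes the whole
  development.

  The Hopf module argument is run with a basis and its dual basis instead of an abstract coaction:
  the canonical element, the sum of b \<otimes> \<open>coord b\<close>, converts the coproduct of
  \<open>H\<close> into the product of \<open>H^*\<close>. A nonzero integral exists because every
  functional is reconstructed from projections, so vanishing projections would kill the counit.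
  Finite dimension supplies this finite basis and the passage from injectivity to surjectivity of
  S.\<close>

text \<open>Every rule below has the variable in exactly one argument, so that \<open>intro\<close> decides
  multilinearity without search.\<close>

named_theorems lin_intros

lemma bilinear_mapI [lin_intros]:
  assumes "\<And>u. u \<in> vcar U \<Longrightarrow> linear_map V W (\<lambda>v. f u v)"
    and "\<And>v. v \<in> vcar V \<Longrightarrow> linear_map U W (\<lambda>u. f u v)"
  shows "bilinear_map U V W f"
  using assms by (simp add: bilinear_map_def)

lemma linear_map_id [lin_intros]: "linear_map V V (\<lambda>x. x)"
  by (simp add: linear_map_def)

lemma linear_map_compose: "linear_map V W f \<Longrightarrow> linear_map U V g \<Longrightarrow> linear_map U W (\<lambda>x. f (g x))"
  by (simp add: linear_map_def)

lemma linear_map_mem: "linear_map V W f \<Longrightarrow> x \<in> vcar V \<Longrightarrow> f x \<in> vcar W"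
  by (simp add: linear_map_def)

lemma bilinear_map_left: "bilinear_map U V W f \<Longrightarrow> linear_map X U k \<Longrightarrow> v \<in> vcar V \<Longrightarrow> linear_map X W (\<lambda>x. f (k x) v)"
  by (rule linear_map_compose[where f = "\<lambda>u. f u v"]) (auto simp: bilinear_map_def)

lemma bilinear_map_right: "bilinear_map U V W f \<Longrightarrow> linear_map X V k \<Longrightarrow> u \<in> vcar U \<Longrightarrow> linear_map X W (\<lambda>x. f u (k x))"
  by (rule linear_map_compose[where f = "f u"]) (auto simp: bilinear_map_def)

lemma bilinear_map_mem: "bilinear_map U V W f \<Longrightarrow> u \<in> vcar U \<Longrightarrow> v \<in> vcar V \<Longrightarrow> f u v \<in> vcar W"
  by (simp add: bilinear_map_def linear_map_def)

lemma vec_spaceD: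
  assumes "vec_space V"
  shows vec_space_zero: "0 \<in> vcar V"
    and vec_space_add: "x \<in> vcar V \<Longrightarrow> y \<in> vcar V \<Longrightarrow> x + y \<in> vcar V"
    and vec_space_scale: "x \<in> vcar V \<Longrightarrow> vscale V c x \<in> vcar V"
    and vscale_add: "vscale V c (x + y) = vscale V c x + vscale V c y"
    and vscale_zero: "vscale V c 0 = 0"
    and add_vscale: "vscale V (c + d) x = vscale V c x + vscale V d x"
    and vscale_vscale: "vscale V c (vscale V d x) = vscale V (c * d) x"
proof -
  have M: "module (vscale V)" and S: "module.subspace (vscale V) (vcar V)"
    using assms by (auto simp: vec_space_def module_iff_vector_space)
  then show "0 \<in> vcar V" "x \<in> vcar V \<Longrightarrow> y \<in> vcar V \<Longrightarrow> x + y \<in> vcar V"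
    "x \<in> vcar V \<Longrightarrow> vscale V c x \<in> vcar V"
    by (auto simp: module.subspace_0 module.subspace_add module.subspace_scale)
  show "vscale V c (x + y) = vscale V c x + vscale V c y" "vscale V c 0 = 0"
    "vscale V (c + d) x = vscale V c x + vscale V d x"
    "vscale V c (vscale V d x) = vscale V (c * d) x"
    using M
    by (auto simp: module.scale_right_distrib module.scale_left_distrib module.scale_scale
        module.scale_zero_right)
qed

lemma vec_space_ground [lin_intros]: "vec_space ground"
proof -
  interpret K: vector_space "(*) :: 'a::field \<Rightarrow> 'a \<Rightarrow> 'a"
    by unfold_locales (auto simp: algebra_simps)
  show ?thesis
    using K.vector_space_axioms K.subspace_UNIV by (simp add: vec_space_def ground_def)
qed

lemma vcar_ground [simp]: "vcar ground = UNIV"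
  by (simp add: ground_def)

lemma vec_space_tensor [lin_intros]:
  fixes U :: "('k::field, 'u::ab_group_add, 'y) vspace_scheme" and V :: "('k, 'v::ab_group_add, 'z) vspace_scheme"
  shows "vec_space (tensor U V)"
proof -
  interpret T: vector_space "fscale :: 'k \<Rightarrow> (('u \<Rightarrow> 'v \<Rightarrow> 'k) \<Rightarrow> 'k) \<Rightarrow> _"
    by (rule vector_space_fscale)
  show ?thesis
    using T.vector_space_axioms T.subspace_span by (simp add: vec_space_def tensor_def)
qed

lemma linear_map_zero: "vec_space V \<Longrightarrow> linear_map V W f \<Longrightarrow> f 0 = 0"
  using vec_space_zero[of V] unfolding linear_map_def
  by (metis add_cancel_right_right)

lemma linear_map_add [lin_intros]:
  assumes "vec_space W" "linear_map V W f" "linear_map V W g"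
  shows "linear_map V W (\<lambda>x. f x + g x)"
  using assms by (auto simp: linear_map_def vec_space_add vscale_add algebra_simps)

lemma linear_map_const_zero: "vec_space W \<Longrightarrow> linear_map V W (\<lambda>x. 0)"
  by (simp add: linear_map_def vec_space_zero vscale_zero)

lemma linear_map_sum:
  assumes "vec_space W" "\<And>i. i \<in> I \<Longrightarrow> linear_map V W (f i)"
  shows "linear_map V W (\<lambda>x. \<Sum>i\<in>I. f i x)"
  using assms(2)
  by (induction I rule: infinite_finite_induct)
    (auto intro!: linear_map_const_zero linear_map_add simp: assms(1))

lemma linear_map_sum_push:
  assumes "vec_space V" "linear_map V W F" "\<And>i. i \<in> I \<Longrightarrow> f i \<in> vcar V"
  shows "F (\<Sum>i\<in>I. f i) = (\<Sum>i\<in>I. F (f i))"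
proof -
  have "(\<Sum>i\<in>I. f i) \<in> vcar V \<and> F (\<Sum>i\<in>I. f i) = (\<Sum>i\<in>I. F (f i))"
    using assms(3)
  proof (induction I rule: infinite_finite_induct)
    case (insert i I)
    then show ?case
      using assms(2) by (auto simp: vec_space_add[OF assms(1)] linear_map_def)
  qed (simp_all add: vec_space_zero linear_map_zero[OF assms(1,2)] assms(1))
  then show ?thesis ..
qed

lemma linear_map_sum_list:
  assumes W: "vec_space W" and f: "\<And>i. i \<in> set xs \<Longrightarrow> linear_map V W (f i)"
  shows "linear_map V W (\<lambda>x. \<Sum>i\<leftarrow>xs. f i x)"
  using f by (induction xs) (auto intro!: linear_map_const_zero[OF W] linear_map_add[OF W])

lemma linear_map_sum_list_push:
  assumes V: "vec_space V" and F: "linear_map V W F" and f: "\<And>i. i \<in> set xs \<Longrightarrow> f i \<in> vcar V"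
  shows "(\<Sum>i\<leftarrow>xs. f i) \<in> vcar V" and "F (\<Sum>i\<leftarrow>xs. f i) = (\<Sum>i\<leftarrow>xs. F (f i))"
proof -
  have "(\<Sum>i\<leftarrow>xs. f i) \<in> vcar V \<and> F (\<Sum>i\<leftarrow>xs. f i) = (\<Sum>i\<leftarrow>xs. F (f i))"
    using f F
    by (induction xs) (auto simp: vec_space_zero[OF V] vec_space_add[OF V] linear_map_zero[OF V F] linear_map_def)
  then show "(\<Sum>i\<leftarrow>xs. f i) \<in> vcar V" "F (\<Sum>i\<leftarrow>xs. f i) = (\<Sum>i\<leftarrow>xs. F (f i))" by auto
qed

lemma linear_map_ground_mult_right [lin_intros]: "linear_map V ground f \<Longrightarrow> linear_map V ground (\<lambda>x. f x * c)"
  and linear_map_ground_mult_left [lin_intros]: "linear_map V ground f \<Longrightarrow> linear_map V ground (\<lambda>x. c * f x)"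
  by (simp_all add: linear_map_def ground_def algebra_simps)

lemma linear_map_vscale_left [lin_intros]:
  assumes "vec_space W" "linear_map V ground f" "w \<in> vcar W"
  shows "linear_map V W (\<lambda>x. vscale W (f x) w)"
  using assms by (auto simp: linear_map_def vec_space_scale add_vscale ground_def vscale_vscale)

lemma linear_map_vscale_right [lin_intros]:
  assumes "vec_space W" "linear_map V W f"
  shows "linear_map V W (\<lambda>x. vscale W c (f x))"
  using assms by (auto simp: linear_map_def vec_space_scale vscale_add vscale_vscale mult.commute)


section \<open>Sums over tensors\<close>

definition tensor_rep ::
  "('k::field, 'u::ab_group_add, 'y) vspace_scheme \<Rightarrow> ('k, 'v::ab_group_add, 'z) vspace_scheme \<Rightarrow>
   ('k, 'u, 'v) tens \<Rightarrow> ('u \<times> 'v) list" where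
  "tensor_rep U V t = (SOME r. set r \<subseteq> vcar U \<times> vcar V \<and> t = (\<Sum>(u, v)\<leftarrow>r. pure_tensor U V u v))"

text \<open>The representation chosen by \<open>tlift\<close> depends on the tensor only, so that
  \<open>tlift U V f t\<close> is additive in \<open>f\<close> and iterated sums commute for arbitrary \<open>f\<close>.\<close>

lemma tlift_eq_sum: "tlift U V f t = (\<Sum>(u, v)\<leftarrow>tensor_rep U V t. f u v)"
  by (simp add: tlift_def tensor_rep_def)

lemma tensor_rep_mem:
  assumes "vec_space U" "vec_space V" "t \<in> vcar (tensor U V)"
  shows "set (tensor_rep U V t) \<subseteq> vcar U \<times> vcar V"
  using someI_ex[OF tensor_representation[OF assms]] by (simp add: tensor_rep_def)

lemma sum_list_swap:
  fixes f :: "'a \<Rightarrow> 'b \<Rightarrow> 'c::comm_monoid_add"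
  shows "(\<Sum>x\<leftarrow>xs. \<Sum>y\<leftarrow>ys. f x y) = (\<Sum>y\<leftarrow>ys. \<Sum>x\<leftarrow>xs. f x y)"
  by (induction xs) (simp_all add: sum_list_addf)

lemma tlift_swap:
  "tlift A B (\<lambda>a b. tlift C D (\<lambda>c d. f a b c d) t) s = tlift C D (\<lambda>c d. tlift A B (\<lambda>a b. f a b c d) s) t"
  using sum_list_swap[of "\<lambda>(a, b) (c, d). f a b c d"] by (simp add: tlift_eq_sum case_prod_unfold)

lemma tlift_sum_distrib: "tlift A B (\<lambda>a b. \<Sum>i\<in>I. f i a b) t = (\<Sum>i\<in>I. tlift A B (f i) t)"
proof -
  have "(\<Sum>(u, v)\<leftarrow>xs. \<Sum>i\<in>I. f i u v) = (\<Sum>i\<in>I. \<Sum>(u, v)\<leftarrow>xs. f i u v)" for xs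
    by (induction xs) (auto simp: sum.distrib)
  then show ?thesis by (simp add: tlift_eq_sum)
qed

text \<open>For fixed \<open>t\<close> the chosen representation is fixed, so this is a finite sum
  of linear maps, whatever the dependence on \<open>a\<close> and \<open>b\<close>. Linearity in the
  tensor itself, as in \<open>linear_map_tlift_arg\<close>, comes instead from bilinearity and the
  universal property.\<close>

lemma linear_map_tlift_param:
  assumes "vec_space A" "vec_space B" "vec_space W" "t \<in> vcar (tensor A B)"
    and "\<And>a b. a \<in> vcar A \<Longrightarrow> b \<in> vcar B \<Longrightarrow> linear_map V W (\<lambda>x. f x a b)"
  shows "linear_map V W (\<lambda>x. tlift A B (f x) t)"
  unfolding tlift_eq_sum
  using tensor_rep_mem[OF assms(1,2,4)] assms(5)
  by (intro linear_map_sum_list[OF assms(3)]) auto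

lemma linear_map_tlift_arg:
  assumes "vec_space A" "vec_space B" "vec_space W" "linear_map V (tensor A B) k" "bilinear_map A B W f"
  shows "linear_map V W (\<lambda>x. tlift A B f (k x))"
  using tensor_universal(1)[OF assms(1-3,5)] assms(4) by (rule linear_map_compose)

lemma tlift_push:
  assumes "vec_space A" "vec_space B" "vec_space W" "linear_map W W' F" "t \<in> vcar (tensor A B)"
    and "\<And>a b. a \<in> vcar A \<Longrightarrow> b \<in> vcar B \<Longrightarrow> f a b \<in> vcar W"
  shows "F (tlift A B f t) = tlift A B (\<lambda>a b. F (f a b)) t"
    and "tlift A B f t \<in> vcar W"
proof -
  have *: "i \<in> set (tensor_rep A B t) \<Longrightarrow> (case i of (a, b) \<Rightarrow> f a b) \<in> vcar W" for i
    using tensor_rep_mem[OF assms(1,2,5)] assms(6) by auto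
  show "F (tlift A B f t) = tlift A B (\<lambda>a b. F (f a b)) t"
    using linear_map_sum_list_push(2)[OF assms(3,4), of "tensor_rep A B t" "\<lambda>(a, b). f a b"] *
    by (simp add: tlift_eq_sum case_prod_unfold)
  show "tlift A B f t \<in> vcar W"
    unfolding tlift_eq_sum by (rule linear_map_sum_list_push(1)[OF assms(3,4)]) (rule *)
qed

lemma pure_tensor_mem [lin_intros]:
  "vec_space U \<Longrightarrow> vec_space V \<Longrightarrow> u \<in> vcar U \<Longrightarrow> v \<in> vcar V \<Longrightarrow> pure_tensor U V u v \<in> vcar (tensor U V)"
  by (rule bilinear_map_mem[OF pure_tensor_bilinear])

lemma linear_map_pure_tensor_left [lin_intros]:
  "vec_space U \<Longrightarrow> vec_space V \<Longrightarrow> linear_map X U k \<Longrightarrow> v \<in> vcar V \<Longrightarrow>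
   linear_map X (tensor U V) (\<lambda>x. pure_tensor U V (k x) v)"
  by (rule bilinear_map_left[OF pure_tensor_bilinear])

lemma linear_map_pure_tensor_right [lin_intros]:
  "vec_space U \<Longrightarrow> vec_space V \<Longrightarrow> linear_map X V k \<Longrightarrow> u \<in> vcar U \<Longrightarrow>
   linear_map X (tensor U V) (\<lambda>x. pure_tensor U V u (k x))"
  by (rule bilinear_map_right[OF pure_tensor_bilinear])

text \<open>Both maps are lifts of the same bilinear map, \<open>G\<close> on pure tensors, so the
  uniqueness part of \<open>tensor_universal\<close> identifies each with that lift.\<close>

lemma tensor_ext:
  assumes U: "vec_space U" and V: "vec_space V" and W: "vec_space W"
    and F: "linear_map (tensor U V) W F" and G: "linear_map (tensor U V) W G"
    and eq: "\<And>u v. u \<in> vcar U \<Longrightarrow> v \<in> vcar V \<Longrightarrow> F (pure_tensor U V u v) = G (pure_tensor U V u v)"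
    and t: "t \<in> vcar (tensor U V)"
  shows "F t = G t"
proof -
  have B: "bilinear_map U V W (\<lambda>u v. G (pure_tensor U V u v))"
    by (intro bilinear_mapI linear_map_compose[OF G] lin_intros U V)
  show ?thesis
    using tensor_universal(3)[OF U V W B F eq t] tensor_universal(3)[OF U V W B G refl t] by simp
qed


section \<open>Fourfold tensor products\<close>

definition tens4 where
  "tens4 A B C D a b c d = pure_tensor (tensor A B) (tensor C D) (pure_tensor A B a b) (pure_tensor C D c d)"

definition lift4 where
  "lift4 A B C D F = tlift (tensor A B) (tensor C D) (\<lambda>s t. tlift A B (\<lambda>a b. tlift C D (\<lambda>c d. F a b c d) t) s)"

text \<open>Linearity in each argument is packaged as two bilinearity conditions because the nested
  lifts of \<open>lift4\<close> consume it in this form: the inner lift over \<open>C\<close>,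
  \<open>D\<close> at fixed \<open>a\<close>, \<open>b\<close>, the outer one over \<open>A\<close>,
  \<open>B\<close> at fixed \<open>c\<close>, \<open>d\<close>.\<close>

definition quadrilinear_map where
  "quadrilinear_map A B C D W F \<longleftrightarrow>
    (\<forall>a\<in>vcar A. \<forall>b\<in>vcar B. bilinear_map C D W (\<lambda>c d. F a b c d)) \<and>
    (\<forall>c\<in>vcar C. \<forall>d\<in>vcar D. bilinear_map A B W (\<lambda>a b. F a b c d))"

lemma quadrilinear_mapI [lin_intros]:
  assumes "\<And>b c d. b \<in> vcar B \<Longrightarrow> c \<in> vcar C \<Longrightarrow> d \<in> vcar D \<Longrightarrow> linear_map A W (\<lambda>a. F a b c d)"
    and "\<And>a c d. a \<in> vcar A \<Longrightarrow> c \<in> vcar C \<Longrightarrow> d \<in> vcar D \<Longrightarrow> linear_map B W (\<lambda>b. F a b c d)"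
    and "\<And>a b d. a \<in> vcar A \<Longrightarrow> b \<in> vcar B \<Longrightarrow> d \<in> vcar D \<Longrightarrow> linear_map C W (\<lambda>c. F a b c d)"
    and "\<And>a b c. a \<in> vcar A \<Longrightarrow> b \<in> vcar B \<Longrightarrow> c \<in> vcar C \<Longrightarrow> linear_map D W (\<lambda>d. F a b c d)"
  shows "quadrilinear_map A B C D W F"
  unfolding quadrilinear_map_def by (intro conjI ballI bilinear_mapI assms)

context
  fixes A :: "('k::field, 'a::ab_group_add) vspace" and B :: "('k, 'b::ab_group_add) vspace"
    and C :: "('k, 'c::ab_group_add) vspace" and D :: "('k, 'd::ab_group_add) vspace"
    and W :: "('k, 'w::ab_group_add, 'z) vspace_scheme"
  assumes A: "vec_space A" and B: "vec_space B" and C: "vec_space C" and D: "vec_space D"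
    and W: "vec_space W"
begin

text \<open>In \<open>t\<close>, every summand of the outer sum is a lift, hence linear. In
  \<open>s\<close>, the inner sum at fixed \<open>t\<close> is a finite sum of bilinear maps in
  \<open>a\<close>, \<open>b\<close>, and its lift is linear.\<close>

lemma quadrilinear_map_inner:
  assumes "quadrilinear_map A B C D W F"
  shows "bilinear_map (tensor A B) (tensor C D) W (\<lambda>s t. tlift A B (\<lambda>a b. tlift C D (\<lambda>c d. F a b c d) t) s)"
    (is "bilinear_map _ _ _ ?f")
proof (rule bilinear_mapI)
  have CD: "bilinear_map C D W (\<lambda>c d. F a b c d)" if "a \<in> vcar A" "b \<in> vcar B" for a b
    using assms that by (simp add: quadrilinear_map_def)
  have AB: "bilinear_map A B W (\<lambda>a b. F a b c d)" if "c \<in> vcar C" "d \<in> vcar D" for c d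
    using assms that by (simp add: quadrilinear_map_def)
  show "linear_map (tensor C D) W (\<lambda>t. ?f s t)" if "s \<in> vcar (tensor A B)" for s
    by (intro linear_map_tlift_param[OF A B W that] linear_map_tlift_arg[OF C D W] lin_intros CD)
  show "linear_map (tensor A B) W (\<lambda>s. ?f s t)" if t: "t \<in> vcar (tensor C D)" for t
  proof (intro linear_map_tlift_arg[OF A B W] linear_map_id)
    show "bilinear_map A B W (\<lambda>a b. tlift C D (F a b) t)"
      by (intro bilinear_mapI linear_map_tlift_param[OF C D W t] bilinear_map_left[OF AB]
          bilinear_map_right[OF AB] linear_map_id)
  qed
qed

lemma linear_map_lift4:
  assumes "quadrilinear_map A B C D W F" "linear_map V (tensor (tensor A B) (tensor C D)) k"
  shows "linear_map V W (\<lambda>x. lift4 A B C D F (k x))"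
  unfolding lift4_def
  by (intro linear_map_tlift_arg lin_intros W quadrilinear_map_inner assms)

lemma lift4_tens4:
  assumes F: "quadrilinear_map A B C D W F"
    and "a \<in> vcar A" "b \<in> vcar B" "c \<in> vcar C" "d \<in> vcar D"
  shows "lift4 A B C D F (tens4 A B C D a b c d) = F a b c d"
proof -
  let ?t = "pure_tensor C D c d"
  have t: "?t \<in> vcar (tensor C D)" by (intro lin_intros C D assms)
  have CD: "bilinear_map C D W (\<lambda>c d. F a b c d)" if "a \<in> vcar A" "b \<in> vcar B" for a b
    using assms that by (simp add: quadrilinear_map_def)
  have AB: "bilinear_map A B W (\<lambda>a b. F a b c d)" if "c \<in> vcar C" "d \<in> vcar D" for c d
    using assms that by (simp add: quadrilinear_map_def)
  have AB': "bilinear_map A B W (\<lambda>a b. tlift C D (F a b) ?t)"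
    by (intro bilinear_mapI linear_map_tlift_param[OF C D W t] bilinear_map_left[OF AB]
          bilinear_map_right[OF AB] linear_map_id)
  have "lift4 A B C D F (tens4 A B C D a b c d) =
      tlift A B (\<lambda>a b. tlift C D (\<lambda>c d. F a b c d) ?t) (pure_tensor A B a b)"
    unfolding lift4_def tens4_def
    by (intro tensor_universal(2)[OF _ _ W quadrilinear_map_inner[OF F]] lin_intros A B C D assms)
  also have "\<dots> = tlift C D (F a b) ?t"
    by (rule tensor_universal(2)[OF A B W AB' assms(2,3)])
  also have "\<dots> = F a b c d"
    by (rule tensor_universal(2)[OF C D W CD[OF assms(2,3)] assms(4,5)])
  finally show ?thesis .
qed

lemma linear_map_lift4_param:
  assumes "x \<in> vcar (tensor (tensor A B) (tensor C D))"
    and "\<And>a b c d. a \<in> vcar A \<Longrightarrow> b \<in> vcar B \<Longrightarrow> c \<in> vcar C \<Longrightarrow> d \<in> vcar D \<Longrightarrow>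
      linear_map V W (\<lambda>y. F y a b c d)"
  shows "linear_map V W (\<lambda>y. lift4 A B C D (F y) x)"
  unfolding lift4_def
  by (intro linear_map_tlift_param lin_intros assms W A B C D)

lemma tens4_ext:
  assumes F: "linear_map (tensor (tensor A B) (tensor C D)) W F"
    and G: "linear_map (tensor (tensor A B) (tensor C D)) W G"
    and eq: "\<And>a b c d. a \<in> vcar A \<Longrightarrow> b \<in> vcar B \<Longrightarrow> c \<in> vcar C \<Longrightarrow> d \<in> vcar D \<Longrightarrow>
      F (tens4 A B C D a b c d) = G (tens4 A B C D a b c d)"
    and t: "t \<in> vcar (tensor (tensor A B) (tensor C D))"
  shows "F t = G t"
proof (rule tensor_ext[OF vec_space_tensor vec_space_tensor W F G _ t])
  fix s t assume s: "s \<in> vcar (tensor A B)" and t: "t \<in> vcar (tensor C D)"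
  note comp = linear_map_compose[OF F] linear_map_compose[OF G]
  show "F (pure_tensor (tensor A B) (tensor C D) s t) = G (pure_tensor (tensor A B) (tensor C D) s t)"
  proof (rule tensor_ext[OF A B W _ _ _ s])
    fix a b assume ab: "a \<in> vcar A" "b \<in> vcar B"
    show "F (pure_tensor (tensor A B) (tensor C D) (pure_tensor A B a b) t) =
        G (pure_tensor (tensor A B) (tensor C D) (pure_tensor A B a b) t)"
      by (rule tensor_ext[OF C D W _ _ _ t])
        (intro comp lin_intros ab A B C D, intro comp lin_intros ab A B C D,
         rule eq[unfolded tens4_def, OF ab])
  qed (intro comp lin_intros t)+
qed

end

lemma tens4_mem:
  assumes "vec_space A" "vec_space B" "vec_space C" "vec_space D"
    "a \<in> vcar A" "b \<in> vcar B" "c \<in> vcar C" "d \<in> vcar D"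
  shows "tens4 A B C D a b c d \<in> vcar (tensor (tensor A B) (tensor C D))"
  unfolding tens4_def by (intro lin_intros assms)

lemma linear_map_tens4:
  assumes "vec_space A" "vec_space B" "vec_space C" "vec_space D"
  shows "linear_map X A k1 \<Longrightarrow> b \<in> vcar B \<Longrightarrow> c \<in> vcar C \<Longrightarrow> d \<in> vcar D \<Longrightarrow>
      linear_map X (tensor (tensor A B) (tensor C D)) (\<lambda>x. tens4 A B C D (k1 x) b c d)"
    and "a \<in> vcar A \<Longrightarrow> linear_map X B k2 \<Longrightarrow> c \<in> vcar C \<Longrightarrow> d \<in> vcar D \<Longrightarrow>
      linear_map X (tensor (tensor A B) (tensor C D)) (\<lambda>x. tens4 A B C D a (k2 x) c d)"
    and "a \<in> vcar A \<Longrightarrow> b \<in> vcar B \<Longrightarrow> linear_map X C k3 \<Longrightarrow> d \<in> vcar D \<Longrightarrow>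
      linear_map X (tensor (tensor A B) (tensor C D)) (\<lambda>x. tens4 A B C D a b (k3 x) d)"
    and "a \<in> vcar A \<Longrightarrow> b \<in> vcar B \<Longrightarrow> c \<in> vcar C \<Longrightarrow> linear_map X D k4 \<Longrightarrow>
      linear_map X (tensor (tensor A B) (tensor C D)) (\<lambda>x. tens4 A B C D a b c (k4 x))"
  unfolding tens4_def by (intro lin_intros assms; assumption)+


section \<open>Sweedler calculus\<close>

context hopf_algebra
begin

lemma vcar_hspace [simp]: "vcar (hspace H) = UNIV"
  by (simp add: hspace_def)

lemma hspace_mem [lin_intros]: "x \<in> vcar (hspace H)"
  by simp

lemma vec_space_hspace [lin_intros]: "vec_space (hspace H)"
  using vector_space_axioms subspace_UNIV by (simp add: vec_space_def hspace_def)

lemma dual_iff: "p \<in> vcar (dual H) \<longleftrightarrow> linear_map (hspace H) ground p"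
proof -
  interpret K: vector_space "(*) :: 'k \<Rightarrow> 'k \<Rightarrow> 'k"
    by unfold_locales (auto simp: algebra_simps)
  show ?thesis
    by (auto simp: dual_def linear_map_def hspace_def ground_def Vector_Spaces.linear_iff
        vector_space_axioms K.vector_space_axioms)
qed

lemma linear_map_dual_apply: "p \<in> vcar (dual H) \<Longrightarrow> linear_map X (hspace H) k \<Longrightarrow> linear_map X ground (\<lambda>x. p (k x))"
  unfolding dual_iff by (rule linear_map_compose)

lemma dual_scale: "p \<in> vcar (dual H) \<Longrightarrow> p (hscale H c x) = c * p x"
  by (simp add: dual_iff linear_map_def hspace_def ground_def)

lemma vec_space_dual [lin_intros]: "vec_space (dual H)"
proof -
  interpret F: vector_space "fscale :: 'k \<Rightarrow> ('h \<Rightarrow> 'k) \<Rightarrow> _"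
    by (rule vector_space_fscale)
  have "F.subspace (vcar (dual H))"
    unfolding F.subspace_def
    by (auto simp: dual_iff linear_map_def fscale_def ground_def algebra_simps)
  then show ?thesis
    using F.vector_space_axioms by (simp add: vec_space_def dual_def)
qed

lemma linear_map_mult_left [lin_intros]: "linear_map X (hspace H) k \<Longrightarrow> linear_map X (hspace H) (\<lambda>x. k x * y)"
  and linear_map_mult_right [lin_intros]: "linear_map X (hspace H) k \<Longrightarrow> linear_map X (hspace H) (\<lambda>x. y * k x)"
  by (simp_all add: linear_map_def hspace_def scale_mult_left scale_mult_right algebra_simps)

lemma linear_map_antipode [lin_intros]: "linear_map X (hspace H) k \<Longrightarrow> linear_map X (hspace H) (\<lambda>x. antipode H (k x))"
proof (rule linear_map_compose[where f = "antipode H"])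
  interpret S: Vector_Spaces.linear "hscale H" "hscale H" "antipode H"
    by (rule antipode_linear)
  show "linear_map (hspace H) (hspace H) (antipode H)"
    by (simp add: linear_map_def hspace_def S.add S.scale)
qed

lemma counit_mem [lin_intros]: "counit H \<in> vcar (dual H)"
  using counit_linear by (simp add: dual_def)

lemma comult_mem: "comult H h \<in> vcar (hh_space H)"
  using linear_map_mem[OF comult_linear] by simp

lemma linear_map_sweedler2_param [lin_intros]:
  assumes "vec_space W" "\<And>a b. linear_map V W (\<lambda>x. f x a b)"
  shows "linear_map V W (\<lambda>x. sweedler2 H h (f x))"
  unfolding sweedler2_def
  by (intro linear_map_tlift_param lin_intros comult_mem assms)

lemma linear_map_sweedler2_arg [lin_intros]:
  assumes "vec_space W" "linear_map V (hspace H) k" "bilinear_map (hspace H) (hspace H) W f"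
  shows "linear_map V W (\<lambda>x. sweedler2 H (k x) f)"
  unfolding sweedler2_def
  by (intro linear_map_tlift_arg lin_intros linear_map_compose[OF comult_linear] assms)

lemma sweedler2_swap:
  "sweedler2 H x (\<lambda>a b. sweedler2 H y (\<lambda>c d. f a b c d)) = sweedler2 H y (\<lambda>c d. sweedler2 H x (\<lambda>a b. f a b c d))"
  unfolding sweedler2_def by (rule tlift_swap)

lemma sweedler2_push:
  assumes "linear_map W W' F" "vec_space W" "\<And>a b. f a b \<in> vcar W"
  shows "F (sweedler2 H h f) = sweedler2 H h (\<lambda>a b. F (f a b))"
  unfolding sweedler2_def by (rule tlift_push(1)[OF _ _ assms(2,1)]) (intro lin_intros comult_mem assms)+

lemma sweedler2_mem [lin_intros]:
  assumes "vec_space W" "\<And>a b. f a b \<in> vcar W"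
  shows "sweedler2 H h f \<in> vcar W"
  unfolding sweedler2_def by (rule tlift_push(2)[OF _ _ assms(1) linear_map_id]) (intro lin_intros comult_mem assms)+

text \<open>The axiom \<open>coassoc\<close> equates two elements of a threefold tensor product. The
  linear map \<open>?T\<close> induced by the trilinear \<open>f\<close> carries it to the
  corresponding sums of \<open>f\<close>.\<close>

lemma sweedler2_coassoc:
  assumes W: "vec_space W"
    and f: "\<And>b c. linear_map (hspace H) W (\<lambda>a. f a b c)"
      "\<And>a c. linear_map (hspace H) W (\<lambda>b. f a b c)"
      "\<And>a b. linear_map (hspace H) W (\<lambda>c. f a b c)"
  shows "sweedler2 H h (\<lambda>a y. sweedler2 H y (\<lambda>b c. f a b c)) =
    sweedler2 H h (\<lambda>y c. sweedler2 H y (\<lambda>a b. f a b c))"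
proof -
  let ?T = "tlift (hspace H) (hh_space H) (\<lambda>a t. tlift (hspace H) (hspace H) (f a) t)"
  let ?t = "\<lambda>a b c. pure_tensor (hspace H) (hh_space H) a (pure_tensor (hspace H) (hspace H) b c)"
  have f2: "bilinear_map (hspace H) (hspace H) W (f a)" for a
    by (intro lin_intros f)
  have B: "bilinear_map (hspace H) (hh_space H) W (\<lambda>a t. tlift (hspace H) (hspace H) (f a) t)"
    by (intro lin_intros linear_map_tlift_param linear_map_tlift_arg f2 f W)
  have T: "linear_map (tensor (hspace H) (hh_space H)) W ?T"
    by (intro tensor_universal(1) lin_intros W B)
  have eval: "?T (?t a b c) = f a b c" for a b c
    by (subst tensor_universal(2)[OF _ _ W B]; (intro lin_intros)?)
      (intro tensor_universal(2)[OF _ _ W f2] lin_intros)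
  have "?T (sweedler2 H h (\<lambda>a y. sweedler2 H y (\<lambda>b c. ?t a b c))) =
      sweedler2 H h (\<lambda>a y. sweedler2 H y (\<lambda>b c. f a b c))"
    by (subst sweedler2_push[OF T]; (intro lin_intros)?)+ (simp only: eval)
  moreover have "?T (sweedler2 H h (\<lambda>y c. sweedler2 H y (\<lambda>a b. ?t a b c))) =
      sweedler2 H h (\<lambda>y c. sweedler2 H y (\<lambda>a b. f a b c))"
    by (subst sweedler2_push[OF T]; (intro lin_intros)?)+ (simp only: eval)
  ultimately show ?thesis by (simp only: coassoc)
qed

lemma sweedler2_counit_left:
  assumes "vec_space W" "linear_map (hspace H) W f"
  shows "sweedler2 H h (\<lambda>a b. vscale W (counit H a) (f b)) = f h"
proof -
  have "f (sweedler2 H h (\<lambda>a b. hscale H (counit H a) b)) = sweedler2 H h (\<lambda>a b. f (hscale H (counit H a) b))"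
    by (intro sweedler2_push[OF assms(2)] lin_intros)
  then show ?thesis
    using assms(2) by (simp add: counit_left linear_map_def hspace_def)
qed

lemma sweedler2_counit_right:
  assumes "vec_space W" "linear_map (hspace H) W f"
  shows "sweedler2 H h (\<lambda>a b. vscale W (counit H b) (f a)) = f h"
proof -
  have "f (sweedler2 H h (\<lambda>a b. hscale H (counit H b) a)) = sweedler2 H h (\<lambda>a b. f (hscale H (counit H b) a))"
    by (intro sweedler2_push[OF assms(2)] lin_intros)
  then show ?thesis
    using assms(2) by (simp add: counit_right linear_map_def hspace_def)
qed

lemma sweedler2_mult:
  assumes "vec_space W" "bilinear_map (hspace H) (hspace H) W f"
  shows "sweedler2 H (x * y) f = sweedler2 H x (\<lambda>a b. sweedler2 H y (\<lambda>c d. f (a * c) (b * d)))"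
proof -
  have T: "linear_map (hh_space H) W (tlift (hspace H) (hspace H) f)"
    by (intro tensor_universal(1) lin_intros assms)
  have "sweedler2 H (x * y) f = tlift (hspace H) (hspace H) f (comult H (x * y))"
    by (simp add: sweedler2_def)
  also have "\<dots> = sweedler2 H x (\<lambda>a b. sweedler2 H y (\<lambda>c d.
      tlift (hspace H) (hspace H) f (pure_tensor (hspace H) (hspace H) (a * c) (b * d))))"
    unfolding comult_mult by (subst sweedler2_push[OF T]; (intro lin_intros)?)+ (rule refl)
  also have "\<dots> = sweedler2 H x (\<lambda>a b. sweedler2 H y (\<lambda>c d. f (a * c) (b * d)))"
    by (subst tensor_universal(2)[OF _ _ assms]; (intro lin_intros)?) (rule refl)
  finally show ?thesis .
qed

lemma sweedler2_one:
  assumes "vec_space W" "bilinear_map (hspace H) (hspace H) W f"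
  shows "sweedler2 H 1 f = f 1 1"
  unfolding sweedler2_def comult_one by (rule tensor_universal(2)[OF _ _ assms]) (intro lin_intros)+

lemma linear_map_hscale: "linear_map (hspace H) W f \<Longrightarrow> f (hscale H c x) = vscale W c (f x)"
  by (simp add: linear_map_def hspace_def)

text \<open>The parameter \<open>\<sigma>\<close> stands for any of the four products that sum to
  the counit: S(a) b and a S(b), and, once S is known to be bijective, the reversed products with
  its inverse.\<close>

lemma sweedler2_absorb:
  assumes W: "vec_space W" and \<sigma>: "\<And>h. sweedler2 H h (\<lambda>a b. \<sigma> a b) = hscale H (counit H h) 1"
    and f: "linear_map (hspace H) W f"
  shows "sweedler2 H h (\<lambda>a b. f (\<sigma> a b)) = vscale W (counit H h) (f 1)"
proof -
  have "f (sweedler2 H h (\<lambda>a b. \<sigma> a b)) = sweedler2 H h (\<lambda>a b. f (\<sigma> a b))"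
    by (intro sweedler2_push[OF f] lin_intros)
  then show ?thesis by (simp add: \<sigma> linear_map_hscale[OF f])
qed

lemma sweedler2_absorb_right:
  assumes W: "vec_space W" and \<sigma>: "\<And>h. sweedler2 H h (\<lambda>a b. \<sigma> a b) = hscale H (counit H h) 1"
    and f: "\<And>x. linear_map (hspace H) W (f x)" "linear_map (hspace H) W (\<lambda>x. f x 1)"
  shows "sweedler2 H h (\<lambda>a b. sweedler2 H b (\<lambda>c d. f a (\<sigma> c d))) = f h 1"
  by (simp only: sweedler2_absorb[OF W \<sigma> f(1)] sweedler2_counit_right[OF W f(2)])

lemma sweedler2_absorb_left:
  assumes W: "vec_space W" and \<sigma>: "\<And>h. sweedler2 H h (\<lambda>a b. \<sigma> a b) = hscale H (counit H h) 1"
    and f: "\<And>y. linear_map (hspace H) W (\<lambda>x. f x y)" "linear_map (hspace H) W (\<lambda>y. f 1 y)"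
  shows "sweedler2 H h (\<lambda>a b. sweedler2 H a (\<lambda>c d. f (\<sigma> c d) b)) = f 1 h"
  by (simp only: sweedler2_absorb[OF W \<sigma> f(1)] sweedler2_counit_left[OF W f(2)])

text \<open>Uniqueness of convolution inverses: both sides invert the multiplication as a map from H
  \<otimes> H to H. Here \<open>?L\<close> is the sum of S(x1 y1) x2 y2 S(y3) S(x3). Cancelling from
  the inside, first y2 S(y3), leaves S(x y); reading x1 y1 and x2 y2 as the coproduct of a product
  cancels the left part and leaves S(y) S(x).\<close>

lemma antipode_mult: "antipode H (x * y) = antipode H y * antipode H x"
proof -
  let ?S = "antipode H" and ?sw = "sweedler2 H"
  let ?L = "?sw x (\<lambda>a b. ?sw b (\<lambda>b1 b2. ?sw y (\<lambda>c d. ?sw d (\<lambda>d1 d2.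
    ?S (a * c) * (b1 * (d1 * ?S d2) * ?S b2)))))"
  have "?L = ?sw x (\<lambda>a b. ?sw b (\<lambda>b1 b2. ?S (a * y) * (b1 * 1 * ?S b2)))"
    by (subst sweedler2_absorb_right[where W = "hspace H" and \<sigma> = "\<lambda>a b. a * ?S b"];
      (intro lin_intros antipode_right)?) (rule refl)
  also have "\<dots> = ?sw x (\<lambda>a b. ?sw b (\<lambda>b1 b2. ?S (a * y) * (b1 * ?S b2)))"
    by simp
  also have "\<dots> = ?S (x * y)"
    by (subst sweedler2_absorb_right[where W = "hspace H" and \<sigma> = "\<lambda>a b. a * ?S b"];
      (intro lin_intros antipode_right)?) simp
  finally have 1: "?L = ?S (x * y)" .
  have "?L = ?sw x (\<lambda>a b. ?sw b (\<lambda>b1 b2. ?sw y (\<lambda>c d. ?sw d (\<lambda>d1 d2.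
    ?S (a * c) * (b1 * d1) * (?S d2 * ?S b2)))))"
    by (simp only: mult.assoc)
  also have "\<dots> = ?sw x (\<lambda>a b. ?sw b (\<lambda>b1 b2. ?sw y (\<lambda>e d2. ?sw e (\<lambda>c d1.
    ?S (a * c) * (b1 * d1) * (?S d2 * ?S b2)))))"
    by (subst sweedler2_coassoc[where W = "hspace H" and h = y]; (intro lin_intros)?) (rule refl)
  also have "\<dots> = ?sw x (\<lambda>g b2. ?sw g (\<lambda>a b1. ?sw y (\<lambda>e d2. ?sw e (\<lambda>c d1.
    ?S (a * c) * (b1 * d1) * (?S d2 * ?S b2)))))"
    by (rule sweedler2_coassoc[where W = "hspace H" and h = x]) (intro lin_intros)+
  also have "\<dots> = ?sw x (\<lambda>g b2. ?sw y (\<lambda>e d2. ?sw g (\<lambda>a b1. ?sw e (\<lambda>c d1.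
    ?S (a * c) * (b1 * d1) * (?S d2 * ?S b2)))))"
    by (subst sweedler2_swap[where y = y]) (rule refl)
  also have "\<dots> = ?sw x (\<lambda>g b2. ?sw y (\<lambda>e d2. ?sw (g * e) (\<lambda>u v. ?S u * v * (?S d2 * ?S b2))))"
    by (subst sweedler2_mult[where W = "hspace H"]; (intro lin_intros)?) (rule refl)
  also have "\<dots> = ?sw x (\<lambda>g b2. ?sw y (\<lambda>e d2.
    vscale (hspace H) (counit H g) (vscale (hspace H) (counit H e) (?S d2 * ?S b2))))"
    by (subst sweedler2_absorb[where W = "hspace H" and \<sigma> = "\<lambda>a b. ?S a * b"];
      (intro lin_intros antipode_left)?) (simp add: counit_mult vscale_vscale[OF vec_space_hspace])
  also have "\<dots> = ?sw y (\<lambda>e d2. ?sw x (\<lambda>g b2.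
    vscale (hspace H) (counit H g) (vscale (hspace H) (counit H e) (?S d2 * ?S b2))))"
    by (rule sweedler2_swap)
  also have "\<dots> = ?S y * ?S x"
    by (subst sweedler2_counit_left; (intro lin_intros)?)+ (rule refl)
  finally show ?thesis using 1 by simp
qed

lemma antipode_one: "antipode H 1 = 1"
  using antipode_left[of 1] sweedler2_one[of "hspace H" "\<lambda>a b. antipode H a * b"]
  by (simp add: lin_intros counit_one)

text \<open>Again a convolution inverse, now of the coproduct: \<open>?L\<close> evaluates
  \<open>f\<close> on \<Delta>(S(h1) h2) multiplied by S(h4) \<otimes> S(h3). Cancelling S(h1) h2
  gives the right side; splitting \<Delta> multiplicatively and cancelling everything after S(h1)
  gives the left side.\<close>

lemma sweedler2_antipode:
  assumes W: "vec_space W" and f: "bilinear_map (hspace H) (hspace H) W f"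
  shows "sweedler2 H (antipode H h) f = sweedler2 H h (\<lambda>a b. f (antipode H b) (antipode H a))"
proof -
  let ?S = "antipode H" and ?sw = "sweedler2 H"
  note f_lin = bilinear_map_left[OF f] bilinear_map_right[OF f]
  let ?L = "?sw h (\<lambda>a b. ?sw b (\<lambda>b1 b2. ?sw (?S a * b1) (\<lambda>u v. ?sw b2 (\<lambda>c d. f (u * ?S d) (v * ?S c)))))"
  have "?L = ?sw h (\<lambda>e b2. ?sw e (\<lambda>a b1. ?sw (?S a * b1) (\<lambda>u v. ?sw b2 (\<lambda>c d. f (u * ?S d) (v * ?S c)))))"
    by (rule sweedler2_coassoc[OF W]) (intro lin_intros f_lin W)+
  also have "\<dots> = ?sw 1 (\<lambda>u v. ?sw h (\<lambda>c d. f (u * ?S d) (v * ?S c)))"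
    by (rule sweedler2_absorb_left[where W = W and \<sigma> = "\<lambda>a b. ?S a * b"]) (intro lin_intros f_lin W antipode_left)+
  also have "\<dots> = ?sw h (\<lambda>c d. f (?S d) (?S c))"
    by (subst sweedler2_one[OF W]; (intro lin_intros f_lin W)?) simp
  finally have 1: "?L = ?sw h (\<lambda>c d. f (?S d) (?S c))" .
  \<comment> \<open>The factors \<open>u\<close>, \<open>v\<close>, \<open>c\<close>,
    \<open>d\<close> are four consecutive pieces of \<open>b\<close>, obtained by splitting both
    halves of its coproduct. Rebracketing twice makes \<open>v\<close> and \<open>c\<close> the
    halves of one coproduct, so that \<open>v * ?S c\<close> cancels.\<close>
  have inner: "?sw b (\<lambda>b1 b2. ?sw b1 (\<lambda>u v. ?sw b2 (\<lambda>c d. g u (v * ?S c) d))) = ?sw b (\<lambda>u d. g u 1 d)"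
    if g: "\<And>b c. linear_map (hspace H) W (\<lambda>a. g a b c)"
      "\<And>a c. linear_map (hspace H) W (\<lambda>b. g a b c)"
      "\<And>a b. linear_map (hspace H) W (\<lambda>c. g a b c)" for g b
  proof -
    note g_lin = g[THEN linear_map_compose]
    have "?sw b (\<lambda>b1 b2. ?sw b1 (\<lambda>u v. ?sw b2 (\<lambda>c d. g u (v * ?S c) d))) =
        ?sw b (\<lambda>u y. ?sw y (\<lambda>v b2. ?sw b2 (\<lambda>c d. g u (v * ?S c) d)))"
      by (rule sweedler2_coassoc[OF W, symmetric]) (intro lin_intros g_lin W)+
    also have "\<dots> = ?sw b (\<lambda>u y. ?sw y (\<lambda>z d. ?sw z (\<lambda>v c. g u (v * ?S c) d)))"
      by (subst (2) sweedler2_coassoc[where W = W]; (intro lin_intros g_lin W)?) (rule refl)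
    also have "\<dots> = ?sw b (\<lambda>u d. g u 1 d)"
      by (subst sweedler2_absorb_left[where W = W and \<sigma> = "\<lambda>a b. a * ?S b"];
        (intro lin_intros g_lin W antipode_right)?) (rule refl)
    finally show ?thesis .
  qed
  have absorb: "?sw b (\<lambda>u d. f (s * (u * ?S d)) t) = vscale W (counit H b) (f s t)" for b s t
    using sweedler2_absorb[where W = W and \<sigma> = "\<lambda>a b. a * ?S b" and f = "\<lambda>z. f (s * z) t" and h = b,
        OF W antipode_right]
    by (simp add: lin_intros f_lin)
  have "?L = ?sw h (\<lambda>a b. ?sw b (\<lambda>b1 b2. ?sw (?S a) (\<lambda>s t. ?sw b1 (\<lambda>u v. ?sw b2 (\<lambda>c d.
      f (s * u * ?S d) (t * v * ?S c))))))"
    by (subst sweedler2_mult[OF W]; (intro lin_intros f_lin W)?) (rule refl)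
  also have "\<dots> = ?sw h (\<lambda>a b. ?sw (?S a) (\<lambda>s t. ?sw b (\<lambda>b1 b2. ?sw b1 (\<lambda>u v. ?sw b2 (\<lambda>c d.
      f (s * u * ?S d) (t * (v * ?S c)))))))"
    by (simp only: mult.assoc) (subst (2) sweedler2_swap, rule refl)
  also have "\<dots> = ?sw h (\<lambda>a b. ?sw (?S a) (\<lambda>s t. ?sw b (\<lambda>u d. f (s * u * ?S d) (t * 1))))"
    by (subst inner; (intro lin_intros f_lin W)?) (rule refl)
  also have "\<dots> = ?sw h (\<lambda>a b. ?sw (?S a) (\<lambda>s t. vscale W (counit H b) (f s t)))"
    by (simp only: mult.assoc mult_1_right absorb)
  also have "\<dots> = ?sw h (\<lambda>a b. vscale W (counit H b) (?sw (?S a) f))"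
    by (subst sweedler2_push[where F = "vscale W c" and W = W and W' = W for c];
       (intro lin_intros linear_map_vscale_right bilinear_map_mem[OF f] W)?) (rule refl)
  also have "\<dots> = ?sw (?S h) f"
    by (rule sweedler2_counit_right[OF W]) (intro lin_intros f W)+
  finally show ?thesis using 1 by simp
qed

end


section \<open>The dual algebra and the regular actions\<close>

context hopf_algebra
begin

lemma sum_apply: "(\<Sum>i\<in>I. f i) x = (\<Sum>i\<in>I. f i x)"
  by (induction I rule: infinite_finite_induct) auto

lemma sweedler2_apply: "sweedler2 H h F x = sweedler2 H h (\<lambda>a b. F a b x)"
proof -
  have "(\<Sum>(u, v)\<leftarrow>r. F u v) x = (\<Sum>(u, v)\<leftarrow>r. F u v x)" for r
    by (induction r) auto
  then show ?thesis by (simp add: sweedler2_def tlift_eq_sum)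
qed

lemma sweedler2_sum: "sweedler2 H h (\<lambda>a b. \<Sum>i\<in>I. f i a b) = (\<Sum>i\<in>I. sweedler2 H h (f i))"
  unfolding sweedler2_def by (rule tlift_sum_distrib)

lemma sweedler2_zero [simp]: "sweedler2 H h (\<lambda>a b. 0) = 0"
  using sweedler2_sum[of h "\<lambda>_ _ _. 0" "{}"] by simp

lemma vscale_ground [simp]: "vscale ground = (*)"
  by (simp add: ground_def)

lemma sweedler2_times_right: "sweedler2 H h (\<lambda>a b. f a b) * (c::'k) = sweedler2 H h (\<lambda>a b. f a b * c)"
  by (rule sweedler2_push[where W = ground and W' = ground and F = "\<lambda>x. x * c"]) (intro lin_intros | simp)+

lemma sweedler2_times_left: "(c::'k) * sweedler2 H h (\<lambda>a b. f a b) = sweedler2 H h (\<lambda>a b. c * f a b)"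
  by (rule sweedler2_push[where W = ground and W' = ground and F = "\<lambda>x. c * x"]) (intro lin_intros | simp)+

lemma linear_map_dualI:
  assumes "\<And>x. x \<in> vcar V \<Longrightarrow> F x \<in> vcar (dual H)" "\<And>h. linear_map V ground (\<lambda>x. F x h)"
  shows "linear_map V (dual H) F"
  using assms by (auto simp: linear_map_def dual_def fscale_def ground_def)

lemma linear_map_dual_eval: "linear_map V (dual H) F \<Longrightarrow> linear_map V ground (\<lambda>x. F x h)"
  by (auto simp: linear_map_def dual_def fscale_def ground_def)

lemma ground_mem [lin_intros]: "x \<in> vcar ground"
  by simp

lemma dmult_mem [lin_intros]:
  assumes "p \<in> vcar (dual H)" "q \<in> vcar (dual H)"
  shows "dmult H p q \<in> vcar (dual H)"
  unfolding dual_iff dmult_def by (intro lin_intros linear_map_dual_apply[OF assms(1)] linear_map_dual_apply[OF assms(2)])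

lemma lreg_mem [lin_intros]:
  assumes "p \<in> vcar (dual H)"
  shows "h \<rightharpoonup> p \<in> vcar (dual H)"
  unfolding dual_iff lreg_def by (intro lin_intros linear_map_dual_apply[OF assms])

lemma rreg_mem [lin_intros]:
  assumes "p \<in> vcar (dual H)"
  shows "p \<leftharpoonup> h \<in> vcar (dual H)"
  unfolding dual_iff rreg_def by (intro lin_intros linear_map_dual_apply[OF assms])

lemma linear_map_dmult_left [lin_intros]:
  assumes "linear_map X (dual H) k" "q \<in> vcar (dual H)"
  shows "linear_map X (dual H) (\<lambda>x. dmult H (k x) q)"
  by (intro linear_map_dualI lin_intros linear_map_mem[OF assms(1)] assms(2))
    (simp_all add: dmult_def lin_intros linear_map_dual_eval[OF assms(1)])

lemma linear_map_dmult_right [lin_intros]: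
  assumes "linear_map X (dual H) k" "p \<in> vcar (dual H)"
  shows "linear_map X (dual H) (\<lambda>x. dmult H p (k x))"
  by (intro linear_map_dualI lin_intros linear_map_mem[OF assms(1)] assms(2))
    (simp_all add: dmult_def lin_intros linear_map_dual_eval[OF assms(1)])

lemma linear_map_lreg_left [lin_intros]:
  assumes "linear_map X (hspace H) k" "p \<in> vcar (dual H)"
  shows "linear_map X (dual H) (\<lambda>x. k x \<rightharpoonup> p)"
  by (intro linear_map_dualI lin_intros assms(2))
    (simp add: lreg_def, intro linear_map_dual_apply[OF assms(2)] lin_intros assms(1))

lemma linear_map_lreg_right [lin_intros]:
  assumes "linear_map X (dual H) k"
  shows "linear_map X (dual H) (\<lambda>x. h \<rightharpoonup> k x)"
  by (intro linear_map_dualI lin_intros linear_map_mem[OF assms])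
    (simp_all add: lreg_def linear_map_dual_eval[OF assms])

lemma linear_map_rreg_right [lin_intros]:
  assumes "linear_map X (hspace H) k" "p \<in> vcar (dual H)"
  shows "linear_map X (dual H) (\<lambda>x. p \<leftharpoonup> k x)"
  by (intro linear_map_dualI lin_intros assms(2))
    (simp add: rreg_def, intro linear_map_dual_apply[OF assms(2)] lin_intros assms(1))

lemma linear_map_rreg_left [lin_intros]:
  assumes "linear_map X (dual H) k"
  shows "linear_map X (dual H) (\<lambda>x. k x \<leftharpoonup> h)"
  by (intro linear_map_dualI lin_intros linear_map_mem[OF assms])
    (simp_all add: rreg_def linear_map_dual_eval[OF assms])

lemma dmult_assoc:
  assumes p: "p \<in> vcar (dual H)" and q: "q \<in> vcar (dual H)" and r: "r \<in> vcar (dual H)"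
  shows "dmult H (dmult H p q) r = dmult H p (dmult H q r)"
proof
  fix h
  have "dmult H p (dmult H q r) h = sweedler2 H h (\<lambda>a y. sweedler2 H y (\<lambda>b c. p a * (q b * r c)))"
    by (simp add: dmult_def sweedler2_times_left)
  also have "\<dots> = sweedler2 H h (\<lambda>y c. sweedler2 H y (\<lambda>a b. p a * (q b * r c)))"
    by (rule sweedler2_coassoc[where W = ground])
      (intro lin_intros linear_map_dual_apply[OF p] linear_map_dual_apply[OF q] linear_map_dual_apply[OF r])+
  also have "\<dots> = dmult H (dmult H p q) r h"
    by (simp add: dmult_def sweedler2_times_right mult.assoc)
  finally show "dmult H (dmult H p q) r h = dmult H p (dmult H q r) h" by simp
qed

lemma dmult_counit_left:
  assumes "p \<in> vcar (dual H)"
  shows "dmult H (counit H) p = p"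
  using sweedler2_counit_left[where W = ground and f = p] assms
  by (simp add: fun_eq_iff dmult_def dual_iff lin_intros)

lemma dmult_counit_right:
  assumes "p \<in> vcar (dual H)"
  shows "dmult H p (counit H) = p"
  using sweedler2_counit_right[where W = ground and f = p] assms
  by (simp add: fun_eq_iff dmult_def dual_iff lin_intros mult.commute)

lemma lreg_lreg: "a \<rightharpoonup> (b \<rightharpoonup> p) = (a * b) \<rightharpoonup> (p :: 'h \<Rightarrow> 'k)"
  by (simp add: lreg_def mult.assoc)

lemma rreg_rreg: "(p :: 'h \<Rightarrow> 'k) \<leftharpoonup> a \<leftharpoonup> b = p \<leftharpoonup> (a * b)"
  by (simp add: rreg_def mult.assoc)

lemma lreg_rreg: "a \<rightharpoonup> (p \<leftharpoonup> b) = a \<rightharpoonup> (p :: 'h \<Rightarrow> 'k) \<leftharpoonup> b"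
  by (simp add: rreg_def lreg_def mult.assoc)

lemma lreg_one: "1 \<rightharpoonup> p = (p :: 'h \<Rightarrow> 'k)"
  by (simp add: lreg_def)

lemma rreg_one: "(p :: 'h \<Rightarrow> 'k) \<leftharpoonup> 1 = p"
  by (simp add: rreg_def)

lemma lreg_counit: "a \<rightharpoonup> counit H = fscale (counit H a) (counit H)"
  by (simp add: lreg_def fscale_def counit_mult fun_eq_iff mult.commute)

lemma rreg_counit: "counit H \<leftharpoonup> a = fscale (counit H a) (counit H)"
  by (simp add: rreg_def fscale_def counit_mult fun_eq_iff)

text \<open>Multiplicativity of the coproduct makes \<open>H^*\<close> a module algebra for
  \<open>\<rightharpoonup>\<close>; \<open>rreg_dmult\<close> is the mirror image. Associativity of
  \<open>Z\<close> rests on these two facts.\<close>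

lemma lreg_dmult:
  assumes p: "p \<in> vcar (dual H)" and q: "q \<in> vcar (dual H)"
  shows "h \<rightharpoonup> dmult H p q = sweedler2 H h (\<lambda>a b. dmult H (a \<rightharpoonup> p) (b \<rightharpoonup> q))"
proof
  fix x
  have "(h \<rightharpoonup> dmult H p q) x = sweedler2 H x (\<lambda>c d. sweedler2 H h (\<lambda>a b. p (c * a) * q (d * b)))"
    unfolding lreg_def dmult_def
    by (rule sweedler2_mult[where W = ground]) (intro lin_intros linear_map_dual_apply[OF p] linear_map_dual_apply[OF q])+
  also have "\<dots> = sweedler2 H h (\<lambda>a b. dmult H (a \<rightharpoonup> p) (b \<rightharpoonup> q)) x"
    by (subst sweedler2_swap) (simp add: sweedler2_apply dmult_def lreg_def)
  finally show "(h \<rightharpoonup> dmult H p q) x = sweedler2 H h (\<lambda>a b. dmult H (a \<rightharpoonup> p) (b \<rightharpoonup> q)) x" .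
qed

lemma rreg_dmult:
  assumes p: "p \<in> vcar (dual H)" and q: "q \<in> vcar (dual H)"
  shows "dmult H p q \<leftharpoonup> h = sweedler2 H h (\<lambda>a b. dmult H (p \<leftharpoonup> a) (q \<leftharpoonup> b))"
proof
  fix x
  have "(dmult H p q \<leftharpoonup> h) x = sweedler2 H h (\<lambda>a b. sweedler2 H x (\<lambda>c d. p (a * c) * q (b * d)))"
    unfolding rreg_def dmult_def
    by (rule sweedler2_mult[where W = ground]) (intro lin_intros linear_map_dual_apply[OF p] linear_map_dual_apply[OF q])+
  also have "\<dots> = sweedler2 H h (\<lambda>a b. dmult H (p \<leftharpoonup> a) (q \<leftharpoonup> b)) x"
    by (simp add: sweedler2_apply dmult_def rreg_def)
  finally show "(dmult H p q \<leftharpoonup> h) x = sweedler2 H h (\<lambda>a b. dmult H (p \<leftharpoonup> a) (q \<leftharpoonup> b)) x" .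
qed

end


section \<open>Bijectivity of the antipode\<close>

context hopf_algebra
begin

text \<open>In terms of the regular action this reads p (S(h) \<rightharpoonup> \<phi>) = sum of
  S(h1) \<rightharpoonup> ((h2 \<rightharpoonup> p) \<phi>), the compatibility behind the Hopf
  module \<open>H^*\<close>. The action of S(h1) distributes over the product with reversed
  coproduct, so S(h2) h3 acts on p and cancels.\<close>

lemma dmult_twist:
  assumes p: "p \<in> vcar (dual H)" and \<phi>: "\<phi> \<in> vcar (dual H)"
  shows "sweedler2 H x (\<lambda>a b. p a * \<phi> (b * antipode H h)) =
    sweedler2 H h (\<lambda>u v. dmult H (v \<rightharpoonup> p) \<phi> (x * antipode H u))"
proof -
  let ?S = "antipode H" and ?sw = "sweedler2 H"
  note lin = lin_intros linear_map_dual_apply[OF p] linear_map_dual_apply[OF \<phi>]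
  have "dmult H (v \<rightharpoonup> p) \<phi> (x * ?S u) =
      ?sw x (\<lambda>c d. ?sw u (\<lambda>s t. p (c * (?S t * v)) * \<phi> (d * ?S s)))" for u v
    unfolding dmult_def lreg_def
    by (subst sweedler2_mult[where W = ground]; (intro lin)?)
      ((subst sweedler2_antipode[where W = ground]; (intro lin)?), simp add: mult.assoc)
  then have "?sw h (\<lambda>u v. dmult H (v \<rightharpoonup> p) \<phi> (x * ?S u)) =
      ?sw h (\<lambda>u v. ?sw x (\<lambda>c d. ?sw u (\<lambda>s t. p (c * (?S t * v)) * \<phi> (d * ?S s))))"
    by simp
  also have "\<dots> = ?sw x (\<lambda>c d. ?sw h (\<lambda>u v. ?sw u (\<lambda>s t. p (c * (?S t * v)) * \<phi> (d * ?S s))))"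
    by (rule sweedler2_swap)
  also have "\<dots> = ?sw x (\<lambda>c d. ?sw h (\<lambda>s w. ?sw w (\<lambda>t v. p (c * (?S t * v)) * \<phi> (d * ?S s))))"
    by (subst sweedler2_coassoc[where W = ground and h = h]; (intro lin)?) (rule refl)
  also have "\<dots> = ?sw x (\<lambda>c d. p (c * 1) * \<phi> (d * ?S h))"
    by (subst sweedler2_absorb_right[where W = ground and \<sigma> = "\<lambda>a b. ?S a * b" and f = "\<lambda>a z. p (c * z) * \<phi> (d * ?S a)" for c d];
        (intro lin antipode_left)?) (rule refl)
  finally show ?thesis by simp
qed

end

text \<open>Left multiplication of \<open>H^*\<close> on itself corresponds to the coaction sending
  f to the sum of (\<open>coord b\<close> f) \<otimes> b over the basis, while h acts on f by f(-
  S(h)). The usual projection f0 S(f1) of a Hopf module therefore involves S twice, which is the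
  origin of the double antipode in \<open>integral_proj\<close>.\<close>

locale hopf_algebra_basis = hopf_algebra H for H :: "('k::field, 'h::ring_1) hopf" +
  fixes B :: "'h set"
  assumes finite_basis: "finite B" and independent_basis: "independent B" and span_basis: "span B = UNIV"
begin

definition coord :: "'h \<Rightarrow> 'h \<Rightarrow> 'k" where
  "coord b h = representation B h b"

lemma coord_mem [lin_intros]: "coord b \<in> vcar (dual H)"
  by (auto simp: dual_iff linear_map_def hspace_def ground_def coord_def span_basis
      representation_add[OF independent_basis] representation_scale[OF independent_basis])

lemma basis_expand: "(\<Sum>b\<in>B. hscale H (coord b h) b) = h"
  unfolding coord_def
  by (rule sum_representation_eq[OF independent_basis]) (auto simp: span_basis finite_basis)

lemma linear_basis_expand:
  assumes "linear_map (hspace H) W f"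
  shows "f h = (\<Sum>b\<in>B. vscale W (coord b h) (f b))"
proof -
  have "f (\<Sum>b\<in>B. hscale H (coord b h) b) = (\<Sum>b\<in>B. f (hscale H (coord b h) b))"
    by (rule linear_map_sum_push[OF vec_space_hspace assms]) simp
  then show ?thesis by (simp add: basis_expand linear_map_hscale[OF assms])
qed

lemma dual_basis_expand:
  assumes F: "linear_map (dual H) W F" and p: "p \<in> vcar (dual H)"
  shows "F p = (\<Sum>b\<in>B. vscale W (p b) (F (coord b)))"
proof -
  have "p = (\<Sum>b\<in>B. fscale (p b) (coord b))"
  proof
    fix h
    have "p h = (\<Sum>b\<in>B. p b * coord b h)"
      using linear_basis_expand[OF p[unfolded dual_iff], of h] by (simp only: vscale_ground mult.commute)
    then show "p h = (\<Sum>b\<in>B. fscale (p b) (coord b)) h"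
      by (simp only: sum_apply fscale_def)
  qed
  moreover have "F (\<Sum>b\<in>B. fscale (p b) (coord b)) = (\<Sum>b\<in>B. F (fscale (p b) (coord b)))"
    using vec_space_scale[OF vec_space_dual coord_mem]
    by (intro linear_map_sum_push[OF vec_space_dual F]) (simp add: dual_def)
  moreover have "F (fscale c (coord b)) = vscale W c (F (coord b))" for c b
    using F coord_mem by (simp add: linear_map_def dual_def)
  ultimately show ?thesis by simp
qed

text \<open>The coproduct in the first leg of the canonical element is the product of
  \<open>H^*\<close> in its second leg. Both slots of \<open>G\<close> are expanded in the basis,
  and the functional \<open>dmult H (coord i) (coord j)\<close> is reassembled from its values on
  \<open>B\<close>.\<close>

lemma sweedler2_canonical:
  fixes G :: "'h \<Rightarrow> 'h \<Rightarrow> ('h \<Rightarrow> 'k) \<Rightarrow> 'k"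
  assumes G: "\<And>b q. q \<in> vcar (dual H) \<Longrightarrow> linear_map (hspace H) ground (\<lambda>a. G a b q)"
    "\<And>a q. q \<in> vcar (dual H) \<Longrightarrow> linear_map (hspace H) ground (\<lambda>b. G a b q)"
    "\<And>a b. linear_map (dual H) ground (\<lambda>q. G a b q)"
  shows "(\<Sum>k\<in>B. sweedler2 H k (\<lambda>a b. G a b (coord k))) = (\<Sum>i\<in>B. \<Sum>j\<in>B. G i j (dmult H (coord i) (coord j)))"
proof -
  have "sweedler2 H k (\<lambda>a b. G a b q) = (\<Sum>i\<in>B. \<Sum>j\<in>B. dmult H (coord i) (coord j) k * G i j q)"
    if q: "q \<in> vcar (dual H)" for k q
  proof -
    have expand: "G a b q = (\<Sum>i\<in>B. \<Sum>j\<in>B. coord i a * coord j b * G i j q)" for a b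
    proof -
      have "G a b q = (\<Sum>i\<in>B. coord i a * G i b q)"
        using linear_basis_expand[OF G(1)[OF q, of b], of a] by (simp only: vscale_ground)
      also have "\<dots> = (\<Sum>i\<in>B. coord i a * (\<Sum>j\<in>B. coord j b * G i j q))"
        using linear_basis_expand[OF G(2)[OF q], of _ b] by (simp only: vscale_ground)
      finally show ?thesis by (simp only: sum_distrib_left mult.assoc)
    qed
    show ?thesis by (subst expand) (simp add: sweedler2_sum dmult_def sweedler2_times_right)
  qed
  then have "(\<Sum>k\<in>B. sweedler2 H k (\<lambda>a b. G a b (coord k))) =
      (\<Sum>k\<in>B. \<Sum>i\<in>B. \<Sum>j\<in>B. dmult H (coord i) (coord j) k * G i j (coord k))"
    by (simp add: coord_mem)
  also have "\<dots> = (\<Sum>i\<in>B. \<Sum>j\<in>B. \<Sum>k\<in>B. dmult H (coord i) (coord j) k * G i j (coord k))"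
    by (rule trans[OF sum.swap sum.cong[OF refl sum.swap]])
  also have "\<dots> = (\<Sum>i\<in>B. \<Sum>j\<in>B. G i j (dmult H (coord i) (coord j)))"
  proof (intro sum.cong refl)
    show "(\<Sum>k\<in>B. dmult H (coord i) (coord j) k * G i j (coord k)) = G i j (dmult H (coord i) (coord j))" for i j
      using dual_basis_expand[OF G(3)[of i j] dmult_mem[OF coord_mem coord_mem]] by simp
  qed
  finally show ?thesis .
qed

text \<open>The projection of the Hopf module \<open>H\<^sup>*\<close> onto its coinvariants, which are the integrals.\<close>

definition integral_proj :: "('h \<Rightarrow> 'k) \<Rightarrow> 'h \<Rightarrow> 'k" where
  "integral_proj f x = (\<Sum>i\<in>B. dmult H (coord i) f (x * antipode H (antipode H i)))"

lemma integral_proj_mem [lin_intros]: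
  assumes "f \<in> vcar (dual H)"
  shows "integral_proj f \<in> vcar (dual H)"
proof -
  have "linear_map (hspace H) ground (\<lambda>x. integral_proj f x)"
    unfolding integral_proj_def
    by (intro linear_map_sum lin_intros linear_map_dual_apply[OF dmult_mem] assms)
  then show ?thesis by (simp add: dual_iff)
qed

text \<open>The outer antipode in S(S(k)) allows \<open>dmult_twist\<close> with S(k) in place of h,
  which yields S(a) \<rightharpoonup> p and S(S(b)) for the coproduct a \<otimes> b of k. The
  canonical element trades this coproduct for a product of coordinates, and \<open>canon\<close>
  collapses the part involving p.\<close>

lemma integral_proj_integral:
  assumes p: "p \<in> vcar (dual H)" and f: "f \<in> vcar (dual H)"
  shows "dmult H p (integral_proj f) x = p 1 * integral_proj f x"
proof -
  let ?S = "antipode H" and ?sw = "sweedler2 H"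
  note lin = lin_intros p f linear_map_dual_apply[OF p] linear_map_dual_apply[OF f]
    linear_map_dual_apply[OF dmult_mem] linear_map_dual_eval
  \<comment> \<open>Summing over the dual basis reproduces the map from d to p(c S(d)), so
    evaluation at z gives p(z1 S(z2)), which is p(1) times the counit of z.\<close>
  have canon: "dmult H (\<Sum>i\<in>B. dmult H (?S i \<rightharpoonup> p) (coord i)) r y = p 1 * r y" if r: "r \<in> vcar (dual H)" for r y
  proof -
    have "(\<Sum>i\<in>B. dmult H (?S i \<rightharpoonup> p) (coord i)) z = p 1 * counit H z" for z
    proof -
      have "(\<Sum>i\<in>B. dmult H (?S i \<rightharpoonup> p) (coord i)) z = ?sw z (\<lambda>c d. \<Sum>i\<in>B. coord i d * p (c * ?S i))"
        by (simp add: sum_apply dmult_def lreg_def sweedler2_sum mult.commute)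
      also have "\<dots> = ?sw z (\<lambda>c d. p (c * ?S d))"
        using linear_basis_expand[where W = ground and f = "\<lambda>d. p (c * ?S d)" for c, symmetric]
        by (simp add: lin)
      also have "\<dots> = counit H z * p 1"
        using sweedler2_absorb[where W = ground and \<sigma> = "\<lambda>a b. a * ?S b" and f = p, OF _ antipode_right]
        by (simp add: lin p[unfolded dual_iff])
      finally show ?thesis by (simp add: mult.commute)
    qed
    then have "dmult H (\<Sum>i\<in>B. dmult H (?S i \<rightharpoonup> p) (coord i)) r y = p 1 * dmult H (counit H) r y"
      by (simp add: dmult_def sweedler2_times_left mult.assoc)
    then show ?thesis by (simp add: dmult_counit_left r)
  qed
  have "dmult H p (integral_proj f) x =
      (\<Sum>k\<in>B. ?sw x (\<lambda>a b. p a * dmult H (coord k) f (b * ?S (?S k))))"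
    unfolding dmult_def[of H p] integral_proj_def by (simp add: sum_distrib_left sweedler2_sum)
  also have "\<dots> = (\<Sum>k\<in>B. ?sw k (\<lambda>a b. dmult H (?S a \<rightharpoonup> p) (dmult H (coord k) f) (x * ?S (?S b))))"
    by (subst dmult_twist; (intro lin)?)
      ((subst sweedler2_antipode[where W = ground]; (intro lin)?), rule refl)
  also have "\<dots> = (\<Sum>i\<in>B. \<Sum>j\<in>B. dmult H (?S i \<rightharpoonup> p) (dmult H (dmult H (coord i) (coord j)) f) (x * ?S (?S j)))"
    by (rule sweedler2_canonical) (intro lin; assumption)+
  also have "\<dots> = (\<Sum>j\<in>B. \<Sum>i\<in>B. dmult H (dmult H (?S i \<rightharpoonup> p) (coord i)) (dmult H (coord j) f) (x * ?S (?S j)))"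
    by (subst sum.swap) (simp add: dmult_assoc lin)
  also have "\<dots> = (\<Sum>j\<in>B. dmult H (\<Sum>i\<in>B. dmult H (?S i \<rightharpoonup> p) (coord i)) (dmult H (coord j) f) (x * ?S (?S j)))"
    by (subst linear_map_sum_push[where V = "dual H" and W = ground and F = "\<lambda>q. dmult H q r y" for r y];
        (intro lin)?) (rule refl)
  also have "\<dots> = p 1 * integral_proj f x"
    by (simp add: canon integral_proj_def sum_distrib_left lin)
  finally show ?thesis .
qed

text \<open>The surjectivity half of the Hopf module decomposition. Antimultiplicativity gathers the
  arguments into S(S(i) j), the canonical element turns i and j into the coproduct of a single k,
  and S(k1) k2 cancels. What remains is the sum of the coordinates weighted by the counit, that is,
  the counit itself.\<close>

lemma integral_proj_reconstruct:
  assumes f: "f \<in> vcar (dual H)"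
  shows "f x = (\<Sum>j\<in>B. integral_proj (dmult H (coord j) f) (x * antipode H j))"
proof -
  let ?S = "antipode H" and ?sw = "sweedler2 H"
  note lin = lin_intros f linear_map_dual_apply[OF f] linear_map_dual_apply[OF dmult_mem] linear_map_dual_eval
  have "(\<Sum>j\<in>B. integral_proj (dmult H (coord j) f) (x * ?S j)) =
      (\<Sum>i\<in>B. \<Sum>j\<in>B. dmult H (dmult H (coord i) (coord j)) f (x * ?S (?S i * j)))"
    unfolding integral_proj_def
    by (subst sum.swap) (simp add: dmult_assoc antipode_mult mult.assoc lin)
  also have "\<dots> = (\<Sum>k\<in>B. ?sw k (\<lambda>a b. dmult H (coord k) f (x * ?S (?S a * b))))"
    by (rule sweedler2_canonical[symmetric]) (intro lin; assumption)+
  also have "\<dots> = (\<Sum>k\<in>B. counit H k * dmult H (coord k) f x)"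
    using sweedler2_absorb[where W = ground and \<sigma> = "\<lambda>a b. ?S a * b" and f = "\<lambda>z. dmult H q f (x * ?S z)" for q, OF _ antipode_left]
    by (simp add: lin antipode_one)
  also have "\<dots> = dmult H (counit H) f x"
    by (subst dual_basis_expand[where W = ground and F = "\<lambda>q. dmult H q f x" and p = "counit H"]; (intro lin)?) simp
  finally show ?thesis by (simp add: dmult_counit_left f)
qed

lemma antipode_eq_zero:
  assumes S: "antipode H h = 0"
  shows "h = 0"
proof -
  let ?S = "antipode H" and ?sw = "sweedler2 H"
  \<comment> \<open>If all projections vanished, reconstruction would give the counit the value 0 at
    1.\<close>
  have "\<exists>\<phi>\<in>vcar (dual H). \<exists>y. integral_proj \<phi> y \<noteq> 0"
  proof (rule ccontr)
    assume "\<not> ?thesis"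
    then have "integral_proj (dmult H (coord j) (counit H)) y = 0" for j y
      by (simp add: lin_intros)
    then have "counit H 1 = 0"
      by (subst integral_proj_reconstruct) (simp_all add: lin_intros)
    then show False by (simp add: counit_one)
  qed
  then obtain \<phi> y where \<phi>: "\<phi> \<in> vcar (dual H)" and y: "integral_proj \<phi> y \<noteq> 0" by blast
  define \<mu> where "\<mu> = integral_proj \<phi>"
  have \<mu>: "\<mu> \<in> vcar (dual H)" by (simp add: \<mu>_def lin_intros \<phi>)
  \<comment> \<open>With S(h) = 0, \<open>dmult_twist\<close> equates 0 with a sum of products by
    \<open>\<mu>\<close>. As \<open>\<mu>\<close> is an integral, multiplying it by
    \<open>v \<rightharpoonup> p\<close> is scaling it by the value of that functional at 1, namely
    p(v).\<close>
  have vanish: "?sw h (\<lambda>u v. p v * \<mu> (x * ?S u)) = 0" if p: "p \<in> vcar (dual H)" for x p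
  proof -
    have "\<mu> 0 = 0" using dual_scale[OF \<mu>, of 0 0] by simp
    then have "0 = ?sw x (\<lambda>a b. p a * \<mu> (b * ?S h))"
      by (simp add: S)
    also have "\<dots> = ?sw h (\<lambda>u v. dmult H (v \<rightharpoonup> p) \<mu> (x * ?S u))"
      by (rule dmult_twist[OF p \<mu>])
    also have "\<dots> = ?sw h (\<lambda>u v. p v * \<mu> (x * ?S u))"
      by (simp add: \<mu>_def integral_proj_integral lin_intros p \<phi>) (simp add: lreg_def)
    finally show ?thesis by simp
  qed
  have "coord b h = 0" for b
  proof -
    note lin = lin_intros linear_map_dual_apply[OF \<mu>] linear_map_dual_apply[OF coord_mem]
    \<comment> \<open>The trivial factor S(1) is replaced by a sum of S(s S(t)) = S(S(t)) S(s), in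
      order to bring in S(s) with s the first factor of h.\<close>
    have "\<mu> y * coord b h = \<mu> (y * ?S 1) * coord b h"
      by (simp add: antipode_one)
    also have "\<dots> = ?sw h (\<lambda>z v. ?sw z (\<lambda>s t. \<mu> (y * ?S (s * ?S t)) * coord b v))"
      by (subst sweedler2_absorb_left[where W = ground and \<sigma> = "\<lambda>a b. a * ?S b" and f = "\<lambda>z v. \<mu> (y * ?S z) * coord b v"];
        (intro lin antipode_right)?) (rule refl)
    also have "\<dots> = ?sw h (\<lambda>s w. ?sw w (\<lambda>t v. \<mu> (y * ?S (s * ?S t)) * coord b v))"
      by (rule sweedler2_coassoc[where W = ground, symmetric]) (intro lin)+
    \<comment> \<open>In \<open>vanish\<close> the element x in front of S(s) must be fixed, whereas
      y S(S(t)) still depends on h through t. Expanding the rest \<open>w\<close> in the basis makes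
      \<open>t\<close> a factor of a basis vector, and the sum over h becomes an instance of
      \<open>vanish\<close> with p = \<open>coord i\<close>.\<close>
    also have "\<dots> = ?sw h (\<lambda>s w. \<Sum>i\<in>B. coord i w * ?sw i (\<lambda>t v. \<mu> (y * ?S (s * ?S t)) * coord b v))"
      by (subst linear_basis_expand[where W = ground and f = "\<lambda>w. ?sw w (\<lambda>t v. \<mu> (y * ?S (s * ?S t)) * coord b v)" for s];
        (intro lin)?) simp
    also have "\<dots> = (\<Sum>i\<in>B. ?sw i (\<lambda>t v. ?sw h (\<lambda>s w. coord i w * \<mu> (y * ?S (?S t) * ?S s)) * coord b v))"
      by (simp add: sweedler2_sum sweedler2_times_left sweedler2_times_right antipode_mult mult.assoc)
        (subst sweedler2_swap, rule refl)
    also have "\<dots> = 0"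
      by (simp add: vanish lin_intros)
    finally show ?thesis using y by (simp add: \<mu>_def)
  qed
  then show ?thesis using basis_expand[of h] by simp
qed

end

context fd_hopf_algebra
begin

lemma bij_antipode: "bij (antipode H)"
proof -
  obtain B0 where B0: "finite B0" "span B0 = UNIV"
    using finite_dimensional by blast
  obtain B where B: "B \<subseteq> B0" "independent B" "B0 \<subseteq> span B"
    using maximal_independent_subset[of B0] by blast
  have "finite B" "span B = UNIV"
    using B B0 finite_subset span_mono[OF B(3)] by (auto simp: span_span)
  then interpret hopf_algebra_basis H B
    by unfold_locales (use B in auto)
  interpret FD: finite_dimensional_vector_space "hscale H" B
    by unfold_locales (use finite_basis independent_basis span_basis in auto)
  interpret S: Vector_Spaces.linear "hscale H" "hscale H" "antipode H"
    by (rule antipode_linear)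
  have "inj (antipode H)"
    using antipode_eq_zero by (simp add: S.inj_iff_eq_0)
  then show ?thesis
    using FD.linear_inj_imp_surj[OF antipode_linear] by (simp add: bij_def)
qed

end


section \<open>Iterated comultiplications\<close>

context hopf_algebra
begin

lemma linear_map_sweedler3_param [lin_intros]:
  assumes "vec_space W" "\<And>a b c. linear_map V W (\<lambda>x. f x a b c)"
  shows "linear_map V W (\<lambda>x. sweedler3 H h (f x))"
  unfolding sweedler3_def by (intro lin_intros assms)

lemma linear_map_sweedler3_arg [lin_intros]:
  assumes "vec_space W" "linear_map V (hspace H) k"
    and "\<And>b c. linear_map (hspace H) W (\<lambda>a. f a b c)"
      "\<And>a c. linear_map (hspace H) W (\<lambda>b. f a b c)"
      "\<And>a b. linear_map (hspace H) W (\<lambda>c. f a b c)"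
  shows "linear_map V W (\<lambda>x. sweedler3 H (k x) f)"
  unfolding sweedler3_def by (intro lin_intros assms)

lemma sweedler3_mem [lin_intros]:
  assumes "vec_space W" "\<And>a b c. f a b c \<in> vcar W"
  shows "sweedler3 H h f \<in> vcar W"
  unfolding sweedler3_def by (intro lin_intros assms)

lemma sweedler3_push:
  assumes "linear_map W W' F" "vec_space W" "\<And>a b c. f a b c \<in> vcar W"
  shows "F (sweedler3 H h f) = sweedler3 H h (\<lambda>a b c. F (f a b c))"
  unfolding sweedler3_def
  by (subst sweedler2_push[OF assms(1,2)]; (intro lin_intros assms)?)+ (rule refl)

lemma sweedler2_cong: "(\<And>a b. f a b = g a b) \<Longrightarrow> sweedler2 H h f = sweedler2 H h g"
  by presburger

lemma sweedler3_cong: "(\<And>a b c. f a b c = g a b c) \<Longrightarrow> sweedler3 H h f = sweedler3 H h g"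
  by presburger

lemma sweedler32_swap:
  "sweedler3 H x (\<lambda>a b c. sweedler2 H y (\<lambda>d e. f a b c d e)) =
   sweedler2 H y (\<lambda>d e. sweedler3 H x (\<lambda>a b c. f a b c d e))"
  unfolding sweedler3_def
  by (rule trans[OF sweedler2_cong[OF sweedler2_swap] sweedler2_swap])

lemma sweedler3_swap:
  "sweedler3 H x (\<lambda>a b c. sweedler3 H y (\<lambda>d e f. F a b c d e f)) =
   sweedler3 H y (\<lambda>d e f. sweedler3 H x (\<lambda>a b c. F a b c d e f))"
  unfolding sweedler3_def[of H y]
  by (rule trans[OF sweedler32_swap sweedler2_cong[OF sweedler32_swap]])

lemma sweedler3_one:
  assumes "vec_space W"
    and "\<And>b c. linear_map (hspace H) W (\<lambda>a. f a b c)"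
      "\<And>a c. linear_map (hspace H) W (\<lambda>b. f a b c)"
      "\<And>a b. linear_map (hspace H) W (\<lambda>c. f a b c)"
  shows "sweedler3 H 1 f = f 1 1 1"
  unfolding sweedler3_def by (subst sweedler2_one[OF assms(1)]; (intro lin_intros assms)?)+ (rule refl)

lemma sweedler3_counit:
  assumes W: "vec_space W" and f: "linear_map (hspace H) W f"
  shows "sweedler3 H h (\<lambda>a b c. vscale W (counit H a) (vscale W (counit H c) (f b))) = f h"
proof -
  note lin = lin_intros W linear_map_dual_apply[OF counit_mem] linear_map_compose[OF f]
    linear_map_mem[OF f]
  have "sweedler2 H y (\<lambda>b c. vscale W (counit H a) (vscale W (counit H c) (f b))) = vscale W (counit H a) (f y)" for a y
    using sweedler2_counit_right[where W = W and f = "\<lambda>b. vscale W (counit H a) (f b)"]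
    by (simp add: lin vscale_vscale mult.commute)
  then show ?thesis
    by (simp add: sweedler3_def sweedler2_counit_left[OF W f])
qed

section \<open>Fivefold Sweedler sums\<close>

context
  fixes W :: "('k, 'w::ab_group_add, 'z) vspace_scheme" and f :: "'h \<Rightarrow> 'h \<Rightarrow> 'h \<Rightarrow> 'h \<Rightarrow> 'h \<Rightarrow> 'w"
  assumes W: "vec_space W"
    and f: "\<And>b c d e. linear_map (hspace H) W (\<lambda>a. f a b c d e)"
      "\<And>a c d e. linear_map (hspace H) W (\<lambda>b. f a b c d e)"
      "\<And>a b d e. linear_map (hspace H) W (\<lambda>c. f a b c d e)"
      "\<And>a b c e. linear_map (hspace H) W (\<lambda>d. f a b c d e)"
      "\<And>a b c d. linear_map (hspace H) W (\<lambda>e. f a b c d e)"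
begin

text \<open>The right-nested sum is the normal form of the fivefold coproduct. Splitting the middle
  of three factors into three, or each outer factor into two as in \<open>sweedler5_outer\<close>,
  reduces to it by coassociativity.\<close>

lemma sweedler5_inner:
  "sweedler3 H h (\<lambda>h1 h2 h3. sweedler3 H h2 (\<lambda>k1 k2 k3. f h1 k1 k2 k3 h3)) =
   sweedler2 H h (\<lambda>a u. sweedler2 H u (\<lambda>b v. sweedler2 H v (\<lambda>c w. sweedler2 H w (\<lambda>d e. f a b c d e))))"
proof -
  note lin = lin_intros W f[THEN linear_map_compose]
  have "sweedler2 H u (\<lambda>m e. sweedler2 H m (\<lambda>b n. sweedler2 H n (\<lambda>c d. f a b c d e))) =
      sweedler2 H u (\<lambda>b v. sweedler2 H v (\<lambda>n e. sweedler2 H n (\<lambda>c d. f a b c d e)))" for a u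
    by (rule sweedler2_coassoc[OF W, symmetric]) (intro lin)+
  moreover have "sweedler2 H v (\<lambda>n e. sweedler2 H n (\<lambda>c d. f a b c d e)) =
      sweedler2 H v (\<lambda>c w. sweedler2 H w (\<lambda>d e. f a b c d e))" for a b v
    by (rule sweedler2_coassoc[OF W, symmetric]) (intro lin)+
  ultimately show ?thesis by (simp only: sweedler3_def)
qed

lemma sweedler5_outer:
  "sweedler3 H h (\<lambda>h1 h2 h3. sweedler2 H h1 (\<lambda>a b. sweedler2 H h3 (\<lambda>d e. f a b h2 d e))) =
   sweedler2 H h (\<lambda>a u. sweedler2 H u (\<lambda>b v. sweedler2 H v (\<lambda>c w. sweedler2 H w (\<lambda>d e. f a b c d e))))"
proof -
  note lin = lin_intros W f[THEN linear_map_compose]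
  have "sweedler3 H h (\<lambda>h1 h2 h3. sweedler2 H h1 (\<lambda>a b. sweedler2 H h3 (\<lambda>d e. f a b h2 d e))) =
      sweedler2 H h (\<lambda>x v. sweedler2 H x (\<lambda>a b. sweedler2 H v (\<lambda>c w. sweedler2 H w (\<lambda>d e. f a b c d e))))"
    unfolding sweedler3_def by (intro sweedler2_cong) (rule sweedler2_swap)
  also have "\<dots> = sweedler2 H h (\<lambda>a u. sweedler2 H u (\<lambda>b v. sweedler2 H v (\<lambda>c w. sweedler2 H w (\<lambda>d e. f a b c d e))))"
    by (rule sweedler2_coassoc[OF W, symmetric]) (intro lin)+
  finally show ?thesis .
qed

end

text \<open>Of the five factors of h, \<open>\<tau>\<close> cancels the last two and then
  \<open>\<sigma>\<close> the first two. Both stay abstract because the composites of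
  \<open>beta\<close> and \<open>beta_inv\<close> use different antipode identities at the two
  ends.\<close>

lemma sweedler3_cancel:
  assumes W: "vec_space W"
    and \<sigma>: "\<And>h. sweedler2 H h (\<lambda>a b. \<sigma> a b) = hscale H (counit H h) 1"
      "\<And>b. linear_map (hspace H) (hspace H) (\<lambda>a. \<sigma> a b)" "\<And>a. linear_map (hspace H) (hspace H) (\<lambda>b. \<sigma> a b)"
    and \<tau>: "\<And>h. sweedler2 H h (\<lambda>a b. \<tau> a b) = hscale H (counit H h) 1"
      "\<And>b. linear_map (hspace H) (hspace H) (\<lambda>a. \<tau> a b)" "\<And>a. linear_map (hspace H) (hspace H) (\<lambda>b. \<tau> a b)"
    and f: "\<And>b c. linear_map (hspace H) W (\<lambda>a. f a b c)"
      "\<And>a c. linear_map (hspace H) W (\<lambda>b. f a b c)"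
      "\<And>a b. linear_map (hspace H) W (\<lambda>c. f a b c)"
  shows "sweedler3 H h (\<lambda>h1 h2 h3. sweedler3 H h2 (\<lambda>k1 k2 k3. f (\<sigma> h1 k1) k2 (\<tau> k3 h3))) = f 1 h 1"
proof -
  note lin = lin_intros W f[THEN linear_map_compose] \<sigma>(2,3) \<tau>(2,3)
  have "sweedler3 H h (\<lambda>h1 h2 h3. sweedler3 H h2 (\<lambda>k1 k2 k3. f (\<sigma> h1 k1) k2 (\<tau> k3 h3))) =
      sweedler2 H h (\<lambda>a u. sweedler2 H u (\<lambda>b v. sweedler2 H v (\<lambda>c w. sweedler2 H w (\<lambda>d e. f (\<sigma> a b) c (\<tau> d e)))))"
    by (rule sweedler5_inner[OF W]) (intro lin)+
  also have "\<dots> = sweedler2 H h (\<lambda>a u. sweedler2 H u (\<lambda>b v. f (\<sigma> a b) v 1))"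
    by (intro sweedler2_cong sweedler2_absorb_right[OF W \<tau>(1)] lin)
  also have "\<dots> = sweedler2 H h (\<lambda>x v. sweedler2 H x (\<lambda>a b. f (\<sigma> a b) v 1))"
    by (rule sweedler2_coassoc[OF W]) (intro lin)+
  also have "\<dots> = f 1 h 1"
    by (rule sweedler2_absorb_left[OF W \<sigma>(1)]) (intro lin)+
  finally show ?thesis .
qed

section \<open>Sweedler sums of products in \<open>H\<close> or in its opposite algebra\<close>

context
  fixes m :: "'h \<Rightarrow> 'h \<Rightarrow> 'h"
  assumes m: "m = (\<lambda>x y. x * y) \<or> m = (\<lambda>x y. y * x)"
begin

text \<open>In \<open>Z\<close> the \<open>h\<close> component multiplies in \<open>H\<close> and
  the \<open>g\<close> component in the opposite algebra. The coproduct is multiplicative for both,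
  so one parameter \<open>m\<close> serves the two halves of the associativity proof.\<close>

lemma linear_map_mult_or_opposite:
  shows "linear_map X (hspace H) k \<Longrightarrow> linear_map X (hspace H) (\<lambda>x. m (k x) y)"
    and "linear_map X (hspace H) k \<Longrightarrow> linear_map X (hspace H) (\<lambda>x. m y (k x))"
  using m by (auto intro: lin_intros)

lemma sweedler2_mult_or_opposite:
  assumes "vec_space W" "bilinear_map (hspace H) (hspace H) W f"
  shows "sweedler2 H (m x y) f = sweedler2 H x (\<lambda>a b. sweedler2 H y (\<lambda>c d. f (m a c) (m b d)))"
  using m
proof
  assume "m = (\<lambda>x y. y * x)"
  then show ?thesis
    by (simp add: sweedler2_mult[OF assms]) (rule sweedler2_swap)
qed (simp add: sweedler2_mult[OF assms])

lemma sweedler3_mult_or_opposite: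
  assumes W: "vec_space W"
    and f: "\<And>b c. linear_map (hspace H) W (\<lambda>a. f a b c)"
      "\<And>a c. linear_map (hspace H) W (\<lambda>b. f a b c)"
      "\<And>a b. linear_map (hspace H) W (\<lambda>c. f a b c)"
  shows "sweedler3 H (m x y) f =
    sweedler3 H x (\<lambda>x1 x2 x3. sweedler3 H y (\<lambda>y1 y2 y3. f (m x1 y1) (m x2 y2) (m x3 y3)))"
proof -
  have "sweedler3 H (m x y) f =
      sweedler2 H x (\<lambda>x1 x'. sweedler2 H y (\<lambda>y1 y'. sweedler2 H (m x' y') (\<lambda>b c. f (m x1 y1) b c)))"
    unfolding sweedler3_def by (rule sweedler2_mult_or_opposite[OF W]) (intro lin_intros W f)
  also have "\<dots> = sweedler2 H x (\<lambda>x1 x'. sweedler2 H y (\<lambda>y1 y'. sweedler2 H x' (\<lambda>x2 x3. sweedler2 H y' (\<lambda>y2 y3.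
      f (m x1 y1) (m x2 y2) (m x3 y3)))))"
    by (intro sweedler2_cong sweedler2_mult_or_opposite[OF W] lin_intros f)
  also have "\<dots> = sweedler3 H x (\<lambda>x1 x2 x3. sweedler3 H y (\<lambda>y1 y2 y3. f (m x1 y1) (m x2 y2) (m x3 y3)))"
    unfolding sweedler3_def by (rule sweedler2_cong, rule sweedler2_swap)
  finally show ?thesis .
qed

text \<open>In a triple product of \<open>Z\<close> bracketed to the left, the middle factor of x is
  multiplied by y and split again. The five factors of x are regrouped so that its outer factors are
  split instead; this is the shape produced by regular actions on products of functionals in the
  other bracketing.\<close>

lemma sweedler3_mult_middle:
  assumes W: "vec_space W"
    and f: "\<And>b c d e. linear_map (hspace H) W (\<lambda>a. f a b c d e)"
      "\<And>a c d e. linear_map (hspace H) W (\<lambda>b. f a b c d e)"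
      "\<And>a b d e. linear_map (hspace H) W (\<lambda>c. f a b c d e)"
      "\<And>a b c e. linear_map (hspace H) W (\<lambda>d. f a b c d e)"
      "\<And>a b c d. linear_map (hspace H) W (\<lambda>e. f a b c d e)"
  shows "sweedler3 H x (\<lambda>x1 x2 x3. sweedler3 H (m x2 y) (\<lambda>k1 k2 k3. f x1 k1 k2 k3 x3)) =
    sweedler3 H y (\<lambda>y1 y2 y3. sweedler3 H x (\<lambda>x1 x2 x3.
      sweedler2 H x1 (\<lambda>a b. sweedler2 H x3 (\<lambda>d e. f a (m b y1) (m x2 y2) (m d y3) e))))"
proof -
  note lin = lin_intros W f[THEN linear_map_compose] linear_map_mult_or_opposite
  have "sweedler3 H x (\<lambda>x1 x2 x3. sweedler3 H (m x2 y) (\<lambda>k1 k2 k3. f x1 k1 k2 k3 x3)) =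
     sweedler3 H x (\<lambda>x1 x2 x3. sweedler3 H x2 (\<lambda>k1 k2 k3. sweedler3 H y (\<lambda>y1 y2 y3.
       f x1 (m k1 y1) (m k2 y2) (m k3 y3) x3)))"
    by (intro sweedler3_cong sweedler3_mult_or_opposite[OF W] f)
  also have "\<dots> = sweedler3 H y (\<lambda>y1 y2 y3. sweedler3 H x (\<lambda>x1 x2 x3. sweedler3 H x2 (\<lambda>k1 k2 k3.
       f x1 (m k1 y1) (m k2 y2) (m k3 y3) x3)))"
    by (rule trans[OF sweedler3_cong[OF sweedler3_swap] sweedler3_swap])
  also have "\<dots> = sweedler3 H y (\<lambda>y1 y2 y3. sweedler3 H x (\<lambda>x1 x2 x3.
      sweedler2 H x1 (\<lambda>a b. sweedler2 H x3 (\<lambda>d e. f a (m b y1) (m x2 y2) (m d y3) e))))"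
    by (rule sweedler3_cong, rule trans[OF sweedler5_inner[OF W] sweedler5_outer[OF W, symmetric]])
      (intro lin)+
  finally show ?thesis .
qed

end

end


section \<open>The diagonal crossed product\<close>

abbreviation x_space where "x_space H \<equiv> tensor (hh_space H) (dd_space H)"
abbreviation z_space where "z_space H \<equiv> tensor (dd_space H) (hh_space H)"

lemma x_lift_eq_lift4: "x_lift H F = lift4 (hspace H) (hspace H) (dual H) (dual H) F"
  by (rule ext) (simp add: x_lift_def lift4_def)

lemma z_lift_eq_lift4: "z_lift H F = lift4 (dual H) (dual H) (hspace H) (hspace H) F"
  by (rule ext) (simp add: z_lift_def lift4_def)

lemma x_tensor_eq_tens4: "x_tensor H g h p q = tens4 (hspace H) (hspace H) (dual H) (dual H) g h p q"
  by (simp add: x_tensor_def tens4_def)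

lemma z_tensor_eq_tens4: "z_tensor H p q h g = tens4 (dual H) (dual H) (hspace H) (hspace H) p q h g"
  by (simp add: z_tensor_def tens4_def)

context hopf_algebra
begin

lemmas linear_map_x_tensor [lin_intros] =
  linear_map_tens4[OF vec_space_hspace vec_space_hspace vec_space_dual vec_space_dual, folded x_tensor_eq_tens4]

lemmas linear_map_z_tensor [lin_intros] =
  linear_map_tens4[OF vec_space_dual vec_space_dual vec_space_hspace vec_space_hspace, folded z_tensor_eq_tens4]

lemma x_tensor_mem [lin_intros]:
  "p \<in> vcar (dual H) \<Longrightarrow> q \<in> vcar (dual H) \<Longrightarrow> x_tensor H g h p q \<in> vcar (x_space H)"
  unfolding x_tensor_eq_tens4 by (intro tens4_mem lin_intros)

lemma z_tensor_mem [lin_intros]: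
  "p \<in> vcar (dual H) \<Longrightarrow> q \<in> vcar (dual H) \<Longrightarrow> z_tensor H p q h g \<in> vcar (z_space H)"
  unfolding z_tensor_eq_tens4 by (intro tens4_mem lin_intros)

lemma x_ext:
  assumes "vec_space W" "linear_map (x_space H) W F" "linear_map (x_space H) W G"
    and "\<And>g h p q. p \<in> vcar (dual H) \<Longrightarrow> q \<in> vcar (dual H) \<Longrightarrow> F (x_tensor H g h p q) = G (x_tensor H g h p q)"
    and "x \<in> vcar (x_space H)"
  shows "F x = G x"
  by (rule tens4_ext[OF vec_space_hspace vec_space_hspace vec_space_dual vec_space_dual assms(1-3) _ assms(5)])
    (fold x_tensor_eq_tens4, rule assms(4))

lemma z_ext:
  assumes "vec_space W" "linear_map (z_space H) W F" "linear_map (z_space H) W G"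
    and "\<And>p q h g. p \<in> vcar (dual H) \<Longrightarrow> q \<in> vcar (dual H) \<Longrightarrow> F (z_tensor H p q h g) = G (z_tensor H p q h g)"
    and "z \<in> vcar (z_space H)"
  shows "F z = G z"
  by (rule tens4_ext[OF vec_space_dual vec_space_dual vec_space_hspace vec_space_hspace assms(1-3) _ assms(5)])
    (fold z_tensor_eq_tens4, rule assms(4))

lemmas lift4_intros = linear_map_lift4[OF vec_space_hspace vec_space_hspace vec_space_dual vec_space_dual]
  linear_map_lift4[OF vec_space_dual vec_space_dual vec_space_hspace vec_space_hspace]
  linear_map_lift4_param[OF vec_space_hspace vec_space_hspace vec_space_dual vec_space_dual]
  linear_map_lift4_param[OF vec_space_dual vec_space_dual vec_space_hspace vec_space_hspace]

lemma x_lift_x_tensor: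
  "vec_space W \<Longrightarrow> quadrilinear_map (hspace H) (hspace H) (dual H) (dual H) W F \<Longrightarrow>
   p \<in> vcar (dual H) \<Longrightarrow> q \<in> vcar (dual H) \<Longrightarrow> x_lift H F (x_tensor H g h p q) = F g h p q"
  unfolding x_lift_eq_lift4 x_tensor_eq_tens4 by (rule lift4_tens4[where W = W]; (assumption | intro lin_intros))

lemma z_lift_z_tensor:
  "vec_space W \<Longrightarrow> quadrilinear_map (dual H) (dual H) (hspace H) (hspace H) W F \<Longrightarrow>
   p \<in> vcar (dual H) \<Longrightarrow> q \<in> vcar (dual H) \<Longrightarrow> z_lift H F (z_tensor H p q h g) = F p q h g"
  unfolding z_lift_eq_lift4 z_tensor_eq_tens4 by (rule lift4_tens4[where W = W]; (assumption | intro lin_intros))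

lemma linear_map_z_mult_right [lin_intros]:
  assumes "z \<in> vcar (z_space H)" "linear_map X (z_space H) k"
  shows "linear_map X (z_space H) (\<lambda>x. z_mult H z (k x))"
  unfolding z_mult_def z_lift_eq_lift4
  by (intro lift4_intros lin_intros assms)

lemma linear_map_z_mult_left [lin_intros]:
  assumes "z' \<in> vcar (z_space H)" "linear_map X (z_space H) k"
  shows "linear_map X (z_space H) (\<lambda>x. z_mult H (k x) z')"
  unfolding z_mult_def z_lift_eq_lift4
  by (intro lift4_intros lin_intros assms)

lemma z_mult_z_tensor:
  assumes "p \<in> vcar (dual H)" "q \<in> vcar (dual H)" "p' \<in> vcar (dual H)" "q' \<in> vcar (dual H)"
  shows "z_mult H (z_tensor H p q h g) (z_tensor H p' q' h' g') =
    sweedler3 H h (\<lambda>h1 h2 h3. sweedler3 H g (\<lambda>g1 g2 g3.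
      z_tensor H (dmult H p (h1 \<rightharpoonup> p' \<leftharpoonup> g1)) (dmult H (h3 \<rightharpoonup> q' \<leftharpoonup> g3) q) (h2 * h') (g' * g2)))"
proof -
  have z': "z_tensor H p' q' h' g' \<in> vcar (z_space H)" by (intro lin_intros assms)
  let ?f = "\<lambda>p q h g p' q' h' g'. sweedler3 H h (\<lambda>h1 h2 h3. sweedler3 H g (\<lambda>g1 g2 g3.
      z_tensor H (dmult H p (h1 \<rightharpoonup> p' \<leftharpoonup> g1)) (dmult H (h3 \<rightharpoonup> q' \<leftharpoonup> g3) q) (h2 * h') (g' * g2)))"
  have inner: "quadrilinear_map (dual H) (dual H) (hspace H) (hspace H) (z_space H) (?f p q h g)"
    by (intro lin_intros assms)
  have outer: "quadrilinear_map (dual H) (dual H) (hspace H) (hspace H) (z_space H)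
      (\<lambda>p q h g. z_lift H (?f p q h g) (z_tensor H p' q' h' g'))"
    unfolding z_lift_eq_lift4 by (intro lift4_intros lin_intros z')
  show ?thesis
    unfolding z_mult_def z_lift_z_tensor[OF vec_space_tensor outer assms(1,2)]
    by (rule z_lift_z_tensor[OF vec_space_tensor inner assms(3,4)])
qed

lemma z_mult_mem [lin_intros]: "z \<in> vcar (z_space H) \<Longrightarrow> z' \<in> vcar (z_space H) \<Longrightarrow> z_mult H z z' \<in> vcar (z_space H)"
  by (rule linear_map_mem[OF linear_map_z_mult_right[OF _ linear_map_id]])

lemma z_mult_sweedler3_left:
  assumes "z' \<in> vcar (z_space H)" "\<And>a b c. f a b c \<in> vcar (z_space H)"
  shows "z_mult H (sweedler3 H h f) z' = sweedler3 H h (\<lambda>a b c. z_mult H (f a b c) z')"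
  by (rule sweedler3_push[where W = "z_space H" and W' = "z_space H"]) (intro lin_intros assms)+

lemma z_mult_sweedler3_right:
  assumes "z \<in> vcar (z_space H)" "\<And>a b c. f a b c \<in> vcar (z_space H)"
  shows "z_mult H z (sweedler3 H h f) = sweedler3 H h (\<lambda>a b c. z_mult H z (f a b c))"
  by (rule sweedler3_push[where W = "z_space H" and W' = "z_space H"]) (intro lin_intros assms)+

lemma lreg_rreg_dmult:
  assumes p: "p \<in> vcar (dual H)" and q: "q \<in> vcar (dual H)"
  shows "h \<rightharpoonup> dmult H p q \<leftharpoonup> g =
    sweedler2 H h (\<lambda>a b. sweedler2 H g (\<lambda>c d. dmult H (a \<rightharpoonup> p \<leftharpoonup> c) (b \<rightharpoonup> q \<leftharpoonup> d)))"
proof -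
  have "h \<rightharpoonup> dmult H p q \<leftharpoonup> g = sweedler2 H h (\<lambda>a b. dmult H (a \<rightharpoonup> p) (b \<rightharpoonup> q) \<leftharpoonup> g)"
    unfolding lreg_dmult[OF p q]
    by (rule sweedler2_push[where W = "dual H" and W' = "dual H" and F = "\<lambda>p. p \<leftharpoonup> g"]) (intro lin_intros p q)+
  then show ?thesis
    by (simp add: rreg_dmult lreg_mem p q)
qed

lemma z_tensor_lreg_rreg_dmult:
  assumes "p \<in> vcar (dual H)" "p' \<in> vcar (dual H)" "r \<in> vcar (dual H)"
    and "q \<in> vcar (dual H)" "q' \<in> vcar (dual H)" "s \<in> vcar (dual H)"
  shows "z_tensor H (dmult H p (h1 \<rightharpoonup> dmult H p' r \<leftharpoonup> g1)) (dmult H (h3 \<rightharpoonup> dmult H s q' \<leftharpoonup> g3) q) y x =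
    sweedler2 H h1 (\<lambda>a b. sweedler2 H g1 (\<lambda>c d. sweedler2 H h3 (\<lambda>a' b'. sweedler2 H g3 (\<lambda>c' d'.
      z_tensor H (dmult H p (dmult H (a \<rightharpoonup> p' \<leftharpoonup> c) (b \<rightharpoonup> r \<leftharpoonup> d)))
        (dmult H (dmult H (a' \<rightharpoonup> s \<leftharpoonup> c') (b' \<rightharpoonup> q' \<leftharpoonup> d')) q) y x))))"
proof -
  have 1: "z_tensor H (dmult H p (h1 \<rightharpoonup> dmult H p' r \<leftharpoonup> g1)) t y x =
      sweedler2 H h1 (\<lambda>a b. sweedler2 H g1 (\<lambda>c d. z_tensor H (dmult H p (dmult H (a \<rightharpoonup> p' \<leftharpoonup> c) (b \<rightharpoonup> r \<leftharpoonup> d))) t y x))"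
    if t: "t \<in> vcar (dual H)" for t
    unfolding lreg_rreg_dmult[OF assms(2,3)]
    by (subst sweedler2_push[where W = "dual H" and W' = "z_space H" and F = "\<lambda>u. z_tensor H (dmult H p u) t y x"];
        (intro lin_intros assms t)?)+ (rule refl)
  have 2: "z_tensor H t (dmult H (h3 \<rightharpoonup> dmult H s q' \<leftharpoonup> g3) q) y x =
      sweedler2 H h3 (\<lambda>a b. sweedler2 H g3 (\<lambda>c d. z_tensor H t (dmult H (dmult H (a \<rightharpoonup> s \<leftharpoonup> c) (b \<rightharpoonup> q' \<leftharpoonup> d)) q) y x))"
    if t: "t \<in> vcar (dual H)" for t
    unfolding lreg_rreg_dmult[OF assms(6,5)]
    by (subst sweedler2_push[where W = "dual H" and W' = "z_space H" and F = "\<lambda>u. z_tensor H t (dmult H u q) y x"];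
        (intro lin_intros assms t)?)+ (rule refl)
  have t: "dmult H (h3 \<rightharpoonup> dmult H s q' \<leftharpoonup> g3) q \<in> vcar (dual H)"
    by (intro lin_intros assms)
  have t': "dmult H p (dmult H (a \<rightharpoonup> p' \<leftharpoonup> c) (b \<rightharpoonup> r \<leftharpoonup> d)) \<in> vcar (dual H)" for a b c d
    by (intro lin_intros assms)
  show ?thesis by (simp only: 1[OF t] 2[OF t'])
qed

lemma z_mult_assoc_tensor:
  assumes p: "p \<in> vcar (dual H)" "p' \<in> vcar (dual H)" "p'' \<in> vcar (dual H)"
    and q: "q \<in> vcar (dual H)" "q' \<in> vcar (dual H)" "q'' \<in> vcar (dual H)"
  shows "z_mult H (z_mult H (z_tensor H p q h g) (z_tensor H p' q' h' g')) (z_tensor H p'' q'' h'' g'') =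
    z_mult H (z_tensor H p q h g) (z_mult H (z_tensor H p' q' h' g') (z_tensor H p'' q'' h'' g''))"
proof -
  note lin = lin_intros p q
  let ?s3 = "sweedler3 H" and ?s2 = "sweedler2 H" and ?m = "dmult H"
  \<comment> \<open>The slots \<open>u\<close>, \<open>k1\<close>, \<open>k2\<close>,
    \<open>k3\<close>, \<open>z\<close> belong to the \<open>h\<close> side and \<open>a\<close>,
    \<open>l1\<close>, \<open>l2\<close>, \<open>l3\<close>, \<open>d\<close> to the
    \<open>g\<close> side. One symbol for the tensor lets the sums be permuted around it.\<close>
  define \<Theta> where "\<Theta> u k1 k2 k3 z a l1 l2 l3 d =
    z_tensor H (?m (?m p (u \<rightharpoonup> p' \<leftharpoonup> a)) (k1 \<rightharpoonup> p'' \<leftharpoonup> l1)) (?m (k3 \<rightharpoonup> q'' \<leftharpoonup> l3) (?m (z \<rightharpoonup> q' \<leftharpoonup> d) q))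
      (k2 * h'') (g'' * l2)" for u k1 k2 k3 z a l1 l2 l3 d
  have "z_mult H (z_mult H (z_tensor H p q h g) (z_tensor H p' q' h' g')) (z_tensor H p'' q'' h'' g'') =
    ?s3 h (\<lambda>h1 h2 h3. ?s3 g (\<lambda>g1 g2 g3. ?s3 (h2 * h') (\<lambda>k1 k2 k3. ?s3 (g' * g2) (\<lambda>l1 l2 l3.
      \<Theta> h1 k1 k2 k3 h3 g1 l1 l2 l3 g3))))"
    by (simp add: z_mult_z_tensor z_mult_sweedler3_left lin \<Theta>_def)
  also have "\<dots> = ?s3 h (\<lambda>h1 h2 h3. ?s3 (h2 * h') (\<lambda>k1 k2 k3. ?s3 g (\<lambda>g1 g2 g3. ?s3 (g' * g2) (\<lambda>l1 l2 l3.
      \<Theta> h1 k1 k2 k3 h3 g1 l1 l2 l3 g3))))"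
    by (intro sweedler3_cong) (rule sweedler3_swap)
  \<comment> \<open>The \<open>g\<close> side is regrouped here, in the opposite algebra; the next
    step does the same on the \<open>h\<close> side with the product of \<open>H\<close>.\<close>
  also have "\<dots> = ?s3 h (\<lambda>h1 h2 h3. ?s3 (h2 * h') (\<lambda>k1 k2 k3. ?s3 g' (\<lambda>l1 l2 l3. ?s3 g (\<lambda>g1 g2 g3.
      ?s2 g1 (\<lambda>a b. ?s2 g3 (\<lambda>c d. \<Theta> h1 k1 k2 k3 h3 a (l1 * b) (l2 * g2) (l3 * c) d))))))"
    unfolding \<Theta>_def
    by (rule sweedler3_cong, rule sweedler3_cong,
        rule sweedler3_mult_middle[where W = "z_space H" and m = "\<lambda>x y. y * x"]) (simp, (intro lin)+)
  also have "\<dots> = ?s3 h' (\<lambda>k1 k2 k3. ?s3 h (\<lambda>h1 h2 h3. ?s2 h1 (\<lambda>u v. ?s2 h3 (\<lambda>w z.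
      ?s3 g' (\<lambda>l1 l2 l3. ?s3 g (\<lambda>g1 g2 g3. ?s2 g1 (\<lambda>a b. ?s2 g3 (\<lambda>c d.
        \<Theta> u (v * k1) (h2 * k2) (w * k3) z a (l1 * b) (l2 * g2) (l3 * c) d))))))))"
    unfolding \<Theta>_def
    by (rule sweedler3_mult_middle[where W = "z_space H" and m = "\<lambda>x y. x * y"]) (simp, (intro lin)+)
  also have "\<dots> = ?s3 h' (\<lambda>k1 k2 k3. ?s3 h (\<lambda>h1 h2 h3. ?s3 g' (\<lambda>l1 l2 l3. ?s3 g (\<lambda>g1 g2 g3.
      ?s2 h1 (\<lambda>u v. ?s2 h3 (\<lambda>w z. ?s2 g1 (\<lambda>a b. ?s2 g3 (\<lambda>c d.
        \<Theta> u (v * k1) (h2 * k2) (w * k3) z a (l1 * b) (l2 * g2) (l3 * c) d))))))))"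
    by (simp only: sweedler32_swap)
  \<comment> \<open>The inner sums are put into the order in which
    \<open>z_tensor_lreg_rreg_dmult\<close> generates them.\<close>
  also have "\<dots> = ?s3 h' (\<lambda>k1 k2 k3. ?s3 h (\<lambda>h1 h2 h3. ?s3 g' (\<lambda>l1 l2 l3. ?s3 g (\<lambda>g1 g2 g3.
      ?s2 h1 (\<lambda>u v. ?s2 g1 (\<lambda>a b. ?s2 h3 (\<lambda>w z. ?s2 g3 (\<lambda>c d.
        \<Theta> u (v * k1) (h2 * k2) (w * k3) z a (l1 * b) (l2 * g2) (l3 * c) d))))))))"
    by (rule sweedler3_cong, rule sweedler3_cong, rule sweedler3_cong, rule sweedler3_cong,
        rule sweedler2_cong, rule sweedler2_swap)
  also have "\<dots> = ?s3 h' (\<lambda>k1 k2 k3. ?s3 g' (\<lambda>l1 l2 l3. ?s3 h (\<lambda>h1 h2 h3. ?s3 g (\<lambda>g1 g2 g3.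
      ?s2 h1 (\<lambda>u v. ?s2 g1 (\<lambda>a b. ?s2 h3 (\<lambda>w z. ?s2 g3 (\<lambda>c d.
        \<Theta> u (v * k1) (h2 * k2) (w * k3) z a (l1 * b) (l2 * g2) (l3 * c) d))))))))"
    by (rule sweedler3_cong, rule sweedler3_swap)
  \<comment> \<open>Best read backwards: the module algebra property expands the actions on the
    products with p' and q', and iterated actions combine into the products in the slots of
    \<open>\<Theta>\<close>.\<close>
  also have "\<dots> = ?s3 h' (\<lambda>k1 k2 k3. ?s3 g' (\<lambda>l1 l2 l3. ?s3 h (\<lambda>h1 h2 h3. ?s3 g (\<lambda>g1 g2 g3.
      z_tensor H (?m p (h1 \<rightharpoonup> ?m p' (k1 \<rightharpoonup> p'' \<leftharpoonup> l1) \<leftharpoonup> g1)) (?m (h3 \<rightharpoonup> ?m (k3 \<rightharpoonup> q'' \<leftharpoonup> l3) q' \<leftharpoonup> g3) q)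
        (h2 * (k2 * h'')) (g'' * l2 * g2)))))"
    by (simp only: \<Theta>_def z_tensor_lreg_rreg_dmult lin dmult_assoc lreg_rreg lreg_lreg rreg_rreg mult.assoc)
  also have "\<dots> = z_mult H (z_tensor H p q h g) (z_mult H (z_tensor H p' q' h' g') (z_tensor H p'' q'' h'' g''))"
    by (simp add: z_mult_z_tensor z_mult_sweedler3_right lin)
  finally show ?thesis .
qed

lemma z_mult_assoc:
  assumes x: "x \<in> vcar (z_space H)" and y: "y \<in> vcar (z_space H)" and z: "z \<in> vcar (z_space H)"
  shows "z_mult H (z_mult H x y) z = z_mult H x (z_mult H y z)"
proof (rule z_ext[where W = "z_space H" and F = "\<lambda>x. z_mult H (z_mult H x y) z" and G = "\<lambda>x. z_mult H x (z_mult H y z)",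
      OF _ _ _ _ x])
  fix p q h g assume pq: "p \<in> vcar (dual H)" "q \<in> vcar (dual H)"
  note lin = lin_intros pq
  let ?x = "z_tensor H p q h g"
  show "z_mult H (z_mult H ?x y) z = z_mult H ?x (z_mult H y z)"
  proof (rule z_ext[where W = "z_space H" and F = "\<lambda>y. z_mult H (z_mult H ?x y) z" and G = "\<lambda>y. z_mult H ?x (z_mult H y z)",
      OF _ _ _ _ y])
    fix p' q' h' g' assume pq': "p' \<in> vcar (dual H)" "q' \<in> vcar (dual H)"
    note lin = lin pq'
    let ?y = "z_tensor H p' q' h' g'"
    show "z_mult H (z_mult H ?x ?y) z = z_mult H ?x (z_mult H ?y z)"
    proof (rule z_ext[where W = "z_space H" and F = "\<lambda>z. z_mult H (z_mult H ?x ?y) z" and G = "\<lambda>z. z_mult H ?x (z_mult H ?y z)",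
      OF _ _ _ _ z])
      fix p'' q'' h'' g'' assume pq'': "p'' \<in> vcar (dual H)" "q'' \<in> vcar (dual H)"
      show "z_mult H (z_mult H ?x ?y) (z_tensor H p'' q'' h'' g'') = z_mult H ?x (z_mult H ?y (z_tensor H p'' q'' h'' g''))"
        by (intro z_mult_assoc_tensor pq pq' pq'')
    qed (rule vec_space_tensor | intro lin)+
  qed (rule vec_space_tensor | intro lin z)+
qed (rule vec_space_tensor | intro lin_intros y z)+

lemma z_mult_one_left:
  assumes z: "z \<in> vcar (z_space H)"
  shows "z_mult H (z_tensor H (dunit H) (dunit H) 1 1) z = z"
proof (rule z_ext[where W = "z_space H" and F = "\<lambda>z. z_mult H (z_tensor H (dunit H) (dunit H) 1 1) z" and G = "\<lambda>z. z", OF _ _ _ _ z])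
  fix p q h g assume pq: "p \<in> vcar (dual H)" "q \<in> vcar (dual H)"
  note lin = lin_intros pq
  show "z_mult H (z_tensor H (dunit H) (dunit H) 1 1) (z_tensor H p q h g) = z_tensor H p q h g"
    by (simp add: z_mult_z_tensor lin, (subst sweedler3_one[where W = "z_space H"]; (intro lin)?)+)
      (simp add: dmult_counit_left dmult_counit_right lreg_one rreg_one lin)
qed (rule vec_space_tensor | intro lin_intros)+

lemma z_tensor_fscale:
  assumes "p \<in> vcar (dual H)" "q \<in> vcar (dual H)"
  shows "z_tensor H (fscale c p) q h g = vscale (z_space H) c (z_tensor H p q h g)"
    and "z_tensor H p (fscale c q) h g = vscale (z_space H) c (z_tensor H p q h g)"
  using linear_map_z_tensor(1)[OF linear_map_id assms(2) hspace_mem hspace_mem]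
    linear_map_z_tensor(2)[OF assms(1) linear_map_id hspace_mem hspace_mem] assms
  by (simp_all add: linear_map_def dual_def)

lemma dmult_fscale_counit:
  assumes "p \<in> vcar (dual H)"
  shows "dmult H p (fscale c (dunit H)) = fscale c p" "dmult H (fscale c (dunit H)) p = fscale c p"
  using linear_map_dmult_right[OF linear_map_id assms] linear_map_dmult_left[OF linear_map_id assms] assms
  by (simp_all add: linear_map_def dual_def counit_mem[unfolded dual_def, simplified]
      dmult_counit_left[unfolded dual_def, simplified] dmult_counit_right[unfolded dual_def, simplified])

lemma rreg_fscale: "fscale c p \<leftharpoonup> a = fscale c ((p :: 'h \<Rightarrow> 'k) \<leftharpoonup> a)"
  by (simp add: rreg_def fscale_def)

lemma fscale_fscale: "fscale c (fscale d p) = fscale (c * d) (p :: 'h \<Rightarrow> 'k)"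
  by (simp add: fscale_def mult.assoc)

lemma fscale_mem [lin_intros]: "p \<in> vcar (dual H) \<Longrightarrow> fscale c p \<in> vcar (dual H)"
  using vec_space_scale[OF vec_space_dual, of p c] by (simp add: dual_def)

lemma z_mult_one_right:
  assumes z: "z \<in> vcar (z_space H)"
  shows "z_mult H z (z_tensor H (dunit H) (dunit H) 1 1) = z"
proof (rule z_ext[where W = "z_space H" and F = "\<lambda>z. z_mult H z (z_tensor H (dunit H) (dunit H) 1 1)" and G = "\<lambda>z. z", OF _ _ _ _ z])
  fix p q h g assume pq: "p \<in> vcar (dual H)" "q \<in> vcar (dual H)"
  note lin = lin_intros pq
  let ?v = "vscale (z_space H)"
  \<comment> \<open>The regular actions multiply the unit of \<open>H^*\<close> by counits, which
    absorb the outer factors of both coproducts.\<close>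
  have "z_mult H (z_tensor H p q h g) (z_tensor H (dunit H) (dunit H) 1 1) =
      sweedler3 H h (\<lambda>h1 h2 h3. sweedler3 H g (\<lambda>g1 g2 g3.
        ?v (counit H g1) (?v (counit H g3) (?v (counit H h1) (?v (counit H h3) (z_tensor H p q h2 g2))))))"
    by (simp add: z_mult_z_tensor lin lreg_counit rreg_counit rreg_fscale fscale_fscale dmult_fscale_counit
        z_tensor_fscale vscale_vscale mult_ac)
  also have "\<dots> = sweedler3 H h (\<lambda>h1 h2 h3. ?v (counit H h1) (?v (counit H h3) (z_tensor H p q h2 g)))"
    by (intro sweedler3_cong sweedler3_counit lin)
  also have "\<dots> = z_tensor H p q h g"
    by (rule sweedler3_counit) (intro lin)+
  finally show "z_mult H (z_tensor H p q h g) (z_tensor H (dunit H) (dunit H) 1 1) = z_tensor H p q h g" .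
qed (rule vec_space_tensor | intro lin_intros)+

end


section \<open>The isomorphism\<close>

context fd_hopf_algebra
begin

lemma antipode_antipode_inv [simp]: "antipode H (antipode_inv H x) = x"
  using bij_antipode by (simp add: bij_is_surj surj_f_inv_f)

lemma linear_map_antipode_inv [lin_intros]:
  assumes "linear_map X (hspace H) k"
  shows "linear_map X (hspace H) (\<lambda>x. antipode_inv H (k x))"
proof (rule linear_map_compose[where f = "antipode_inv H", OF _ assms])
  have inj: "antipode H x = antipode H y \<Longrightarrow> x = y" for x y
    using bij_antipode by (simp add: bij_is_inj inj_eq)
  have S: "linear_map (hspace H) (hspace H) (\<lambda>x. antipode H x)"
    by (intro lin_intros)
  show "linear_map (hspace H) (hspace H) (antipode_inv H)"
    unfolding linear_map_def
    by (intro conjI ballI allI; (rule inj)?) (insert S, simp_all add: linear_map_def)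
qed

text \<open>Applying the injective S reverses each product and leads back to an antipode axiom of
  \<open>H\<close>. The reversed order reflects that the inverse of S is the antipode of the
  opposite algebra.\<close>

lemma antipode_inv_right: "sweedler2 H h (\<lambda>a b. b * antipode_inv H a) = hscale H (counit H h) 1"
  and antipode_inv_left: "sweedler2 H h (\<lambda>a b. antipode_inv H b * a) = hscale H (counit H h) 1"
proof -
  let ?S = "antipode H"
  have S: "linear_map (hspace H) (hspace H) (\<lambda>x. ?S x)"
    by (intro lin_intros)
  have inj: "?S x = ?S y \<Longrightarrow> x = y" for x y
    using bij_antipode by (simp add: bij_is_inj inj_eq)
  note push = sweedler2_push[where W = "hspace H" and W' = "hspace H" and F = "?S", OF S vec_space_hspace hspace_mem]
  have one: "?S (hscale H c 1) = hscale H c 1" for c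
    using linear_map_hscale[OF S] by (simp add: antipode_one hspace_def)
  show "sweedler2 H h (\<lambda>a b. b * antipode_inv H a) = hscale H (counit H h) 1"
    by (rule inj) (simp add: push antipode_mult antipode_right one)
  show "sweedler2 H h (\<lambda>a b. antipode_inv H b * a) = hscale H (counit H h) 1"
    by (rule inj) (simp add: push antipode_mult antipode_left one)
qed

lemma linear_map_beta [lin_intros]:
  assumes "linear_map X (x_space H) k"
  shows "linear_map X (z_space H) (\<lambda>x. beta H (k x))"
  unfolding beta_def x_lift_eq_lift4 by (intro lift4_intros lin_intros assms)

lemma linear_map_beta_inv [lin_intros]:
  assumes "linear_map X (z_space H) k"
  shows "linear_map X (x_space H) (\<lambda>x. beta_inv H (k x))"
  unfolding beta_inv_def z_lift_eq_lift4 by (intro lift4_intros lin_intros assms)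

lemma beta_mem [lin_intros]: "x \<in> vcar (x_space H) \<Longrightarrow> beta H x \<in> vcar (z_space H)"
  by (rule linear_map_mem[OF linear_map_beta[OF linear_map_id]])

lemma beta_inv_mem [lin_intros]: "z \<in> vcar (z_space H) \<Longrightarrow> beta_inv H z \<in> vcar (x_space H)"
  by (rule linear_map_mem[OF linear_map_beta_inv[OF linear_map_id]])

lemma beta_x_tensor:
  assumes "p \<in> vcar (dual H)" "q \<in> vcar (dual H)"
  shows "beta H (x_tensor H g h p q) =
    sweedler3 H g (\<lambda>g1 g2 g3. sweedler3 H h (\<lambda>h1 h2 h3.
      z_tensor H (h1 \<rightharpoonup> p \<leftharpoonup> g1) (h3 \<rightharpoonup> q \<leftharpoonup> g3) h2 g2))"
  unfolding beta_def by (rule x_lift_x_tensor[where W = "z_space H", OF _ _ assms]) (intro lin_intros)+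

lemma beta_inv_z_tensor:
  assumes "p \<in> vcar (dual H)" "q \<in> vcar (dual H)"
  shows "beta_inv H (z_tensor H p q h g) =
    sweedler3 H g (\<lambda>g1 g2 g3. sweedler3 H h (\<lambda>h1 h2 h3.
      x_tensor H g2 h2 (antipode_inv H h1 \<rightharpoonup> p \<leftharpoonup> antipode H g1) (antipode H h3 \<rightharpoonup> q \<leftharpoonup> antipode_inv H g3)))"
  unfolding beta_inv_def by (rule z_lift_z_tensor[where W = "x_space H", OF _ _ assms]) (intro lin_intros)+

lemma beta_sweedler3:
  assumes "\<And>a b c. f a b c \<in> vcar (x_space H)"
  shows "beta H (sweedler3 H h f) = sweedler3 H h (\<lambda>a b c. beta H (f a b c))"
  by (rule sweedler3_push[where W = "x_space H" and W' = "z_space H" and F = "beta H"])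
    (intro lin_intros assms linear_map_beta[OF linear_map_id])+

lemma beta_inv_sweedler3:
  assumes "\<And>a b c. f a b c \<in> vcar (z_space H)"
  shows "beta_inv H (sweedler3 H h f) = sweedler3 H h (\<lambda>a b c. beta_inv H (f a b c))"
  by (rule sweedler3_push[where W = "z_space H" and W' = "x_space H" and F = "beta_inv H"])
    (intro lin_intros assms linear_map_beta_inv[OF linear_map_id])+

text \<open>Order decides between S and its inverse. Where the earlier coproduct factor stands on
  the left, as in S(g1) l1 and k3 S(h3), the antipode cancels; where it stands on the right, as in
  k1 S^{-1}(h1) and S^{-1}(g3) l3, the inverse does. The same rule governs
  \<open>beta_inv_beta\<close>.\<close>

lemma beta_beta_inv:
  assumes z: "z \<in> vcar (z_space H)"
  shows "beta H (beta_inv H z) = z"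
proof (rule z_ext[where W = "z_space H" and F = "\<lambda>z. beta H (beta_inv H z)" and G = "\<lambda>z. z", OF _ _ _ _ z])
  fix p q h g assume pq: "p \<in> vcar (dual H)" "q \<in> vcar (dual H)"
  note lin = lin_intros pq
  let ?S = "antipode H" and ?T = "antipode_inv H" and ?s = "sweedler3 H"
  have "beta H (beta_inv H (z_tensor H p q h g)) =
    ?s g (\<lambda>g1 g2 g3. ?s h (\<lambda>h1 h2 h3. ?s g2 (\<lambda>l1 l2 l3. ?s h2 (\<lambda>k1 k2 k3.
      z_tensor H ((k1 * ?T h1) \<rightharpoonup> p \<leftharpoonup> (?S g1 * l1)) ((k3 * ?S h3) \<rightharpoonup> q \<leftharpoonup> (?T g3 * l3)) k2 l2))))"
    by (simp add: beta_inv_z_tensor beta_sweedler3 beta_x_tensor lin lreg_rreg lreg_lreg rreg_rreg)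
  \<comment> \<open>Each nested pair of sums, over pieces of \<open>h\<close> and over pieces of
    \<open>g\<close>, must be contiguous for \<open>sweedler3_cancel\<close>.\<close>
  also have "\<dots> = ?s g (\<lambda>g1 g2 g3. ?s g2 (\<lambda>l1 l2 l3. ?s h (\<lambda>h1 h2 h3. ?s h2 (\<lambda>k1 k2 k3.
      z_tensor H ((k1 * ?T h1) \<rightharpoonup> p \<leftharpoonup> (?S g1 * l1)) ((k3 * ?S h3) \<rightharpoonup> q \<leftharpoonup> (?T g3 * l3)) k2 l2))))"
    by (rule sweedler3_cong, rule sweedler3_swap)
  also have "\<dots> = ?s g (\<lambda>g1 g2 g3. ?s g2 (\<lambda>l1 l2 l3.
      z_tensor H (1 \<rightharpoonup> p \<leftharpoonup> (?S g1 * l1)) (1 \<rightharpoonup> q \<leftharpoonup> (?T g3 * l3)) h l2))"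
    by (rule sweedler3_cong, rule sweedler3_cong,
        rule sweedler3_cancel[where W = "z_space H" and \<sigma> = "\<lambda>a b. b * ?T a" and \<tau> = "\<lambda>a b. a * ?S b"])
      (intro lin antipode_right antipode_inv_right)+
  also have "\<dots> = z_tensor H (1 \<rightharpoonup> p \<leftharpoonup> 1) (1 \<rightharpoonup> q \<leftharpoonup> 1) h g"
    by (rule sweedler3_cancel[where W = "z_space H" and \<sigma> = "\<lambda>a b. ?S a * b" and \<tau> = "\<lambda>a b. ?T b * a"])
      (intro lin antipode_left antipode_inv_left)+
  finally show "beta H (beta_inv H (z_tensor H p q h g)) = z_tensor H p q h g"
    by (simp add: lreg_one rreg_one)
qed (rule vec_space_tensor | intro lin_intros)+

lemma beta_inv_beta:
  assumes x: "x \<in> vcar (x_space H)"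
  shows "beta_inv H (beta H x) = x"
proof (rule x_ext[where W = "x_space H" and F = "\<lambda>x. beta_inv H (beta H x)" and G = "\<lambda>x. x", OF _ _ _ _ x])
  fix g h p q assume pq: "p \<in> vcar (dual H)" "q \<in> vcar (dual H)"
  note lin = lin_intros pq
  let ?S = "antipode H" and ?T = "antipode_inv H" and ?s = "sweedler3 H"
  have "beta_inv H (beta H (x_tensor H g h p q)) =
    ?s g (\<lambda>g1 g2 g3. ?s h (\<lambda>h1 h2 h3. ?s g2 (\<lambda>l1 l2 l3. ?s h2 (\<lambda>k1 k2 k3.
      x_tensor H l2 k2 ((?T k1 * h1) \<rightharpoonup> p \<leftharpoonup> (g1 * ?S l1)) ((?S k3 * h3) \<rightharpoonup> q \<leftharpoonup> (g3 * ?T l3))))))"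
    by (simp add: beta_x_tensor beta_inv_sweedler3 beta_inv_z_tensor lin lreg_rreg lreg_lreg rreg_rreg)
  also have "\<dots> = ?s g (\<lambda>g1 g2 g3. ?s g2 (\<lambda>l1 l2 l3. ?s h (\<lambda>h1 h2 h3. ?s h2 (\<lambda>k1 k2 k3.
      x_tensor H l2 k2 ((?T k1 * h1) \<rightharpoonup> p \<leftharpoonup> (g1 * ?S l1)) ((?S k3 * h3) \<rightharpoonup> q \<leftharpoonup> (g3 * ?T l3))))))"
    by (rule sweedler3_cong, rule sweedler3_swap)
  also have "\<dots> = ?s g (\<lambda>g1 g2 g3. ?s g2 (\<lambda>l1 l2 l3.
      x_tensor H l2 h (1 \<rightharpoonup> p \<leftharpoonup> (g1 * ?S l1)) (1 \<rightharpoonup> q \<leftharpoonup> (g3 * ?T l3))))"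
    by (rule sweedler3_cong, rule sweedler3_cong,
        rule sweedler3_cancel[where W = "x_space H" and \<sigma> = "\<lambda>a b. ?T b * a" and \<tau> = "\<lambda>a b. ?S a * b"])
      (intro lin antipode_left antipode_inv_left)+
  also have "\<dots> = x_tensor H g h (1 \<rightharpoonup> p \<leftharpoonup> 1) (1 \<rightharpoonup> q \<leftharpoonup> 1)"
    by (rule sweedler3_cancel[where W = "x_space H" and \<sigma> = "\<lambda>a b. a * ?S b" and \<tau> = "\<lambda>a b. b * ?T a"])
      (intro lin antipode_right antipode_inv_right)+
  finally show "beta_inv H (beta H (x_tensor H g h p q)) = x_tensor H g h p q"
    by (simp add: lreg_one rreg_one)
qed (rule vec_space_tensor | intro lin_intros)+

section \<open>The product of \<open>X\<close> on elementary tensors\<close>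

lemma linear_map_x_mult_right [lin_intros]:
  assumes "x \<in> vcar (x_space H)" "linear_map X (x_space H) k"
  shows "linear_map X (x_space H) (\<lambda>y. x_mult H x (k y))"
  unfolding x_mult_def x_lift_eq_lift4
  by (intro lift4_intros lin_intros assms)

lemma linear_map_x_mult_left [lin_intros]:
  assumes "x' \<in> vcar (x_space H)" "linear_map X (x_space H) k"
  shows "linear_map X (x_space H) (\<lambda>y. x_mult H (k y) x')"
  unfolding x_mult_def x_lift_eq_lift4
  by (intro lift4_intros lin_intros assms)

lemma x_mult_mem [lin_intros]: "x \<in> vcar (x_space H) \<Longrightarrow> x' \<in> vcar (x_space H) \<Longrightarrow> x_mult H x x' \<in> vcar (x_space H)"
  by (rule linear_map_mem[OF linear_map_x_mult_right[OF _ linear_map_id]])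

lemma x_mult_x_tensor:
  assumes "p \<in> vcar (dual H)" "q \<in> vcar (dual H)" "p' \<in> vcar (dual H)" "q' \<in> vcar (dual H)"
  shows "x_mult H (x_tensor H g h p q) (x_tensor H g' h' p' q') =
    sweedler3 H g' (\<lambda>g1 g2 g3. sweedler3 H h' (\<lambda>h1 h2 h3.
      x_tensor H (g2 * g) (h * h2) (dmult H (antipode_inv H h1 \<rightharpoonup> p \<leftharpoonup> antipode H g1) p')
        (dmult H q' (antipode H h3 \<rightharpoonup> q \<leftharpoonup> antipode_inv H g3))))"
proof -
  have x': "x_tensor H g' h' p' q' \<in> vcar (x_space H)" by (intro lin_intros assms)
  let ?f = "\<lambda>g h p q g' h' p' q'. sweedler3 H g' (\<lambda>g1 g2 g3. sweedler3 H h' (\<lambda>h1 h2 h3.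
      x_tensor H (g2 * g) (h * h2) (dmult H (antipode_inv H h1 \<rightharpoonup> p \<leftharpoonup> antipode H g1) p')
        (dmult H q' (antipode H h3 \<rightharpoonup> q \<leftharpoonup> antipode_inv H g3))))"
  have inner: "quadrilinear_map (hspace H) (hspace H) (dual H) (dual H) (x_space H) (?f g h p q)"
    by (intro lin_intros assms)
  have outer: "quadrilinear_map (hspace H) (hspace H) (dual H) (dual H) (x_space H)
      (\<lambda>g h p q. x_lift H (?f g h p q) (x_tensor H g' h' p' q'))"
    unfolding x_lift_eq_lift4 by (intro lift4_intros lin_intros x')
  show ?thesis
    unfolding x_mult_def x_lift_x_tensor[OF vec_space_tensor outer assms(1,2)]
    by (rule x_lift_x_tensor[OF vec_space_tensor inner assms(3,4)])
qed

section \<open>Products inside and between the two subalgebras of \<open>Z\<close>\<close>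

lemma z_mult_hh_dd:
  assumes "p \<in> vcar (dual H)" "q \<in> vcar (dual H)"
  shows "z_mult H (z_tensor H (dunit H) (dunit H) h g) (z_tensor H p q 1 1) = beta H (x_tensor H g h p q)"
  using assms
  by (simp add: z_mult_z_tensor beta_x_tensor lin_intros dmult_counit_left dmult_counit_right)
    (rule sweedler3_swap)

lemma z_mult_dd_hh:
  assumes "p \<in> vcar (dual H)" "q \<in> vcar (dual H)"
  shows "z_mult H (z_tensor H p q 1 1) (z_tensor H (dunit H) (dunit H) h g) = z_tensor H p q h g"
  using assms
  by (simp add: z_mult_z_tensor lin_intros, (subst sweedler3_one[where W = "z_space H"]; (intro lin_intros assms)?)+)
    (simp add: dmult_counit_left dmult_counit_right lreg_one rreg_one)

lemma z_mult_dd_dd: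
  assumes "p \<in> vcar (dual H)" "q \<in> vcar (dual H)" "p' \<in> vcar (dual H)" "q' \<in> vcar (dual H)"
  shows "z_mult H (z_tensor H p q 1 1) (z_tensor H p' q' 1 1) = z_tensor H (dmult H p p') (dmult H q' q) 1 1"
  using assms
  by (simp add: z_mult_z_tensor lin_intros, (subst sweedler3_one[where W = "z_space H"]; (intro lin_intros assms)?)+)
    (simp add: lreg_one rreg_one)

lemma z_mult_hh_hh:
  "z_mult H (z_tensor H (dunit H) (dunit H) h g) (z_tensor H (dunit H) (dunit H) h' g') =
   z_tensor H (dunit H) (dunit H) (h * h') (g' * g)"
proof -
  let ?v = "vscale (z_space H)" and ?z = "z_tensor H (dunit H) (dunit H)"
  have "z_mult H (?z h g) (?z h' g') =
      sweedler3 H h (\<lambda>h1 h2 h3. sweedler3 H g (\<lambda>g1 g2 g3.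
        ?v (counit H g1) (?v (counit H g3) (?v (counit H h1) (?v (counit H h3) (?z (h2 * h') (g' * g2)))))))"
    by (simp add: z_mult_z_tensor lin_intros lreg_counit rreg_counit rreg_fscale fscale_fscale dmult_fscale_counit
        z_tensor_fscale vscale_vscale mult_ac)
  also have "\<dots> = sweedler3 H h (\<lambda>h1 h2 h3. ?v (counit H h1) (?v (counit H h3) (?z (h2 * h') (g' * g))))"
    by (intro sweedler3_cong sweedler3_counit lin_intros)
  also have "\<dots> = ?z (h * h') (g' * g)"
    by (rule sweedler3_counit) (intro lin_intros)+
  finally show ?thesis .
qed

lemma beta_x_mult:
  assumes x: "x \<in> vcar (x_space H)" and y: "y \<in> vcar (x_space H)"
  shows "beta H (x_mult H x y) = z_mult H (beta H x) (beta H y)"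
proof (rule x_ext[where W = "z_space H" and F = "\<lambda>x. beta H (x_mult H x y)" and G = "\<lambda>x. z_mult H (beta H x) (beta H y)",
      OF _ _ _ _ x])
  fix g h p q assume pq: "p \<in> vcar (dual H)" "q \<in> vcar (dual H)"
  let ?x = "x_tensor H g h p q"
  show "beta H (x_mult H ?x y) = z_mult H (beta H ?x) (beta H y)"
  proof (rule x_ext[where W = "z_space H" and F = "\<lambda>y. beta H (x_mult H ?x y)" and G = "\<lambda>y. z_mult H (beta H ?x) (beta H y)",
        OF _ _ _ _ y])
    fix g' h' p' q' assume pq': "p' \<in> vcar (dual H)" "q' \<in> vcar (dual H)"
    note lin = lin_intros pq pq'
    let ?hh = "z_tensor H (dunit H) (dunit H)" and ?dd = "\<lambda>p q. z_tensor H p q 1 1"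
    let ?P = "\<lambda>h1 g1. antipode_inv H h1 \<rightharpoonup> p \<leftharpoonup> antipode H g1"
      and ?Q = "\<lambda>h3 g3. antipode H h3 \<rightharpoonup> q \<leftharpoonup> antipode_inv H g3"
    \<comment> \<open>Each term of the exchange rule factors in \<open>Z\<close>:
      \<open>?hh h g\<close> and \<open>?dd p' q'\<close> come out on the two sides, and
      \<open>beta\<close> of the exchanged pair stays between them.\<close>
    have "beta H (x_tensor H (g2 * g) (h * h2) (dmult H (?P h1 g1) p') (dmult H q' (?Q h3 g3))) =
        z_mult H (?hh h g) (z_mult H (beta H (x_tensor H g2 h2 (?P h1 g1) (?Q h3 g3))) (?dd p' q'))"
      for g1 g2 g3 h1 h2 h3
    proof -
      have "beta H (x_tensor H (g2 * g) (h * h2) (dmult H (?P h1 g1) p') (dmult H q' (?Q h3 g3))) =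
          z_mult H (?hh (h * h2) (g2 * g)) (?dd (dmult H (?P h1 g1) p') (dmult H q' (?Q h3 g3)))"
        by (rule z_mult_hh_dd[symmetric]) (intro lin)+
      also have "\<dots> = z_mult H (z_mult H (?hh h g) (?hh h2 g2)) (z_mult H (?dd (?P h1 g1) (?Q h3 g3)) (?dd p' q'))"
        by (simp add: z_mult_hh_hh z_mult_dd_dd lin)
      also have "\<dots> = z_mult H (?hh h g) (z_mult H (z_mult H (?hh h2 g2) (?dd (?P h1 g1) (?Q h3 g3))) (?dd p' q'))"
        by (simp add: z_mult_assoc lin)
      finally show ?thesis by (simp add: z_mult_hh_dd lin)
    qed
    then have "beta H (x_mult H ?x (x_tensor H g' h' p' q')) =
        sweedler3 H g' (\<lambda>g1 g2 g3. sweedler3 H h' (\<lambda>h1 h2 h3.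
          z_mult H (?hh h g) (z_mult H (beta H (x_tensor H g2 h2 (?P h1 g1) (?Q h3 g3))) (?dd p' q'))))"
      by (simp add: x_mult_x_tensor beta_sweedler3 lin)
    \<comment> \<open>With the constant outer factors pulled out, the sums over the coproducts of
      \<open>g'\<close> and \<open>h'\<close> are those of \<open>beta_inv\<close> at
      \<open>z_tensor H p q h' g'\<close>. By \<open>z_mult_dd_hh\<close> this tensor is the product
      of \<open>?dd p q\<close> and \<open>?hh h' g'\<close>.\<close>
    also have "\<dots> = z_mult H (?hh h g) (z_mult H (beta H (beta_inv H (z_tensor H p q h' g'))) (?dd p' q'))"
      by (simp add: beta_inv_z_tensor beta_sweedler3 z_mult_sweedler3_left z_mult_sweedler3_right lin)
    also have "\<dots> = z_mult H (?hh h g) (z_mult H (z_mult H (?dd p q) (?hh h' g')) (?dd p' q'))"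
      by (simp add: beta_beta_inv z_mult_dd_hh lin)
    also have "\<dots> = z_mult H (z_mult H (?hh h g) (?dd p q)) (z_mult H (?hh h' g') (?dd p' q'))"
      by (simp add: z_mult_assoc lin)
    also have "\<dots> = z_mult H (beta H ?x) (beta H (x_tensor H g' h' p' q'))"
      by (simp add: z_mult_hh_dd lin)
    finally show "beta H (x_mult H ?x (x_tensor H g' h' p' q')) = z_mult H (beta H ?x) (beta H (x_tensor H g' h' p' q'))" .
  qed (rule vec_space_tensor | intro lin_intros pq)+
qed (rule vec_space_tensor | intro lin_intros y)+

lemma beta_one: "beta H (x_tensor H 1 1 (dunit H) (dunit H)) = z_tensor H (dunit H) (dunit H) 1 1"
  by (simp add: z_mult_hh_dd[symmetric] z_mult_dd_hh lin_intros)

section \<open>Algebra axioms and the isomorphism\<close>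

lemma x_space_eqI:
  "x \<in> vcar (x_space H) \<Longrightarrow> y \<in> vcar (x_space H) \<Longrightarrow> beta H x = beta H y \<Longrightarrow> x = y"
  by (metis beta_inv_beta)

lemma assoc_algebra_Z: "assoc_algebra (Z_alg H)"
proof -
  have "vec_space (z_space H)" by (intro lin_intros)
  \<comment> \<open>\<open>Z_alg H\<close> is a record extension with the carrier and scaling of
    \<open>z_space H\<close>, so facts pass between the two by unfolding.\<close>
  then have 1: "vec_space (Z_alg H)" by (simp add: vec_space_def Z_alg_def)
  have "bilinear_map (z_space H) (z_space H) (z_space H) (z_mult H)" by (intro lin_intros)
  then have 2: "bilinear_map (Z_alg H) (Z_alg H) (Z_alg H) (z_mult H)"
    by (simp add: bilinear_map_def linear_map_def Z_alg_def)
  show ?thesis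
    using 1 2 by (simp add: assoc_algebra_def) (simp add: Z_alg_def z_mult_assoc z_mult_one_left z_mult_one_right lin_intros)
qed

lemma assoc_algebra_X: "assoc_algebra (X_alg H)"
proof -
  have "vec_space (x_space H)" by (intro lin_intros)
  then have 1: "vec_space (X_alg H)" by (simp add: vec_space_def X_alg_def)
  have "bilinear_map (x_space H) (x_space H) (x_space H) (x_mult H)" by (intro lin_intros)
  then have 2: "bilinear_map (X_alg H) (X_alg H) (X_alg H) (x_mult H)"
    by (simp add: bilinear_map_def linear_map_def X_alg_def)
  have 3: "x_mult H (x_mult H x y) z = x_mult H x (x_mult H y z)"
    if "x \<in> vcar (x_space H)" "y \<in> vcar (x_space H)" "z \<in> vcar (x_space H)" for x y z
    by (rule x_space_eqI) (simp_all add: beta_x_mult z_mult_assoc lin_intros that)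
  have 4: "x_mult H (x_tensor H 1 1 (dunit H) (dunit H)) x = x" "x_mult H x (x_tensor H 1 1 (dunit H) (dunit H)) = x"
    if "x \<in> vcar (x_space H)" for x
    by (rule x_space_eqI; simp add: beta_x_mult beta_one z_mult_one_left z_mult_one_right lin_intros that)+
  show ?thesis
    using 1 2 by (simp add: assoc_algebra_def) (simp add: X_alg_def 3 4 lin_intros)
qed

lemma algebra_iso_beta: "algebra_iso (X_alg H) (Z_alg H) (beta H)"
proof -
  have "linear_map (x_space H) (z_space H) (\<lambda>x. beta H x)" by (intro lin_intros)
  then have 1: "linear_map (X_alg H) (Z_alg H) (beta H)"
    by (simp add: linear_map_def X_alg_def Z_alg_def)
  have "bij_betw (beta H) (vcar (x_space H)) (vcar (z_space H))"
    by (rule bij_betw_byWitness[where f' = "beta_inv H"]) (auto simp: beta_inv_beta beta_beta_inv lin_intros)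
  then show ?thesis
    using assoc_algebra_X assoc_algebra_Z 1
    by (simp add: algebra_iso_def) (simp add: X_alg_def Z_alg_def beta_x_mult beta_one)
qed

end


section \<open>The actions on Hopf bimodules\<close>

context hopf_bimodule
begin

lemma vec_space_mspace [lin_intros]: "vec_space (mspace M)"
  using M.vector_space_axioms M.subspace_UNIV by (simp add: vec_space_def mspace_def)

lemma mspace_mem [lin_intros]: "m \<in> vcar (mspace M)"
  by (simp add: mspace_def)

lemma linear_map_lmul [lin_intros]:
  "linear_map X (dual H) k \<Longrightarrow> linear_map X (mspace M) (\<lambda>x. lmul M (k x) m)"
  "linear_map X (mspace M) l \<Longrightarrow> p \<in> vcar (dual H) \<Longrightarrow> linear_map X (mspace M) (\<lambda>x. lmul M p (l x))"
  by (rule bilinear_map_left[OF lmul_bilinear] bilinear_map_right[OF lmul_bilinear]; simp add: mspace_def)+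

lemma linear_map_rmul [lin_intros]:
  "linear_map X (dual H) k \<Longrightarrow> linear_map X (mspace M) (\<lambda>x. rmul M m (k x))"
  "linear_map X (mspace M) l \<Longrightarrow> p \<in> vcar (dual H) \<Longrightarrow> linear_map X (mspace M) (\<lambda>x. rmul M (l x) p)"
  by (rule bilinear_map_left[OF rmul_bilinear] bilinear_map_right[OF rmul_bilinear]; simp add: mspace_def)+

lemma linear_map_mscale [lin_intros]:
  "linear_map X ground k \<Longrightarrow> linear_map X (mspace M) (\<lambda>x. mscale M (k x) m)"
  "linear_map X (mspace M) l \<Longrightarrow> linear_map X (mspace M) (\<lambda>x. mscale M c (l x))"
  using linear_map_vscale_left[OF vec_space_mspace _ mspace_mem] linear_map_vscale_right[OF vec_space_mspace]
  by (simp_all add: mspace_def)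

lemma lcoact_mem: "lcoact M m \<in> vcar (dm_space H M)"
  by (rule linear_map_mem[OF lcoact_linear mspace_mem])

lemma rcoact_mem: "rcoact M m \<in> vcar (md_space H M)"
  by (rule linear_map_mem[OF rcoact_linear mspace_mem])

lemma coact_mem: "coact H M m \<in> vcar (tensor (dual H) (md_space H M))"
  unfolding coact_def lsweedler_def rsweedler_def dmd_tensor_def
  by (intro tlift_push(2)[OF _ _ _ linear_map_id] lin_intros lcoact_mem rcoact_mem)

lemma linear_map_bisweedler_param:
  assumes "vec_space W"
    and "\<And>a n b. a \<in> vcar (dual H) \<Longrightarrow> b \<in> vcar (dual H) \<Longrightarrow> linear_map V W (\<lambda>x. f x a n b)"
  shows "linear_map V W (\<lambda>x. bisweedler H M m (f x))"
  unfolding bisweedler_def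
  by (intro linear_map_tlift_param lin_intros coact_mem assms)

text \<open>Both sides run over representations chosen from the tensors alone, so the sums commute
  for arbitrary summands. Two exchanges occur because \<open>bisweedler\<close> nests two
  lifts.\<close>

lemma bisweedler_sweedler2_swap:
  "bisweedler H M m (\<lambda>a n b. sweedler2 H h (\<lambda>c d. f a n b c d)) =
   sweedler2 H h (\<lambda>c d. bisweedler H M m (\<lambda>a n b. f a n b c d))"
proof -
  have "tlift (mspace M) (dual H) (\<lambda>n b. sweedler2 H h (\<lambda>c d. f a n b c d)) t =
      sweedler2 H h (\<lambda>c d. tlift (mspace M) (dual H) (\<lambda>n b. f a n b c d) t)" for a t
    unfolding sweedler2_def by (rule tlift_swap)
  then have "bisweedler H M m (\<lambda>a n b. sweedler2 H h (\<lambda>c d. f a n b c d)) =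
      tlift (dual H) (md_space H M) (\<lambda>a t. sweedler2 H h (\<lambda>c d. tlift (mspace M) (dual H) (\<lambda>n b. f a n b c d) t)) (coact H M m)"
    by (simp only: bisweedler_def)
  also have "\<dots> = sweedler2 H h (\<lambda>c d. bisweedler H M m (\<lambda>a n b. f a n b c d))"
    unfolding bisweedler_def sweedler2_def by (rule tlift_swap)
  finally show ?thesis .
qed

lemma bisweedler_sweedler3_swap:
  "bisweedler H M m (\<lambda>a n b. sweedler3 H h (\<lambda>c d e. f a n b c d e)) =
   sweedler3 H h (\<lambda>c d e. bisweedler H M m (\<lambda>a n b. f a n b c d e))"
  by (simp only: sweedler3_def bisweedler_sweedler2_swap)

lemma x_act_quadrilinear:
  "quadrilinear_map (hspace H) (hspace H) (dual H) (dual H) (mspace M)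
    (\<lambda>g h p q. bisweedler H M m (\<lambda>a n b. sweedler3 H g (\<lambda>g1 g2 g3. sweedler3 H h (\<lambda>h1 h2 h3.
      mscale M (a g2 * b h2) (rmul M (lmul M (h1 \<rightharpoonup> p \<leftharpoonup> g1) n) (h3 \<rightharpoonup> q \<leftharpoonup> g3))))))"
  by (intro quadrilinear_mapI linear_map_bisweedler_param lin_intros; simp add: H.dual_iff)

lemma z_act_quadrilinear:
  "quadrilinear_map (dual H) (dual H) (hspace H) (hspace H) (mspace M)
    (\<lambda>p q h g. bisweedler H M m (\<lambda>a n b. mscale M (a g * b h) (rmul M (lmul M p n) q)))"
  by (intro quadrilinear_mapI linear_map_bisweedler_param lin_intros; simp add: H.dual_iff)

lemma linear_map_x_act: "linear_map (x_space H) (mspace M) (\<lambda>x. x_act H M x m)"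
  unfolding x_act_def x_lift_eq_lift4
  by (intro H.lift4_intros lin_intros x_act_quadrilinear)

lemma linear_map_z_act: "linear_map (z_space H) (mspace M) (\<lambda>z. z_act H M z m)"
  unfolding z_act_def z_lift_eq_lift4
  by (intro H.lift4_intros lin_intros z_act_quadrilinear)

text \<open>On an elementary tensor the summand of \<open>x_act\<close> is that of
  \<open>z_act\<close> at the terms of the sum defining \<open>beta\<close>. It remains to move the
  coproduct sums outside the coaction sum and to use linearity of \<open>z_act\<close> in its
  algebra argument.\<close>

lemma x_act_eq_z_act_beta:
  assumes x: "x \<in> vcar (x_space H)"
  shows "x_act H M x m = z_act H M (beta H x) m"
proof (rule H.x_ext[where W = "mspace M" and F = "\<lambda>x. x_act H M x m" and G = "\<lambda>x. z_act H M (beta H x) m",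
      OF vec_space_mspace linear_map_x_act linear_map_compose[OF linear_map_z_act] _ x])
  show "linear_map (x_space H) (z_space H) (beta H)"
    by (rule H.linear_map_beta[OF linear_map_id])
  fix g h p q assume pq: "p \<in> vcar (dual H)" "q \<in> vcar (dual H)"
  note lin = lin_intros pq
  note push = H.sweedler3_push[where W = "z_space H" and F = "\<lambda>z. z_act H M z m", OF linear_map_z_act]
  have z_act: "z_act H M (z_tensor H p' q' h' g') m =
      bisweedler H M m (\<lambda>a n b. mscale M (a g' * b h') (rmul M (lmul M p' n) q'))"
    if "p' \<in> vcar (dual H)" "q' \<in> vcar (dual H)" for p' q' h' g'
    unfolding z_act_def by (rule H.z_lift_z_tensor[OF vec_space_mspace z_act_quadrilinear that])
  have "x_act H M (x_tensor H g h p q) m =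
      bisweedler H M m (\<lambda>a n b. sweedler3 H g (\<lambda>g1 g2 g3. sweedler3 H h (\<lambda>h1 h2 h3.
        mscale M (a g2 * b h2) (rmul M (lmul M (h1 \<rightharpoonup> p \<leftharpoonup> g1) n) (h3 \<rightharpoonup> q \<leftharpoonup> g3)))))"
    unfolding x_act_def by (rule H.x_lift_x_tensor[OF vec_space_mspace x_act_quadrilinear pq])
  also have "\<dots> = sweedler3 H g (\<lambda>g1 g2 g3. sweedler3 H h (\<lambda>h1 h2 h3.
      z_act H M (z_tensor H (h1 \<rightharpoonup> p \<leftharpoonup> g1) (h3 \<rightharpoonup> q \<leftharpoonup> g3) h2 g2) m))"
    by (simp add: bisweedler_sweedler3_swap z_act lin)
  also have "\<dots> = z_act H M (beta H (x_tensor H g h p q)) m"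
    by (simp add: H.beta_x_tensor push lin)
  finally show "x_act H M (x_tensor H g h p q) m = z_act H M (beta H (x_tensor H g h p q)) m" .
qed

end


theorem mainTheorem6:
  fixes H :: "('k::field, 'h::ring_1) hopf"
    and M :: "('k, 'h, 'm::ab_group_add) bimod"
  assumes "fd_hopf_algebra H"
  shows "algebra_iso (X_alg H) (Z_alg H) (beta H) \<and>
    (\<forall>x\<in>vcar (X_alg H). beta_inv H (beta H x) = x) \<and>
    (\<forall>z\<in>vcar (Z_alg H). beta_inv H z \<in> vcar (X_alg H) \<and> beta H (beta_inv H z) = z) \<and>
    (hopf_bimodule H M \<longrightarrow>
      (\<forall>x\<in>vcar (X_alg H). \<forall>m. x_act H M x m = z_act H M (beta H x) m))"
proof -
  interpret fd_hopf_algebra H by (rule assms)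
  have X: "vcar (X_alg H) = vcar (x_space H)" and Z: "vcar (Z_alg H) = vcar (z_space H)"
    by (simp_all add: X_alg_def Z_alg_def)
  show ?thesis
    unfolding X Z
    by (intro conjI ballI impI allI algebra_iso_beta beta_inv_beta beta_beta_inv beta_inv_mem
        hopf_bimodule.x_act_eq_z_act_beta)
qed

end
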